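(* Let $k \in \mathbb{N}$ (so $k \geq 1$), $p = 2k+1$ and $\mu \in \{1,-1\}$. Suppose that $u_0 \in E$ and $\hat{u}_0 \in L^1_{\xi,\eta}(\mathbb{R}^2)$. Then the Cauchy problem $$ i\partial_t u + \partial_x^2 u - |D_y| u = \mu |u|^{p-1}u, \qquad u(0,x,y) = u_0(x,y), \qquad (t,x,y) \in [-T,T]\times\mathbb{R}^2, $$ is locally well-posed in the following precise sense: there exists $T = T(\|u_0\|_E, \|\hat{u}_0\|_{L^1_{\xi,\eta}}) > 0$ (for fixed $k$ and $\mu$, depending on $u_0$ only through these two norms) such that the Cauchy problem has a unique solution $u$ on $[-T,T]$ satisfying $$ u \in C([-T,T]; E) \cap L^\infty([-T,T]\times\mathbb{R}^2) \quad\text{and}\quad \hat{u} \in L^\infty([-T,T]; L^1_{\xi,\eta}(\mathbb{R}^2)). $$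
   Context: Functions $u = u(t,x,y)$ are complex-valued, with $(x,y) \in \mathbb{R}^2$. The hat $\hat{\cdot}$ denotes the Fourier transform with respect to the spatial variables $(x,y)$, with dual variables $(\xi,\eta) \in \mathbb{R}^2$ (the normalization is immaterial), and $L^1_{\xi,\eta}(\mathbb{R}^2)$ is the usual $L^1$ space in $(\xi,\eta)$. The operator $|D_y| = (-\partial_y^2)^{1/2}$ is the Fourier multiplier with symbol $|\eta|$, and $|D_y|^{1/2}$ is the one with symbol $|\eta|^{1/2}$. For $s_1,s_2\in\mathbb{R}$, the anisotropic Sobolev space $H^{s_1,s_2}(\mathbb{R}^2)$ is the space of $f \in \mathcal{S}'(\mathbb{R}^2)$ with $$\|f\|_{H^{s_1,s_2}} = \Bigl(\int_{\mathbb{R}^2} \langle\xi\rangle^{2s_1}\langle\eta\rangle^{2s_2} |\hat f(\xi,\eta)|^2\, d\xi\, d\eta\Bigr)^{1/2} < \infty, \qquad \langle \cdot\rangle = \sqrt{1+|\cdot|^2}.$$ The energy space is $E = H^{1,0}(\mathbb{R}^2)\cap H^{0,1/2}(\mathbb{R}^2)$, equipped with the norm $$\|u\|_E = \bigl(\|\partial_x u\|_{L^2}^2 + \||D_y|^{1/2}u\|_{L^2}^2 + \|u\|_{L^2}^2\bigr)^{1/2}.$$ A solution on $[-T,T]$ is understood in the sense of the Duhamel formula: for all $t\in[-T,T]$, $$u(t) = S(t)u_0 - i\mu\int_0^t S(t-\tau)\bigl(|u|^{p-1}u\bigr)(\tau)\,d\tau,$$ as an identity in $L^2(\mathbb{R}^2)$,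 where $S(t) = \exp\{it(\partial_x^2 - |D_y|)\}$ is the unitary operator on $L^2(\mathbb{R}^2)$ given by the Fourier multiplier $e^{-it(\xi^2+|\eta|)}$. *)

theory Defs
  imports "HOL-Analysis.Analysis"
begin

section \<open>The Hilbert space of square integrable functions on the plane\<close>

definition square_integrable :: "(real \<times> real \<Rightarrow> complex) \<Rightarrow> bool" where
  "square_integrable f \<longleftrightarrow>
     f \<in> borel_measurable lborel \<and> integrable lborel (\<lambda>z. (norm (f z))\<^sup>2)"

definition L2_rel :: "(real \<times> real \<Rightarrow> complex) \<Rightarrow> (real \<times> real \<Rightarrow> complex) \<Rightarrow> bool" where
  "L2_rel f g \<longleftrightarrow> square_integrable f \<and> square_integrable g \<and> (AE z in lborel. f z = g z)"

lemma square_integrable_zero: "square_integrable (\<lambda>z. 0)"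
  by (simp add: square_integrable_def)

lemma square_integrable_add:
  assumes "square_integrable f" "square_integrable g"
  shows "square_integrable (\<lambda>z. f z + g z)"
proof -
  have [measurable]: "f \<in> borel_measurable lborel" "g \<in> borel_measurable lborel"
    using assms by (auto simp: square_integrable_def)
  have "integrable lborel (\<lambda>z. 2 * (norm (f z))\<^sup>2 + 2 * (norm (g z))\<^sup>2)"
    using assms by (auto simp: square_integrable_def)
  then have "integrable lborel (\<lambda>z. (norm (f z + g z))\<^sup>2)"
  proof (rule Bochner_Integration.integrable_bound)
    show "AE z in lborel. norm ((norm (f z + g z))\<^sup>2)
            \<le> norm (2 * (norm (f z))\<^sup>2 + 2 * (norm (g z))\<^sup>2)"
    proof (rule AE_I2)
      fix z
      have "(norm (f z + g z))\<^sup>2 \<le> (norm (f z) + norm (g z))\<^sup>2"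
        by (intro power_mono norm_triangle_ineq) auto
      also have "\<dots> \<le> 2 * (norm (f z))\<^sup>2 + 2 * (norm (g z))\<^sup>2"
        using zero_le_power2[of "norm (f z) - norm (g z)"]
        by (simp add: power2_eq_square algebra_simps)
      finally show "norm ((norm (f z + g z))\<^sup>2)
            \<le> norm (2 * (norm (f z))\<^sup>2 + 2 * (norm (g z))\<^sup>2)"
        by simp
    qed
  qed simp
  then show ?thesis by (simp add: square_integrable_def)
qed

lemma square_integrable_cmult:
  assumes "square_integrable f"
  shows "square_integrable (\<lambda>z. c * f z)"
  using assms by (auto simp: square_integrable_def norm_mult power_mult_distrib)

lemma borel_measurable_cnj [measurable]:
  fixes f :: "'a \<Rightarrow> complex"
  assumes "f \<in> borel_measurable M"
  shows "(\<lambda>x. cnj (f x)) \<in> borel_measurable M"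
  by (rule borel_measurable_continuous_on[OF _ assms]) (intro continuous_intros)

lemma square_integrable_mult_cnj:
  assumes "square_integrable f" "square_integrable g"
  shows "integrable lborel (\<lambda>z. f z * cnj (g z))"
proof -
  have [measurable]: "f \<in> borel_measurable lborel" "g \<in> borel_measurable lborel"
    using assms by (auto simp: square_integrable_def)
  have "integrable lborel (\<lambda>z. (norm (f z))\<^sup>2 + (norm (g z))\<^sup>2)"
    using assms by (auto simp: square_integrable_def)
  then show ?thesis
  proof (rule Bochner_Integration.integrable_bound)
    show "AE z in lborel. norm (f z * cnj (g z)) \<le> norm ((norm (f z))\<^sup>2 + (norm (g z))\<^sup>2)"
    proof (rule AE_I2)
      fix z
      have "2 * (norm (f z) * norm (g z)) \<le> (norm (f z))\<^sup>2 + (norm (g z))\<^sup>2"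
        using zero_le_power2[of "norm (f z) - norm (g z)"]
        by (simp add: power2_eq_square algebra_simps)
      moreover have "0 \<le> norm (f z) * norm (g z)" by simp
      ultimately have "norm (f z) * norm (g z) \<le> (norm (f z))\<^sup>2 + (norm (g z))\<^sup>2"
        by linarith
      then show "norm (f z * cnj (g z)) \<le> norm ((norm (f z))\<^sup>2 + (norm (g z))\<^sup>2)"
        by (simp add: norm_mult)
    qed
  qed simp
qed

text \<open>The type \<open>L2\<close> is $L^2(\mathbb{R}^2)$: complex-valued square integrable functions modulo
  equality almost everywhere.  \<open>abs_L2 f\<close> is the class of \<open>f\<close> (meaningful only for square
  integrable \<open>f\<close>) and \<open>rep_L2 u\<close> is some representative of \<open>u\<close>.\<close>

quotient_type L2 = "real \<times> real \<Rightarrow> complex" / partial: L2_rel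
proof (rule part_equivpI)
  show "\<exists>f. L2_rel f f"
    using square_integrable_zero by (auto simp: L2_rel_def)
  show "symp L2_rel"
    by (auto simp: symp_def L2_rel_def)
  show "transp L2_rel"
    by (auto simp: transp_def L2_rel_def)
qed

text \<open>Complex multiples; the library class for the vector space structure is over the reals.\<close>

lift_definition cscale :: "complex \<Rightarrow> L2 \<Rightarrow> L2" is "\<lambda>c f z. c * f z"
  by (auto simp: L2_rel_def square_integrable_cmult)

instantiation L2 :: real_inner
begin

lift_definition zero_L2 :: L2 is "\<lambda>z. 0"
  by (simp add: L2_rel_def square_integrable_zero)

lift_definition plus_L2 :: "L2 \<Rightarrow> L2 \<Rightarrow> L2" is "\<lambda>f g z. f z + g z"
  by (auto simp: L2_rel_def square_integrable_add)

lift_definition scaleR_L2 :: "real \<Rightarrow> L2 \<Rightarrow> L2" is "\<lambda>r f z. of_real r * f z"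
  by (auto simp: L2_rel_def square_integrable_cmult)

lift_definition uminus_L2 :: "L2 \<Rightarrow> L2" is "\<lambda>f z. - 1 * f z"
  by (auto simp only: L2_rel_def square_integrable_cmult)

definition minus_L2 :: "L2 \<Rightarrow> L2 \<Rightarrow> L2" where
  "minus_L2 u v = u + (- v)"

lift_definition inner_L2 :: "L2 \<Rightarrow> L2 \<Rightarrow> real" is "\<lambda>f g. Re (LINT z|lborel. f z * cnj (g z))"
  unfolding L2_rel_def square_integrable_def
  by (intro arg_cong[where f = Re] integral_cong_AE) auto

definition norm_L2 :: "L2 \<Rightarrow> real" where
  "norm_L2 u = sqrt (inner u u)"

definition sgn_L2 :: "L2 \<Rightarrow> L2" where
  "sgn_L2 u = inverse (norm u) *\<^sub>R u"

definition dist_L2 :: "L2 \<Rightarrow> L2 \<Rightarrow> real" where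
  "dist_L2 u v = norm (u - v)"

definition uniformity_L2 :: "(L2 \<times> L2) filter" where
  "uniformity_L2 = (INF e\<in>{0<..}. principal {(x, y). dist x y < e})"

definition open_L2 :: "L2 set \<Rightarrow> bool" where
  "open_L2 U \<longleftrightarrow> (\<forall>x\<in>U. \<forall>\<^sub>F (x', y) in uniformity. x' = x \<longrightarrow> y \<in> U)"

instance
proof
  fix u v w :: L2 and a b r :: real
  show "u + v + w = u + (v + w)"
    by transfer (auto simp: L2_rel_def add.assoc square_integrable_add)
  show "u + v = v + u"
    by transfer (auto simp: L2_rel_def add.commute square_integrable_add)
  show "0 + u = u"
    by transfer (auto simp: L2_rel_def)
  show "- u + u = 0"
    by transfer (auto simp: L2_rel_def square_integrable_zero)
  show "u - v = u + - v"
    by (rule minus_L2_def)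
  show "a *\<^sub>R (u + v) = a *\<^sub>R u + a *\<^sub>R v"
    by transfer (auto simp: L2_rel_def distrib_left
        intro!: square_integrable_add square_integrable_cmult)
  show "(a + b) *\<^sub>R u = a *\<^sub>R u + b *\<^sub>R u"
    by transfer (auto simp: L2_rel_def distrib_right
        intro!: square_integrable_add square_integrable_cmult
          square_integrable_cmult[where c = "of_real a + of_real b", simplified distrib_right])
  show "a *\<^sub>R b *\<^sub>R u = (a * b) *\<^sub>R u"
    by transfer (auto simp: L2_rel_def mult.assoc
        intro!: square_integrable_cmult
          square_integrable_cmult[where c = "of_real a * of_real b", simplified mult.assoc])
  show "1 *\<^sub>R u = u"
    by transfer (auto simp: L2_rel_def)
  show "sgn u = inverse (norm u) *\<^sub>R u"
    by (rule sgn_L2_def)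
  show "dist u v = norm (u - v)"
    by (rule dist_L2_def)
  show "(uniformity :: (L2 \<times> L2) filter) = (INF e\<in>{0<..}. principal {(x, y). dist x y < e})"
    by (rule uniformity_L2_def)
  show "open U \<longleftrightarrow> (\<forall>x\<in>U. \<forall>\<^sub>F (x', y) in uniformity. x' = x \<longrightarrow> y \<in> U)" for U :: "L2 set"
    by (rule open_L2_def)
  show "inner u v = inner v u"
  proof transfer
    fix f g :: "real \<times> real \<Rightarrow> complex"
    assume "L2_rel f f" "L2_rel g g"
    then have "integrable lborel (\<lambda>z. f z * cnj (g z))" "integrable lborel (\<lambda>z. g z * cnj (f z))"
      by (auto simp: L2_rel_def intro: square_integrable_mult_cnj)
    then show "Re (LINT z|lborel. f z * cnj (g z)) = Re (LINT z|lborel. g z * cnj (f z))"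
      by (simp add: integral_Re[symmetric] algebra_simps)
  qed
  show "inner (u + v) w = inner u w + inner v w"
    by transfer (simp add: L2_rel_def distrib_right square_integrable_mult_cnj)
  show "inner (r *\<^sub>R u) v = r * inner u v"
    by transfer (simp add: L2_rel_def mult.assoc)
  have inner_self: "Re (LINT z|lborel. f z * cnj (f z)) = (LINT z|lborel. (norm (f z))\<^sup>2)"
    for f :: "real \<times> real \<Rightarrow> complex"
    by (simp only: complex_norm_square[symmetric] integral_complex_of_real Re_complex_of_real)
  show "0 \<le> inner u u"
    by transfer (simp only: inner_self, simp)
  show "inner u u = 0 \<longleftrightarrow> u = 0"
  proof transfer
    fix f :: "real \<times> real \<Rightarrow> complex"
    assume "L2_rel f f"
    then have f: "square_integrable f" by (simp add: L2_rel_def)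
    then have "(LINT z|lborel. (norm (f z))\<^sup>2) = 0 \<longleftrightarrow> (AE z in lborel. (norm (f z))\<^sup>2 = 0)"
      by (intro integral_nonneg_eq_0_iff_AE) (auto simp: square_integrable_def)
    then show "Re (LINT z|lborel. f z * cnj (f z)) = 0 \<longleftrightarrow> L2_rel f (\<lambda>z. 0)"
      using f by (simp only: inner_self) (simp add: L2_rel_def square_integrable_zero)
  qed
  show "norm u = sqrt (inner u u)"
    by (rule norm_L2_def)
qed

end


section \<open>Fourier transform and Fourier multipliers\<close>

definition fourier_integral :: "(real \<times> real \<Rightarrow> complex) \<Rightarrow> real \<times> real \<Rightarrow> complex" where
  "fourier_integral f = (\<lambda>(\<xi>, \<eta>).
     1 / (2 * of_real pi) *
       (LINT (x, y)|lborel. exp (- \<i> * of_real (x * \<xi> + y * \<eta>)) * f (x, y)))"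

text \<open>The Fourier transform on $L^2$ is the unique bounded operator that is given by the Fourier
  integral on $L^1 \cap L^2$ (Plancherel); with the normalization above it is unitary.\<close>

definition fourier :: "L2 \<Rightarrow> L2" where
  "fourier = (THE F. bounded_linear F \<and>
     (\<forall>u. integrable lborel (rep_L2 u) \<longrightarrow>
        (AE \<zeta> in lborel. rep_L2 (F u) \<zeta> = fourier_integral (rep_L2 u) \<zeta>)))"

text \<open>The element \<open>v\<close> of $L^2$ with $\hat v = m \hat u$; unspecified if $m \hat u \notin L^2$.\<close>

definition fourier_multiplier :: "(real \<times> real \<Rightarrow> complex) \<Rightarrow> L2 \<Rightarrow> L2" where
  "fourier_multiplier m u =
     (THE v. AE \<zeta> in lborel. rep_L2 (fourier v) \<zeta> = m \<zeta> * rep_L2 (fourier u) \<zeta>)"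

definition deriv_x :: "L2 \<Rightarrow> L2" where
  "deriv_x = fourier_multiplier (\<lambda>(\<xi>, \<eta>). \<i> * of_real \<xi>)"

definition half_deriv_y :: "L2 \<Rightarrow> L2" where
  "half_deriv_y = fourier_multiplier (\<lambda>(\<xi>, \<eta>). of_real (\<bar>\<eta>\<bar> powr (1/2)))"

definition propagator :: "real \<Rightarrow> L2 \<Rightarrow> L2" where
  "propagator t = fourier_multiplier (\<lambda>(\<xi>, \<eta>). exp (- \<i> * of_real (t * (\<xi>\<^sup>2 + \<bar>\<eta>\<bar>))))"


section \<open>Function spaces\<close>

definition japanese_bracket :: "real \<Rightarrow> real" where
  "japanese_bracket x = sqrt (1 + \<bar>x\<bar>\<^sup>2)"

text \<open>The anisotropic space $H^{s_1,s_2}$ for \<open>s1, s2 \<ge> 0\<close>.  In this range a tempered distribution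
  with finite norm is an element of $L^2$, so nothing is lost by working inside \<open>L2\<close>.  For negative
  exponents this would only be $H^{s_1,s_2} \cap L^2$.\<close>

definition aniso_sobolev :: "real \<Rightarrow> real \<Rightarrow> L2 set" where
  "aniso_sobolev s1 s2 = {u. integrable lborel (\<lambda>(\<xi>, \<eta>).
     japanese_bracket \<xi> powr (2 * s1) * japanese_bracket \<eta> powr (2 * s2) *
       (norm (rep_L2 (fourier u) (\<xi>, \<eta>)))\<^sup>2)}"

definition energy_space :: "L2 set" where
  "energy_space = aniso_sobolev 1 0 \<inter> aniso_sobolev 0 (1/2)"

definition energy_norm :: "L2 \<Rightarrow> real" where
  "energy_norm u = sqrt ((norm (deriv_x u))\<^sup>2 + (norm (half_deriv_y u))\<^sup>2 + (norm u)\<^sup>2)"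

definition fourier_in_L1 :: "L2 \<Rightarrow> bool" where
  "fourier_in_L1 u \<longleftrightarrow> integrable lborel (rep_L2 (fourier u))"

definition fourier_L1_norm :: "L2 \<Rightarrow> real" where
  "fourier_L1_norm u = (LINT \<zeta>|lborel. norm (rep_L2 (fourier u) \<zeta>))"

text \<open>\<open>u\<close> belongs to $C([-T,T];E)$.\<close>

definition continuous_into_energy :: "real \<Rightarrow> (real \<Rightarrow> L2) \<Rightarrow> bool" where
  "continuous_into_energy T u \<longleftrightarrow>
     (\<forall>t\<in>{-T..T}. u t \<in> energy_space) \<and>
     (\<forall>t\<in>{-T..T}. ((\<lambda>s. energy_norm (u s - u t)) \<longlongrightarrow> 0) (at t within {-T..T}))"

text \<open>A path \<open>w\<close> in \<open>L2\<close> and a jointly measurable function \<open>U\<close> of time and space (or time and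
  frequency) represent the same object on $[-T,T] \times \mathbb{R}^2$.\<close>

definition spacetime_version ::
    "real \<Rightarrow> (real \<Rightarrow> L2) \<Rightarrow> (real \<times> (real \<times> real) \<Rightarrow> complex) \<Rightarrow> bool" where
  "spacetime_version T w U \<longleftrightarrow>
     U \<in> borel_measurable lborel \<and>
     (AE t in lborel. t \<in> {-T..T} \<longrightarrow> (AE z in lborel. U (t, z) = rep_L2 (w t) z))"

text \<open>\<open>u\<close> belongs to $L^\infty([-T,T] \times \mathbb{R}^2)$.\<close>

definition spacetime_bounded :: "real \<Rightarrow> (real \<Rightarrow> L2) \<Rightarrow> bool" where
  "spacetime_bounded T u \<longleftrightarrow>
     (\<exists>U. spacetime_version T u U \<and>
       (\<exists>M. AE q in lborel. fst q \<in> {-T..T} \<longrightarrow> norm (U q) \<le> M))"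

text \<open>$\hat u$ belongs to $L^\infty([-T,T]; L^1)$.  Since $L^1$ is separable, strong measurability
  of $t \mapsto \hat u(t)$ amounts to the existence of a jointly measurable version.\<close>

definition fourier_bounded_in_L1 :: "real \<Rightarrow> (real \<Rightarrow> L2) \<Rightarrow> bool" where
  "fourier_bounded_in_L1 T u \<longleftrightarrow>
     (\<exists>V. spacetime_version T (\<lambda>t. fourier (u t)) V) \<and>
     (\<exists>M. AE t in lborel. t \<in> {-T..T} \<longrightarrow> fourier_in_L1 (u t) \<and> fourier_L1_norm (u t) \<le> M)"


section \<open>The Cauchy problem\<close>

text \<open>$|u|^{p-1} u$; used only for bounded \<open>u\<close>, for which this is again in $L^2$.\<close>

definition power_nonlinearity :: "nat \<Rightarrow> L2 \<Rightarrow> L2" where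
  "power_nonlinearity p u =
     abs_L2 (\<lambda>z. of_real ((norm (rep_L2 u z)) ^ (p - 1)) * rep_L2 u z)"

text \<open>\<open>I\<close> is the oriented integral from \<open>0\<close> to \<open>t\<close>, with \<open>t\<close> of either sign, of the \<open>L2\<close>-valued
  function \<open>f\<close>.\<close>

definition has_integral_from_zero :: "(real \<Rightarrow> L2) \<Rightarrow> L2 \<Rightarrow> real \<Rightarrow> bool" where
  "has_integral_from_zero f I t \<longleftrightarrow>
     (if 0 \<le> t then (f has_integral I) {0..t} else (f has_integral (- I)) {t..0})"

definition duhamel_solution :: "nat \<Rightarrow> real \<Rightarrow> L2 \<Rightarrow> real \<Rightarrow> (real \<Rightarrow> L2) \<Rightarrow> bool" where
  "duhamel_solution p \<mu> u0 T u \<longleftrightarrow>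
     (\<forall>t\<in>{-T..T}. \<exists>I.
        has_integral_from_zero (\<lambda>\<tau>. propagator (t - \<tau>) (power_nonlinearity p (u \<tau>))) I t \<and>
        u t = propagator t u0 - cscale (\<i> * of_real \<mu>) I)"

definition solution_in_class :: "nat \<Rightarrow> real \<Rightarrow> L2 \<Rightarrow> real \<Rightarrow> (real \<Rightarrow> L2) \<Rightarrow> bool" where
  "solution_in_class p \<mu> u0 T u \<longleftrightarrow>
     duhamel_solution p \<mu> u0 T u \<and>
     continuous_into_energy T u \<and> spacetime_bounded T u \<and> fourier_bounded_in_L1 T u"

end

theory Submission
  imports Defs "HOL-Probability.Probability"
begin

text \<open>On the Fourier side the functions $f$ with $\int |f| \le R$ and $\int w^2 |f|^2 \le R^2$,
  $w^2 = 1 + \xi^2 + |\eta|$, form an algebra under convolution, because $w$ is subadditive and by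
  Young's inequality.  Hence $|u|^{2k} u$ maps such balls into balls, and it is Lipschitz in $L^2$ on
  each ball since $\|u\|_\infty \le \|\hat u\|_{L^1}$.  The balls are closed in $L^2$, so Picard
  iteration contracts in $C([-T,T]; L^2)$ on paths with values in a ball, with $T$ depending only on
  the radius.  Continuity into the energy space follows because $S(-t) u(t)$ is Lipschitz for the
  stronger norm and the propagator is strongly continuous there.  Uniqueness is a Gronwall argument
  in $L^2$, using only that both solutions are bounded.  The Fourier transform of the definitions is
  identified through Plancherel's theorem, obtained by Gaussian regularization.\<close>

section \<open>Square integrable functions\<close>

text \<open>The energy norm alone gives no sup bound, since 1/w^2 is not integrable on the plane;
  the integral of the transform supplies it, and both norms have to be controlled together. In the
  strong norm only sizes of nonlinear terms are estimated, never their differences: those are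
  measured in \<open>L2\<close>, where the sup bound suffices. Hence no complete space with the
  strong norm is built, but integrals, which exist in \<open>L2\<close>, must be shown to stay in
  balls; this is done on Riemann sums. Each convolution costs a factor 3, and multiplication by
  |u|^2 takes two of them, hence the 9 in the radii. \<open>fourier\<close> and
  \<open>fourier_multiplier\<close> are definite descriptions, so nothing can be computed with them
  before existence and uniqueness are known; this is why Plancherel's theorem and inversion precede
  the equation. For uniqueness, the sup bound is available only at almost every time, and the
  Duhamel integral is a gauge integral whose integrand is not known to be norm integrable, so the
  comparison of integrals has to tolerate null sets.\<close>

type_synonym plane = "real \<times> real"

lemma square_integrable_rep: "square_integrable (rep_L2 u)"
  using Quotient3_rep_reflp[OF Quotient3_L2, of u] by (simp add: L2_rel_def)

lemma abs_rep_L2: "abs_L2 (rep_L2 u) = u"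
  by (rule Quotient3_abs_rep[OF Quotient3_L2])

lemma abs_L2_eq_iff:
  assumes "square_integrable f" "square_integrable g"
  shows "abs_L2 f = abs_L2 g \<longleftrightarrow> (AE z in lborel. f z = g z)"
  using Quotient3_rel[OF Quotient3_L2, of f g] assms by (auto simp: L2_rel_def)

lemma rep_abs_L2:
  assumes "square_integrable f"
  shows "AE z in lborel. rep_L2 (abs_L2 f) z = f z"
  using abs_L2_eq_iff[OF square_integrable_rep assms, of "abs_L2 f"] by (simp add: abs_rep_L2)

lemma L2_eqI:
  assumes "AE z in lborel. rep_L2 u z = rep_L2 v z"
  shows "u = v"
  using abs_L2_eq_iff[OF square_integrable_rep square_integrable_rep, of u v] assms
  by (simp add: abs_rep_L2)

lemma rep_L2_measurable [measurable]: "rep_L2 u \<in> borel_measurable borel"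
  using square_integrable_rep[of u] by (simp add: square_integrable_def)

lemma square_integrable_measurable: "square_integrable f \<Longrightarrow> f \<in> borel_measurable borel"
  by (simp add: square_integrable_def)

lemma abs_L2_add:
  assumes "square_integrable f" "square_integrable g"
  shows "abs_L2 f + abs_L2 g = abs_L2 (\<lambda>z. f z + g z)"
  using assms by (simp add: plus_L2.abs_eq L2_rel_def)

lemma abs_L2_scaleR:
  assumes "square_integrable f"
  shows "r *\<^sub>R abs_L2 f = abs_L2 (\<lambda>z. of_real r * f z)"
  using assms by (simp add: scaleR_L2.abs_eq L2_rel_def)

lemma abs_L2_cscale:
  assumes "square_integrable f"
  shows "cscale c (abs_L2 f) = abs_L2 (\<lambda>z. c * f z)"
  using assms by (simp add: cscale.abs_eq L2_rel_def)

lemma abs_L2_diff: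
  assumes "square_integrable f" "square_integrable g"
  shows "abs_L2 f - abs_L2 g = abs_L2 (\<lambda>z. f z - g z)"
  using assms square_integrable_cmult[OF assms(2), of "-1"] abs_L2_add[OF assms(1), of "\<lambda>z. - 1 * g z"]
  by (simp add: minus_L2_def uminus_L2.abs_eq L2_rel_def)

lemma rep_L2_add: "AE z in lborel. rep_L2 (u + v) z = rep_L2 u z + rep_L2 v z"
  using rep_abs_L2[OF square_integrable_add[OF square_integrable_rep square_integrable_rep], of u v]
    abs_L2_add[OF square_integrable_rep square_integrable_rep, of u v] by (simp add: abs_rep_L2)

lemma rep_L2_cscale: "AE z in lborel. rep_L2 (cscale c u) z = c * rep_L2 u z"
  using rep_abs_L2[OF square_integrable_cmult[OF square_integrable_rep], of c u]
    abs_L2_cscale[OF square_integrable_rep, of c u] by (simp add: abs_rep_L2)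

lemma scaleR_eq_cscale: "r *\<^sub>R u = cscale (of_real r) u"
  using abs_L2_scaleR[OF square_integrable_rep, of r u] abs_L2_cscale[OF square_integrable_rep, of "of_real r" u]
  by (simp add: abs_rep_L2)

lemma square_integrable_diff:
  assumes "square_integrable f" "square_integrable g"
  shows "square_integrable (\<lambda>z. f z - g z)"
  using square_integrable_add[OF assms(1) square_integrable_cmult[OF assms(2), of "-1"]] by simp

lemma rep_L2_diff: "AE z in lborel. rep_L2 (u - v) z = rep_L2 u z - rep_L2 v z"
  using rep_abs_L2[OF square_integrable_diff[OF square_integrable_rep square_integrable_rep], of u v]
    abs_L2_diff[OF square_integrable_rep square_integrable_rep, of u v] by (simp add: abs_rep_L2)

lemma rep_L2_zero: "AE z in lborel. rep_L2 0 z = 0"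
  using rep_abs_L2[OF square_integrable_zero] by (simp add: zero_L2_def)

lemma inner_abs_L2:
  assumes "square_integrable f" "square_integrable g"
  shows "inner (abs_L2 f) (abs_L2 g) = Re (LINT z|lborel. f z * cnj (g z))"
  using assms by (simp add: inner_L2.abs_eq L2_rel_def)

lemma norm_abs_L2_sq:
  assumes "square_integrable f"
  shows "(norm (abs_L2 f))\<^sup>2 = (LINT z|lborel. (norm (f z))\<^sup>2)"
  unfolding power2_norm_eq_inner[of "abs_L2 f"] inner_abs_L2[OF assms assms]
  by (simp only: complex_norm_square[symmetric] integral_complex_of_real Re_complex_of_real)

text \<open>With values in \<open>ennreal\<close> these quantities make sense for every measurable
  function, so membership and a bound can be proved in one step, without prior
  integrability.\<close>

abbreviation L2_nn :: "('a::euclidean_space \<Rightarrow> complex) \<Rightarrow> ennreal" where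
  "L2_nn f \<equiv> \<integral>\<^sup>+z. ennreal ((norm (f z))\<^sup>2) \<partial>lborel"

abbreviation L1_nn :: "('a::euclidean_space \<Rightarrow> complex) \<Rightarrow> ennreal" where
  "L1_nn f \<equiv> \<integral>\<^sup>+z. ennreal (norm (f z)) \<partial>lborel"

lemma norm_abs_L2_nn:
  assumes "square_integrable f"
  shows "ennreal ((norm (abs_L2 f))\<^sup>2) = L2_nn f"
  using assms by (simp add: norm_abs_L2_sq nn_integral_eq_integral square_integrable_def)

lemma norm_L2_nn: "ennreal ((norm u)\<^sup>2) = L2_nn (rep_L2 u)"
  using norm_abs_L2_nn[OF square_integrable_rep[of u]] by (simp add: abs_rep_L2)

lemma square_integrable_iff_nn:
  assumes [measurable]: "f \<in> borel_measurable borel"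
  shows "square_integrable f \<longleftrightarrow> L2_nn f < \<infinity>"
  by (simp add: square_integrable_def integrable_iff_bounded)

lemma square_integrableI_nn:
  assumes "f \<in> borel_measurable borel" "L2_nn f \<le> ennreal c"
  shows "square_integrable f"
  using assms by (simp add: square_integrable_iff_nn le_less_trans[OF _ ennreal_less_top])

lemma norm_abs_L2_leI:
  assumes "f \<in> borel_measurable borel" "L2_nn f \<le> ennreal (c\<^sup>2)" "0 \<le> c"
  shows "norm (abs_L2 f) \<le> c"
proof -
  have "ennreal ((norm (abs_L2 f))\<^sup>2) \<le> ennreal (c\<^sup>2)"
    using norm_abs_L2_nn[OF square_integrableI_nn[OF assms(1,2)]] assms(2) by simp
  then show ?thesis using assms(3) by (auto simp: power2_le_iff_abs_le)
qed

lemma square_integrable_bound: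
  assumes "square_integrable g" "f \<in> borel_measurable borel" "\<And>z. norm (f z) \<le> norm (g z)"
  shows "square_integrable f"
proof -
  have "L2_nn f \<le> L2_nn g"
    using assms(3) by (intro nn_integral_mono ennreal_leI power_mono) auto
  also have "\<dots> < \<infinity>"
    using assms(1) square_integrable_iff_nn[OF square_integrable_measurable[OF assms(1)]] by simp
  finally show ?thesis using square_integrable_iff_nn[OF assms(2)] by simp
qed

lemma norm_abs_L2_mono:
  assumes "square_integrable g" "f \<in> borel_measurable borel" "AE z in lborel. norm (f z) \<le> c * norm (g z)" "0 \<le> c"
  shows "square_integrable f \<and> norm (abs_L2 f) \<le> c * norm (abs_L2 g)"
proof -
  have [measurable]: "g \<in> borel_measurable borel" using assms by (simp add: square_integrable_measurable)
  have "L2_nn f \<le> (\<integral>\<^sup>+z. ennreal (c\<^sup>2) * ennreal ((norm (g z))\<^sup>2) \<partial>lborel)"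
  proof (intro nn_integral_mono_AE)
    show "AE z in lborel. ennreal ((norm (f z))\<^sup>2) \<le> ennreal (c\<^sup>2) * ennreal ((norm (g z))\<^sup>2)"
      using assms(3)
    proof eventually_elim
      case (elim z)
      then have "(norm (f z))\<^sup>2 \<le> (c * norm (g z))\<^sup>2" by (intro power_mono) auto
      then show ?case by (simp add: ennreal_mult'[symmetric] power_mult_distrib)
    qed
  qed
  also have "\<dots> = ennreal (c\<^sup>2) * L2_nn g"
    by (simp add: nn_integral_cmult)
  also have "\<dots> = ennreal ((c * norm (abs_L2 g))\<^sup>2)"
    by (simp add: norm_abs_L2_nn[OF assms(1), symmetric] ennreal_mult'[symmetric] power_mult_distrib)
  finally show ?thesis using assms
    by (auto intro!: norm_abs_L2_leI square_integrableI_nn)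
qed

section \<open>Fast convergence and completeness of \<open>L2\<close>\<close>

text \<open>The geometric rate makes the squared errors summable in $L^1$, so no further subsequence is needed.\<close>

lemma fast_conv_AE:
  fixes u :: "nat \<Rightarrow> L2"
  assumes "\<And>n. norm (u n - l) \<le> (1/2) ^ n"
  shows "AE z in lborel. (\<lambda>n. rep_L2 (u n) z) \<longlonglongrightarrow> rep_L2 l z"
proof -
  have "(\<integral>\<^sup>+z. (\<Sum>n. ennreal ((norm (rep_L2 (u n - l) z))\<^sup>2)) \<partial>lborel)
      = (\<Sum>n. L2_nn (rep_L2 (u n - l)))"
    by (rule nn_integral_suminf) simp
  also have "\<dots> \<le> (\<Sum>n. ennreal ((1/4) ^ n))"
  proof (intro suminf_le allI)
    fix n
    have "(norm (u n - l))\<^sup>2 \<le> ((1/2) ^ n)\<^sup>2" by (intro power_mono assms) auto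
    also have "((1/2) ^ n)\<^sup>2 = (1/4::real) ^ n" by (simp add: power_mult[symmetric] power2_eq_square power_mult_distrib[symmetric])
    finally show "L2_nn (rep_L2 (u n - l)) \<le> ennreal ((1/4) ^ n)"
      by (simp add: norm_L2_nn[symmetric])
  qed auto
  also have "\<dots> < \<infinity>" by (subst suminf_ennreal2) (auto simp: summable_geometric)
  finally have "AE z in lborel. (\<Sum>n. ennreal ((norm (rep_L2 (u n - l) z))\<^sup>2)) \<noteq> \<infinity>"
    by (intro nn_integral_PInf_AE) auto
  moreover have "AE z in lborel. \<forall>n. rep_L2 (u n - l) z = rep_L2 (u n) z - rep_L2 l z"
    unfolding AE_all_countable by (intro allI rep_L2_diff)
  ultimately show ?thesis
  proof eventually_elim
    case (elim z)
    then have "summable (\<lambda>n. (norm (rep_L2 (u n - l) z))\<^sup>2)"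
      by (intro summable_suminf_not_top) auto
    from tendsto_real_sqrt[OF summable_LIMSEQ_zero[OF this]]
    have "(\<lambda>n. norm (rep_L2 (u n) z - rep_L2 l z)) \<longlonglongrightarrow> 0" using elim by simp
    then show ?case by (simp add: LIM_zero_iff tendsto_norm_zero_iff)
  qed
qed

text \<open>No limit is known yet, so at almost every point the increments must be summable, and
  square summability would not suffice. A geometric rate in norm leaves room for a geometric rate at
  almost every point.\<close>

lemma fast_Cauchy_convergent_AE:
  fixes u :: "nat \<Rightarrow> L2"
  assumes "\<And>n. norm (u (Suc n) - u n) \<le> (1/2) ^ n"
  shows "AE z in lborel. convergent (\<lambda>n. rep_L2 (u n) z)"
proof -
  \<comment> \<open>The squared increments integrate to at most 4^-n, so they can be weighted by 2^n
    and stay summable. Boundedness of the weighted terms at a point then gives increments of order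
    2^(-n/2) there.\<close>
  let ?d = "\<lambda>n z. (norm (rep_L2 (u (Suc n) - u n) z))\<^sup>2"
  have "(\<integral>\<^sup>+z. (\<Sum>n. ennreal (2 ^ n * ?d n z)) \<partial>lborel)
      = (\<Sum>n. \<integral>\<^sup>+z. ennreal (2 ^ n * ?d n z) \<partial>lborel)"
    by (rule nn_integral_suminf) simp
  also have "\<dots> \<le> (\<Sum>n. ennreal ((1/2) ^ n))"
  proof (intro suminf_le allI)
    fix n
    have "(norm (u (Suc n) - u n))\<^sup>2 \<le> ((1/2) ^ n)\<^sup>2" by (intro power_mono assms) auto
    then have "2 ^ n * (norm (u (Suc n) - u n))\<^sup>2 \<le> 2 ^ n * ((1/2) ^ n)\<^sup>2" by (intro mult_left_mono) auto
    also have "2 ^ n * ((1/2) ^ n)\<^sup>2 = (1/2::real) ^ n"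
      by (simp add: power2_eq_square power_mult_distrib[symmetric])
    finally have le: "2 ^ n * (norm (u (Suc n) - u n))\<^sup>2 \<le> (1/2) ^ n" .
    have "(\<integral>\<^sup>+z. ennreal (2 ^ n * ?d n z) \<partial>lborel)
        = (\<integral>\<^sup>+z. ennreal (2 ^ n) * ennreal (?d n z) \<partial>lborel)"
      by (intro nn_integral_cong ennreal_mult) auto
    also have "\<dots> = ennreal (2 ^ n) * ennreal ((norm (u (Suc n) - u n))\<^sup>2)"
      unfolding norm_L2_nn by (rule nn_integral_cmult) simp
    also have "\<dots> = ennreal (2 ^ n * (norm (u (Suc n) - u n))\<^sup>2)"
      by (rule ennreal_mult[symmetric]) auto
    also have "\<dots> \<le> ennreal ((1/2) ^ n)" by (rule ennreal_leI[OF le])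
    finally show "(\<integral>\<^sup>+z. ennreal (2 ^ n * ?d n z) \<partial>lborel) \<le> ennreal ((1/2) ^ n)" .
  qed auto
  also have "\<dots> < \<infinity>" by (subst suminf_ennreal2) (auto simp: summable_geometric)
  finally have "AE z in lborel. (\<Sum>n. ennreal (2 ^ n * ?d n z)) \<noteq> \<infinity>"
    by (intro nn_integral_PInf_AE) auto
  moreover have "AE z in lborel. \<forall>n. rep_L2 (u (Suc n) - u n) z = rep_L2 (u (Suc n)) z - rep_L2 (u n) z"
    unfolding AE_all_countable by (intro allI rep_L2_diff)
  ultimately show ?thesis
  proof eventually_elim
    case (elim z)
    then have "summable (\<lambda>n. 2 ^ n * ?d n z)"
      by (intro summable_suminf_not_top) auto
    then have "Bseq (\<lambda>n. 2 ^ n * ?d n z)"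
      by (intro convergent_imp_Bseq convergentI) (rule summable_LIMSEQ_zero)
    then obtain K where K: "K > 0" "\<And>n. norm (2 ^ n * ?d n z) \<le> K" unfolding Bseq_def by blast
    have "norm (rep_L2 (u (Suc n)) z - rep_L2 (u n) z) \<le> sqrt K * sqrt (1/2) ^ n" for n
    proof -
      have "?d n z \<le> K * (1/2) ^ n" using K(2)[of n] by (simp add: field_simps norm_mult)
      then have "sqrt (?d n z) \<le> sqrt (K * (1/2) ^ n)" by (rule real_sqrt_le_mono)
      then show ?thesis using elim by (simp add: real_sqrt_mult real_sqrt_power)
    qed
    then have le: "\<And>n. norm (rep_L2 (u (Suc n)) z - rep_L2 (u n) z) \<le> sqrt K * sqrt (1/2) ^ n" .
    have "summable (\<lambda>n. sqrt K * sqrt (1/2) ^ n)"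
      by (intro summable_mult summable_geometric) simp
    then have "summable (\<lambda>n. rep_L2 (u (Suc n)) z - rep_L2 (u n) z)"
      by (rule summable_comparison_test'[where N = 0]) (rule le)
    then have "convergent (\<lambda>n. \<Sum>k<n. rep_L2 (u (Suc k)) z - rep_L2 (u k) z)"
      by (simp add: summable_iff_convergent)
    then have "convergent (\<lambda>n. rep_L2 (u n) z - rep_L2 (u 0) z)"
      using sum_lessThan_telescope[of "\<lambda>n. rep_L2 (u n) z"] by simp
    from convergent_add[OF this convergent_const[of "rep_L2 (u 0) z"]] show ?case by simp
  qed
qed

lemma Cauchy_fast_subseq:
  fixes X :: "nat \<Rightarrow> 'a::metric_space"
  assumes "Cauchy X"
  obtains r where "strict_mono r" "\<And>m n. n \<le> m \<Longrightarrow> dist (X (r m)) (X (r n)) \<le> (1/2) ^ n"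
proof -
  have "\<forall>n. \<exists>N. \<forall>m\<ge>N. \<forall>k\<ge>N. dist (X m) (X k) < (1/2) ^ n"
    using assms by (auto simp: Cauchy_def)
  then obtain N where N: "\<And>n m k. m \<ge> N n \<Longrightarrow> k \<ge> N n \<Longrightarrow> dist (X m) (X k) < (1/2) ^ n" by metis
  \<comment> \<open>The sum makes \<open>r\<close> dominate \<open>N\<close>, and the summand
    \<open>n\<close> makes it strictly increasing.\<close>
  define r where "r n = n + (\<Sum>i\<le>n. N i)" for n
  have r: "strict_mono r" by (auto simp: strict_mono_Suc_iff r_def)
  have "N n \<le> r n" for n using member_le_sum[of n "{..n}" N] by (auto simp: r_def)
  then have "dist (X (r m)) (X (r n)) \<le> (1/2) ^ n" if "n \<le> m" for m n
    using N[of n "r m" "r n"] strict_mono_leD[OF r that] le_trans by (metis less_imp_le)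
  with r that show ?thesis by blast
qed

text \<open>Riesz-Fischer: a fast subsequence converges almost everywhere, and Fatou's lemma
  upgrades this to convergence in norm. Integrals of continuous \<open>L2\<close>-valued paths and
  the fixed point theorem rest on this instance.\<close>

instance L2 :: complete_space
proof
  fix X :: "nat \<Rightarrow> L2"
  assume "Cauchy X"
  then obtain r where r: "strict_mono r" "\<And>m n. n \<le> m \<Longrightarrow> norm (X (r m) - X (r n)) \<le> (1/2) ^ n"
    using Cauchy_fast_subseq[of X] unfolding dist_norm by metis
  define u where "u n = X (r n)" for n
  define f where "f z = lim (\<lambda>n. rep_L2 (u n) z)" for z
  have [measurable]: "f \<in> borel_measurable borel" unfolding f_def by measurable
  have lim: "AE z in lborel. (\<lambda>n. rep_L2 (u n) z) \<longlonglongrightarrow> f z"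
    using fast_Cauchy_convergent_AE[of u] r(2)[OF le_SucI[OF order_refl]]
    by (simp add: u_def f_def convergent_LIMSEQ_iff)
  \<comment> \<open>Fatou's lemma in the index \<open>m\<close>. The bound also shows that
    \<open>f\<close> is square integrable, as the sum of \<open>f - u 0\<close> and
    \<open>u 0\<close>.\<close>
  have bnd: "L2_nn (\<lambda>z. f z - rep_L2 (u n) z) \<le> ennreal (((1/2) ^ n)\<^sup>2)" for n
  proof -
    have "L2_nn (\<lambda>z. f z - rep_L2 (u n) z)
        = (\<integral>\<^sup>+z. liminf (\<lambda>m. ennreal ((norm (rep_L2 (u m) z - rep_L2 (u n) z))\<^sup>2)) \<partial>lborel)"
    proof (intro nn_integral_cong_AE)
      show "AE z in lborel. ennreal ((norm (f z - rep_L2 (u n) z))\<^sup>2)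
        = liminf (\<lambda>m. ennreal ((norm (rep_L2 (u m) z - rep_L2 (u n) z))\<^sup>2))"
        using lim
      proof eventually_elim
        case (elim z)
        have "(\<lambda>m. ennreal ((norm (rep_L2 (u m) z - rep_L2 (u n) z))\<^sup>2)) \<longlonglongrightarrow> ennreal ((norm (f z - rep_L2 (u n) z))\<^sup>2)"
          by (intro tendsto_intros elim tendsto_ennrealI)
        then show ?case by (rule lim_imp_Liminf[OF trivial_limit_sequentially, symmetric])
      qed
    qed
    also have "\<dots> \<le> liminf (\<lambda>m. L2_nn (\<lambda>z. rep_L2 (u m) z - rep_L2 (u n) z))"
      by (rule nn_integral_liminf) simp
    also have "\<dots> \<le> ennreal (((1/2) ^ n)\<^sup>2)"
    proof (rule Liminf_le[OF trivial_limit_sequentially], rule eventually_sequentiallyI[of n])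
      fix m assume m: "n \<le> m"
      have "L2_nn (\<lambda>z. rep_L2 (u m) z - rep_L2 (u n) z)
          = ennreal ((norm (u m - u n))\<^sup>2)"
        unfolding norm_L2_nn using rep_L2_diff[of "u m" "u n"]
        by (intro nn_integral_cong_AE) auto
      also have "\<dots> \<le> ennreal (((1/2) ^ n)\<^sup>2)"
        using r(2)[OF m] by (intro ennreal_leI power_mono) (auto simp: u_def)
      finally show "L2_nn (\<lambda>z. rep_L2 (u m) z - rep_L2 (u n) z)
          \<le> ennreal (((1/2) ^ n)\<^sup>2)" .
    qed
    finally show ?thesis .
  qed
  have sqd: "square_integrable (\<lambda>z. f z - rep_L2 (u n) z)" for n
    by (rule square_integrableI_nn[OF _ bnd]) simp
  from square_integrable_add[OF this square_integrable_rep, of 0 "u 0"]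
  have sq: "square_integrable f" by simp
  have "norm (abs_L2 f - u n) \<le> (1/2) ^ n" for n
    using norm_abs_L2_leI[OF _ bnd, of n] abs_L2_diff[OF sq square_integrable_rep[of "u n"]]
    by (simp add: abs_rep_L2)
  then have "(\<lambda>n. u n - abs_L2 f) \<longlonglongrightarrow> 0"
    by (intro Lim_null_comparison[OF always_eventually LIMSEQ_power_zero[of "1/2::real"]])
       (auto simp: norm_minus_commute)
  then have "u \<longlonglongrightarrow> abs_L2 f" by (simp add: LIM_zero_iff)
  then have "(X \<circ> r) \<longlonglongrightarrow> abs_L2 f" by (simp add: u_def[abs_def] comp_def)
  with Cauchy_converges_subseq[OF \<open>Cauchy X\<close> r(1)] show "convergent X"
    by (auto simp: convergent_def)
qed

instance L2 :: banach ..

text \<open>Ordinary dominated convergence for the squared differences: the limit inherits the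
  majorant, so the difference is at most twice \<open>w\<close>, and its square at most
  \<open>4 * (norm (w z))\<^sup>2\<close>.\<close>

lemma L2_dominated_convergence:
  fixes f :: "nat \<Rightarrow> plane \<Rightarrow> complex"
  assumes w: "square_integrable w"
    and [measurable]: "\<And>n. f n \<in> borel_measurable borel" "g \<in> borel_measurable borel"
    and lim: "AE z in lborel. (\<lambda>n. f n z) \<longlonglongrightarrow> g z"
    and bnd: "\<And>n. AE z in lborel. norm (f n z) \<le> norm (w z)"
  shows "square_integrable g" "(\<lambda>n. abs_L2 (f n)) \<longlonglongrightarrow> abs_L2 g"
proof -
  have [measurable]: "w \<in> borel_measurable borel" using w by (rule square_integrable_measurable)
  have sqf: "square_integrable (f n)" for n
    using norm_abs_L2_mono[OF w, of "f n" 1] bnd by simp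
  have bndall: "AE z in lborel. \<forall>n. norm (f n z) \<le> norm (w z)"
    using bnd by (simp add: AE_all_countable)
  have bndg: "AE z in lborel. norm (g z) \<le> norm (w z)"
    using lim bndall
  proof eventually_elim
    case (elim z)
    then show ?case by (intro LIMSEQ_le_const2[OF tendsto_norm]) auto
  qed
  then show sqg: "square_integrable g"
    using norm_abs_L2_mono[OF w, of g 1] by simp
  have "(\<lambda>n. LINT z|lborel. (norm (f n z - g z))\<^sup>2) \<longlonglongrightarrow> (LINT z|(lborel :: plane measure). 0)"
  proof (rule integral_dominated_convergence[where w = "\<lambda>z. 4 * (norm (w z))\<^sup>2"])
    show "integrable lborel (\<lambda>z. 4 * (norm (w z))\<^sup>2)" using w by (simp add: square_integrable_def)
    show "AE z in lborel. (\<lambda>n. (norm (f n z - g z))\<^sup>2) \<longlonglongrightarrow> 0" using lim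
    proof eventually_elim
      case (elim z)
      then have "(\<lambda>n. (norm (f n z - g z))\<^sup>2) \<longlonglongrightarrow> (norm (g z - g z))\<^sup>2" by (intro tendsto_intros)
      then show ?case by simp
    qed
    show "AE z in lborel. norm ((norm (f n z - g z))\<^sup>2) \<le> 4 * (norm (w z))\<^sup>2" for n
      using bnd[of n] bndg
    proof eventually_elim
      case (elim z)
      then have "norm (f n z - g z) \<le> 2 * norm (w z)" by norm
      then have "(norm (f n z - g z))\<^sup>2 \<le> (2 * norm (w z))\<^sup>2" by (rule power_mono) simp
      then show ?case by (simp add: power_mult_distrib)
    qed
  qed auto
  then have "(\<lambda>n. (norm (abs_L2 (f n) - abs_L2 g))\<^sup>2) \<longlonglongrightarrow> 0"
    by (simp add: abs_L2_diff sqf sqg norm_abs_L2_sq square_integrable_diff)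
  from tendsto_real_sqrt[OF this] show "(\<lambda>n. abs_L2 (f n)) \<longlonglongrightarrow> abs_L2 g"
    by (simp add: LIM_zero_iff tendsto_norm_zero_iff)
qed

section \<open>Truncation and density of continuous functions\<close>

lemma square_integrable_indicator_cball:
  "square_integrable (\<lambda>z. of_real M * indicator (cball 0 r) z)"
proof -
  have "(\<integral>\<^sup>+z. ennreal ((norm (indicator (cball 0 r) z :: complex))\<^sup>2) \<partial>(lborel :: plane measure))
      = (\<integral>\<^sup>+z. indicator (cball 0 r) z \<partial>(lborel :: plane measure))"
    by (intro nn_integral_cong) (auto split: split_indicator)
  also have "\<dots> < \<infinity>" using emeasure_bounded_finite[OF bounded_cball[of 0 r]] by simp
  finally have "square_integrable (\<lambda>z. indicator (cball 0 r) z)"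
    by (subst square_integrable_iff_nn) (auto intro!: borel_measurable_indicator)
  then show ?thesis by (rule square_integrable_cmult)
qed

text \<open>Cutting in space and in size at once yields bounded functions of bounded support, hence
  integrable ones; at each point the sequence is eventually constant.\<close>

definition cutoff :: "nat \<Rightarrow> (plane \<Rightarrow> complex) \<Rightarrow> plane \<Rightarrow> complex" where
  "cutoff n f z = (if norm z \<le> n \<and> norm (f z) \<le> n then f z else 0)"

lemma cutoff_measurable [measurable]:
  assumes [measurable]: "f \<in> borel_measurable borel"
  shows "cutoff n f \<in> borel_measurable borel"
  unfolding cutoff_def by measurable

lemma cutoff_tendsto: "(\<lambda>n. cutoff n f z) \<longlonglongrightarrow> f z"
proof (rule tendsto_eventually)
  obtain N :: nat where N: "max (norm z) (norm (f z)) \<le> N" using real_arch_simple by blast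
  show "eventually (\<lambda>n. cutoff n f z = f z) sequentially"
    using N by (intro eventually_sequentiallyI[of N]) (auto simp: cutoff_def)
qed

lemma cutoff_norm_le: "norm (cutoff n f z) \<le> norm (f z)"
  by (simp add: cutoff_def)

lemma integrable_cutoff:
  assumes [measurable]: "f \<in> borel_measurable borel"
  shows "integrable lborel (cutoff n f)"
proof (rule Bochner_Integration.integrable_bound[of lborel "\<lambda>z. real n * indicator (cball 0 (real n)) z"])
  show "integrable lborel (\<lambda>z::plane. real n * indicator (cball 0 (real n)) z)"
    using emeasure_bounded_finite[OF bounded_cball[of "0 :: plane" n]]
    by (intro integrable_mult_right integrable_real_indicator) auto
qed (auto simp: cutoff_def split: split_indicator)

lemma cutoff_tendsto_L2:
  assumes "square_integrable f"
  shows "(\<lambda>n. abs_L2 (cutoff n f)) \<longlonglongrightarrow> abs_L2 f"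
  using assms by (intro L2_dominated_convergence(2)[of f])
    (auto simp: cutoff_norm_le cutoff_tendsto square_integrable_measurable intro!: cutoff_measurable)

text \<open>The radial retraction of the complex plane onto the disc of radius \<open>M\<close>. It
  imposes a bound while preserving continuity.\<close>

definition clamp_norm :: "real \<Rightarrow> complex \<Rightarrow> complex" where
  "clamp_norm M w = w / of_real (max 1 (norm w / M))"

lemma clamp_norm:
  assumes "M > 0"
  shows "continuous_on UNIV (clamp_norm M)" "norm (clamp_norm M w) \<le> M"
    "norm w \<le> M \<Longrightarrow> clamp_norm M w = w"
proof -
  show "continuous_on UNIV (clamp_norm M)" unfolding clamp_norm_def using assms
    by (intro continuous_intros) (auto simp: max_def)
  have "norm (clamp_norm M w) = norm w / max 1 (norm w / M)"
    by (simp add: clamp_norm_def norm_divide)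
  also have "\<dots> \<le> M" using assms by (simp add: divide_simps max_def)
  finally show "norm (clamp_norm M w) \<le> M" .
  show "clamp_norm M w = w" if "norm w \<le> M"
  proof -
    have "max 1 (norm w / M) = 1" using assms that by (simp add: max_def)
    then show ?thesis by (simp add: clamp_norm_def)
  qed
qed

text \<open>A Lebesgue measurable function is a limit of continuous ones off a negligible set, but
  without any control of their size. Starting from a truncation \<open>h\<close> of
  \<open>f\<close>, clamping the approximants and multiplying them by a continuous plateau function
  provides a majorant and does not change the limit \<open>h\<close>.\<close>

lemma continuous_dense_L2:
  assumes f: "square_integrable f" and "e > 0"
  obtains g M r where "continuous_on UNIV g" "\<And>z. norm (g z) \<le> M" "\<And>z. r \<le> norm z \<Longrightarrow> g z = 0"
    "square_integrable g" "norm (abs_L2 f - abs_L2 g) < e"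
proof -
  from metric_LIMSEQ_D[OF cutoff_tendsto_L2[OF f], of "e / 2"] \<open>e > 0\<close>
  obtain n where n: "dist (abs_L2 (cutoff n f)) (abs_L2 f) < e / 2" by auto
  define h where "h = cutoff n f"
  \<comment> \<open>The summand \<open>1\<close> keeps \<open>M\<close> positive when
    \<open>n\<close> is \<open>0\<close>, as \<open>clamp_norm\<close> requires.\<close>
  define M where "M = real n + 1"
  have M: "M > 0" by (simp add: M_def)
  have [measurable]: "f \<in> borel_measurable borel" using f by (rule square_integrable_measurable)
  have [measurable]: "h \<in> borel_measurable borel" unfolding h_def by measurable
  have hM: "norm (h z) \<le> M" for z by (simp add: h_def cutoff_def M_def)
  have h0: "norm z > M \<Longrightarrow> h z = 0" for z by (auto simp: h_def cutoff_def M_def)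
  have "h measurable_on UNIV"
    by (intro lebesgue_measurable_imp_measurable_on measurable_completion) auto
  then obtain N g where N: "negligible N" and g: "\<And>n. continuous_on UNIV (g n)"
    "\<And>x. x \<notin> N \<Longrightarrow> (\<lambda>n. g n x) \<longlonglongrightarrow> h x" unfolding measurable_on_def by auto
  \<comment> \<open>Equal to 1 on the ball of radius \<open>M\<close>, which contains the support of
    \<open>h\<close>, and 0 outside radius \<open>M + 1\<close>.\<close>
  define cut where "cut z = complex_of_real (max 0 (min 1 (M + 1 - norm z)))" for z :: "plane"
  define k where "k m z = cut z * clamp_norm M (g m z)" for m z
  have cut_cont: "continuous_on UNIV cut" unfolding cut_def by (intro continuous_intros)
  have k: "continuous_on UNIV (k m)" for m unfolding k_def
    by (intro continuous_on_mult cut_cont continuous_on_compose2[OF clamp_norm(1)[OF M]] g(1)) auto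
  have [measurable]: "k m \<in> borel_measurable borel" for m
    by (rule borel_measurable_continuous_onI[OF k])
  have kM: "norm (k m z) \<le> M" for m z
  proof -
    have "norm (cut z) \<le> 1" by (simp add: cut_def)
    then have "norm (k m z) \<le> 1 * M" unfolding k_def norm_mult
      by (intro mult_mono clamp_norm M) auto
    then show ?thesis by simp
  qed
  have k0: "M + 1 \<le> norm z \<Longrightarrow> k m z = 0" for m z by (simp add: k_def cut_def)
  define w :: "plane \<Rightarrow> complex" where "w z = of_real M * indicator (cball 0 (M + 1)) z" for z
  have w: "square_integrable w" unfolding w_def by (rule square_integrable_indicator_cball)
  have kw: "norm (k m z) \<le> norm (w z)" for m z
    using kM[of m z] k0[of z m] M by (auto simp: w_def norm_mult split: split_indicator)
  have kh: "(\<lambda>m. k m z) \<longlonglongrightarrow> h z" if "z \<notin> N" for z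
  proof -
    have "isCont (clamp_norm M) (h z)" using clamp_norm(1)[OF M] by (simp add: continuous_on_eq_continuous_at)
    then have "(\<lambda>m. clamp_norm M (g m z)) \<longlonglongrightarrow> clamp_norm M (h z)"
      by (rule isCont_tendsto_compose) (rule g(2)[OF that])
    then have "(\<lambda>m. k m z) \<longlonglongrightarrow> cut z * clamp_norm M (h z)" unfolding k_def by (intro tendsto_intros)
    moreover have "cut z * clamp_norm M (h z) = h z"
    proof (cases "norm z > M")
      case True then show ?thesis by (simp add: h0 clamp_norm_def)
    next
      case False
      then have "cut z = 1" by (simp add: cut_def)
      then show ?thesis using clamp_norm(3)[OF M hM[of z]] by simp
    qed
    ultimately show ?thesis by simp
  qed
  have "AE z in lebesgue. z \<notin> N"
    using N unfolding negligible_iff_null_sets by (rule AE_not_in)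
  then have "AE z in lborel. z \<notin> N" by (simp only: AE_completion_iff)
  then have "AE z in lborel. (\<lambda>m. k m z) \<longlonglongrightarrow> h z"
    by eventually_elim (rule kh)
  from L2_dominated_convergence(2)[OF w _ _ this] kw
  have "(\<lambda>m. abs_L2 (k m)) \<longlonglongrightarrow> abs_L2 h" by auto
  from metric_LIMSEQ_D[OF this, of "e / 2"] \<open>e > 0\<close>
  obtain m where m: "dist (abs_L2 (k m)) (abs_L2 h) < e / 2" by auto
  show ?thesis
  proof (rule that[of "k m" M "M + 1"])
    show "square_integrable (k m)" by (rule square_integrable_bound[OF w _ kw]) simp
    have "dist (abs_L2 f) (abs_L2 (k m)) < e / 2 + e / 2"
      by (rule dist_triangle_less_add[of _ "abs_L2 h"]) (use n m in \<open>simp_all add: h_def dist_commute\<close>)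
    then show "norm (abs_L2 f - abs_L2 (k m)) < e" by (simp add: dist_norm)
  qed (use k kM k0 in auto)
qed

section \<open>Continuity of translations\<close>

lemma nn_integral_translate:
  assumes [measurable]: "f \<in> borel_measurable borel"
  shows "(\<integral>\<^sup>+z. f (z + h) \<partial>lborel) = (\<integral>\<^sup>+z. f z \<partial>(lborel :: plane measure))"
  by (subst lborel_distr_plus[of h, symmetric]) (simp add: nn_integral_distr add.commute)

lemma square_integrable_translate:
  assumes "square_integrable f"
  shows "square_integrable (\<lambda>z. f (z + h))" "norm (abs_L2 (\<lambda>z. f (z + h))) = norm (abs_L2 f)"
proof -
  have [measurable]: "f \<in> borel_measurable borel" using assms by (rule square_integrable_measurable)
  have *: "L2_nn (\<lambda>z. f (z + h)) = L2_nn f"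
    by (rule nn_integral_translate[of "\<lambda>z. ennreal ((norm (f z))\<^sup>2)"]) simp
  show sq: "square_integrable (\<lambda>z. f (z + h))" using assms * by (simp add: square_integrable_iff_nn)
  have "ennreal ((norm (abs_L2 (\<lambda>z. f (z + h))))\<^sup>2) = ennreal ((norm (abs_L2 f))\<^sup>2)"
    by (simp only: norm_abs_L2_nn sq assms *)
  then show "norm (abs_L2 (\<lambda>z. f (z + h))) = norm (abs_L2 f)" by (simp add: power2_eq_iff_nonneg)
qed

text \<open>Translations are isometries, so by density it is enough to treat a continuous
  \<open>g\<close> of bounded support, where dominated convergence applies; three errors of size
  \<open>e / 3\<close> add up.\<close>

lemma translate_tendsto_L2:
  assumes f: "square_integrable f" and h: "h \<longlonglongrightarrow> 0"
  shows "(\<lambda>n. abs_L2 (\<lambda>z. f (z + h n))) \<longlonglongrightarrow> abs_L2 f"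
proof (rule metric_LIMSEQ_I)
  fix e :: real assume "e > 0"
  then obtain g M r where g: "continuous_on UNIV g" "\<And>z. norm (g z) \<le> M" "\<And>z. r \<le> norm z \<Longrightarrow> g z = 0"
    "square_integrable g" "norm (abs_L2 f - abs_L2 g) < e / 3"
    using continuous_dense_L2[OF f, of "e / 3"] by auto
  define w :: "plane \<Rightarrow> complex" where "w z = of_real M * indicator (cball 0 (r + 1)) z" for z
  have w: "square_integrable w" unfolding w_def by (rule square_integrable_indicator_cball)
  \<comment> \<open>A common majorant on the ball of radius \<open>r + 1\<close> exists only once
    the shifts are shorter than 1; hence the index is moved by \<open>N\<close>.\<close>
  obtain N where N: "\<And>n. n \<ge> N \<Longrightarrow> norm (h n) < 1" using h LIMSEQ_D[OF h, of 1] by auto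
  have [measurable]: "g \<in> borel_measurable borel" by (rule square_integrable_measurable[OF g(4)])
  have "(\<lambda>n. abs_L2 (\<lambda>z. g (z + h (n + N)))) \<longlonglongrightarrow> abs_L2 g"
  proof (rule L2_dominated_convergence(2)[OF w])
    show "AE z in lborel. (\<lambda>n. g (z + h (n + N))) \<longlonglongrightarrow> g z"
    proof (rule AE_I2)
      fix z
      have "(\<lambda>n. z + h (n + N)) \<longlonglongrightarrow> z + 0" by (intro tendsto_intros LIMSEQ_ignore_initial_segment h)
      moreover have "isCont g z" using g(1) continuous_on_eq_continuous_at[OF open_UNIV] by blast
      ultimately show "(\<lambda>n. g (z + h (n + N))) \<longlonglongrightarrow> g z" by (auto intro: isCont_tendsto_compose)
    qed
    show "AE z in lborel. norm (g (z + h (n + N))) \<le> norm (w z)" for n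
    proof (rule AE_I2)
      fix z
      have M: "M \<ge> 0" using order_trans[OF norm_ge_zero g(2)] .
      show "norm (g (z + h (n + N))) \<le> norm (w z)"
      proof (cases "norm z \<le> r + 1")
        case True then show ?thesis using M g(2) by (simp add: w_def norm_mult)
      next
        case False
        then have "r \<le> norm (z + h (n + N))" using N[of "n + N"] norm_triangle_ineq[of "z + h (n + N)" "- h (n + N)"] by simp
        then show ?thesis using g(3) by simp
      qed
    qed
  qed auto
  from metric_LIMSEQ_D[OF this, of "e / 3"] \<open>e > 0\<close>
  obtain N' where N': "\<And>n. n \<ge> N' \<Longrightarrow> dist (abs_L2 (\<lambda>z. g (z + h (n + N)))) (abs_L2 g) < e / 3" by auto
  show "\<exists>no. \<forall>n\<ge>no. dist (abs_L2 (\<lambda>z. f (z + h n))) (abs_L2 f) < e"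
  proof (intro exI[of _ "N' + N"] allI impI)
    fix n assume "N' + N \<le> n"
    then have n: "n - N \<ge> N'" "n - N + N = n" by auto
    have 1: "dist (abs_L2 (\<lambda>z. g (z + h n))) (abs_L2 g) < e / 3" using N'[OF n(1)] n(2) by simp
    have 2: "dist (abs_L2 (\<lambda>z. f (z + h n))) (abs_L2 (\<lambda>z. g (z + h n))) < e / 3"
      using square_integrable_translate(2)[OF square_integrable_diff[OF f g(4)], of "h n"] g(5)
      by (simp add: dist_norm abs_L2_diff square_integrable_translate f g(4))
    have 3: "dist (abs_L2 g) (abs_L2 f) < e / 3" using g(5) by (simp add: dist_norm norm_minus_commute)
    show "dist (abs_L2 (\<lambda>z. f (z + h n))) (abs_L2 f) < e"
      by (rule dist_triangle_third[OF 2 1 3])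
  qed
qed

section \<open>Plancherel's theorem\<close>

lemma borel_measurable_cis [measurable]: "cis \<in> borel_measurable borel"
  by (intro borel_measurable_continuous_onI continuous_intros)

lemma borel_measurable_fst_snd [measurable]:
  "(fst :: 'a::topological_space \<times> 'b::topological_space \<Rightarrow> 'a) \<in> borel_measurable borel"
  "(snd :: 'a::topological_space \<times> 'b::topological_space \<Rightarrow> 'b) \<in> borel_measurable borel"
  by (intro borel_measurable_continuous_onI continuous_intros)+

lemma integrable_lborel_pairI:
  fixes F :: "'a::euclidean_space \<times> 'b::euclidean_space \<Rightarrow> complex"
  assumes [measurable]: "F \<in> borel_measurable borel"
    and fin: "(\<integral>\<^sup>+x. L1_nn (\<lambda>y. F (x, y)) \<partial>lborel) < \<infinity>"
  shows "integrable lborel F"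
proof (rule integrableI_bounded)
  have "(\<lambda>p. ennreal (norm (F p))) \<in> borel_measurable (lborel \<Otimes>\<^sub>M lborel)"
    unfolding lborel_prod by simp
  from lborel.nn_integral_fst[OF this] fin
  show "L1_nn F < \<infinity>" by (simp add: lborel_prod)
qed simp

lemma integrable_pair_mult:
  fixes A :: "'a::euclidean_space \<Rightarrow> complex" and B :: "'b::euclidean_space \<Rightarrow> complex"
  assumes "integrable lborel A" "integrable lborel B"
  shows "integrable lborel (\<lambda>p. A (fst p) * B (snd p))"
    "(LINT p|lborel. A (fst p) * B (snd p)) = (LINT x|lborel. A x) * (LINT y|lborel. B y)"
proof -
  have [measurable]: "A \<in> borel_measurable borel" "B \<in> borel_measurable borel"
    using assms borel_measurable_integrable by force+
  have "(\<integral>\<^sup>+x. L1_nn (\<lambda>y. A x * B y) \<partial>lborel)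
      = (L1_nn A) * L1_nn B"
    by (simp add: norm_mult ennreal_mult nn_integral_cmult nn_integral_multc)
  also have "\<dots> < \<infinity>" using assms by (simp add: integrable_iff_bounded ennreal_mult_less_top)
  finally show int: "integrable lborel (\<lambda>p. A (fst p) * B (snd p))"
    by (intro integrable_lborel_pairI) simp_all
  from lborel_pair.integral_fst'[of "\<lambda>p. A (fst p) * B (snd p)"] int
  show "(LINT p|lborel. A (fst p) * B (snd p)) = (LINT x|lborel. A x) * (LINT y|lborel. B y)"
    by (simp add: lborel_prod)
qed

lemma integral_plane_affine:
  fixes f :: "plane \<Rightarrow> 'b::{banach, second_countable_topology}"
  assumes [measurable]: "f \<in> borel_measurable borel" and "c \<noteq> 0"
  shows "(LINT z|lborel. f (t + c *\<^sub>R z)) = (1 / c\<^sup>2) *\<^sub>R (LINT z|lborel. f z)"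
proof -
  have "(LINT z|lborel. f z) = (LINT z|density (distr lborel borel (\<lambda>x. t + c *\<^sub>R x)) (\<lambda>_. \<bar>c\<bar>^DIM(plane)). f z)"
    using lborel_affine[OF \<open>c \<noteq> 0\<close>, of t] by simp
  also have "\<dots> = c\<^sup>2 *\<^sub>R (LINT z|lborel. f (t + c *\<^sub>R z))"
    by (subst integral_density) (simp_all add: integral_distr power2_eq_square)
  finally show ?thesis using \<open>c \<noteq> 0\<close> by (simp add: power2_eq_square)
qed

text \<open>The standard Gaussian probability density of the plane, written as a product so that the
  known characteristic function of the normal distribution can be applied in each variable.\<close>

definition gauss :: "plane \<Rightarrow> real" where
  "gauss z = std_normal_density (fst z) * std_normal_density (snd z)"

lemma gauss_eq: "gauss z = exp (- (norm z)\<^sup>2 / 2) / (2 * pi)"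
proof -
  have "gauss z = (exp (- (fst z)\<^sup>2 / 2) * exp (- (snd z)\<^sup>2 / 2)) / (sqrt (2 * pi) * sqrt (2 * pi))"
    by (simp add: gauss_def std_normal_density_def)
  also have "sqrt (2 * pi) * sqrt (2 * pi) = 2 * pi" by simp
  also have "exp (- (fst z)\<^sup>2 / 2) * exp (- (snd z)\<^sup>2 / 2) = exp (- (norm z)\<^sup>2 / 2)"
    by (simp add: exp_add[symmetric] norm_prod_def add_divide_distrib)
  finally show ?thesis .
qed

lemma gauss_measurable [measurable]: "gauss \<in> borel_measurable borel"
  unfolding gauss_def by measurable

lemma gauss_nonneg: "gauss z \<ge> 0" by (simp add: gauss_def)

lemma gauss_fourier_1d:
  "integrable lborel (\<lambda>x. cis (x * t) * complex_of_real (std_normal_density x))"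
  "(LINT x|lborel. cis (x * t) * complex_of_real (std_normal_density x)) = complex_of_real (exp (- t\<^sup>2 / 2))"
proof -
  show "integrable lborel (\<lambda>x. cis (x * t) * complex_of_real (std_normal_density x))"
    by (rule Bochner_Integration.integrable_bound[OF integrable_normal_density[of 1 0]]) (auto simp: norm_mult)
  have "char std_normal_distribution t
      = (LINT x|lborel. std_normal_density x *\<^sub>R iexp (t * x))"
    unfolding char_def by (subst integral_density) auto
  then show "(LINT x|lborel. cis (x * t) * complex_of_real (std_normal_density x)) = complex_of_real (exp (- t\<^sup>2 / 2))"
    by (simp add: char_std_normal_distribution cis_conv_exp scaleR_conv_of_real mult.commute)
qed

lemma gauss_fourier:
  "integrable lborel (\<lambda>z. cis (z \<bullet> w) * complex_of_real (gauss z))"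
  "(LINT z|lborel. cis (z \<bullet> w) * complex_of_real (gauss z)) = complex_of_real (2 * pi * gauss w)"
proof -
  have eq: "cis (z \<bullet> w) * complex_of_real (gauss z)
     = (cis (fst z * fst w) * complex_of_real (std_normal_density (fst z))) *
       (cis (snd z * snd w) * complex_of_real (std_normal_density (snd z)))" for z
    by (simp add: gauss_def inner_prod_def cis_mult[symmetric])
  show "integrable lborel (\<lambda>z. cis (z \<bullet> w) * complex_of_real (gauss z))"
    unfolding eq by (rule integrable_pair_mult(1)[OF gauss_fourier_1d(1) gauss_fourier_1d(1)])
  have "exp (- (fst w)\<^sup>2 / 2) * exp (- (snd w)\<^sup>2 / 2) = 2 * pi * gauss w"
    by (simp add: gauss_eq exp_add[symmetric] norm_prod_def add_divide_distrib)
  then show "(LINT z|lborel. cis (z \<bullet> w) * complex_of_real (gauss z)) = complex_of_real (2 * pi * gauss w)"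
    unfolding eq integrable_pair_mult(2)[OF gauss_fourier_1d(1) gauss_fourier_1d(1)] gauss_fourier_1d(2)
    by (metis of_real_mult)
qed

lemma gauss_integrable: "integrable lborel gauss" "(LINT z|lborel. gauss z) = 1"
proof -
  have 1: "integrable lborel (\<lambda>z. complex_of_real (gauss z))"
    using gauss_fourier(1)[of 0] by simp
  show "integrable lborel gauss" using integrable_norm[OF 1] by (simp add: gauss_nonneg)
  have "(LINT z|lborel. complex_of_real (gauss z)) = 1"
    using gauss_fourier(2)[of 0] by (simp add: gauss_eq)
  then show "(LINT z|lborel. gauss z) = 1"
    by (metis integral_complex_of_real of_real_eq_1_iff)
qed

lemma gauss_scaled_integrable:
  assumes "e \<noteq> 0"
  shows "integrable lborel (\<lambda>\<zeta>. gauss (e *\<^sub>R \<zeta>))"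
proof -
  \<comment> \<open>The Bochner integral of a non-integrable function is \<open>0\<close>, so a
    nonzero value of the rescaled integral proves integrability.\<close>
  have "(LINT \<zeta>|lborel. gauss (0 + e *\<^sub>R \<zeta>)) \<noteq> 0"
    by (subst integral_plane_affine) (use assms gauss_integrable in auto)
  then show ?thesis using not_integrable_integral_eq[of lborel "\<lambda>\<zeta>. gauss (e *\<^sub>R \<zeta>)"] by auto
qed

lemma integrable_cis_mult:
  assumes "integrable lborel f"
  shows "integrable lborel (\<lambda>x. cis (x \<bullet> \<zeta>) * f x)"
proof -
  have [measurable]: "f \<in> borel_measurable borel" using assms borel_measurable_integrable by force
  show ?thesis by (rule Bochner_Integration.integrable_bound[OF assms]) (auto simp: norm_mult)
qed

section \<open>The Fourier integral and Plancherel's identity\<close>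

lemma fourier_integral_cis:
  "fourier_integral f \<zeta> = 1 / (2 * of_real pi) * (LINT x|lborel. cis (x \<bullet> (- \<zeta>)) * f x)"
  unfolding fourier_integral_def
  by (simp add: case_prod_unfold cis_conv_exp inner_prod_def algebra_simps)

lemma fourier_integral_measurable [measurable]:
  assumes [measurable]: "f \<in> borel_measurable borel"
  shows "fourier_integral f \<in> borel_measurable borel"
  unfolding fourier_integral_cis[abs_def] by measurable

lemma norm_fourier_integral_le:
  assumes "integrable lborel f"
  shows "norm (fourier_integral f \<zeta>) \<le> 1 / (2 * pi) * (LINT x|lborel. norm (f x))"
proof -
  have "norm (LINT x|lborel. cis (x \<bullet> (- \<zeta>)) * f x) \<le> (LINT x|lborel. norm (cis (x \<bullet> (- \<zeta>)) * f x))"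
    by (rule integral_norm_bound)
  then have "norm (LINT x|lborel. cis (x \<bullet> (- \<zeta>)) * f x) \<le> (LINT x|lborel. norm (f x))"
    by (simp add: norm_mult)
  then show ?thesis unfolding fourier_integral_cis by (simp add: norm_mult norm_divide divide_right_mono)
qed

text \<open>Shifts preserve the norm, so the elementary bound of a product by the sum of squares
  controls the inner integral uniformly in the shift, and the Gaussian has finite mass. This
  licenses the last exchange of integrals in the regularized identity.\<close>

lemma autocorrelation_integrable:
  assumes f: "square_integrable f"
  shows "integrable lborel (\<lambda>p. of_real (gauss (fst p)) * (f (snd p) * cnj (f (snd p + e *\<^sub>R fst p))))"
proof (rule integrable_lborel_pairI)
  have [measurable]: "f \<in> borel_measurable borel" using f by (rule square_integrable_measurable)
  show "(\<lambda>p. of_real (gauss (fst p)) * (f (snd p) * cnj (f (snd p + e *\<^sub>R fst p)))) \<in> borel_measurable borel"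
    by measurable
  have le: "L1_nn (\<lambda>x. f x * cnj (f (x + h))) \<le> ennreal (2 * (norm (abs_L2 f))\<^sup>2)" for h
  proof -
    have "L1_nn (\<lambda>x. f x * cnj (f (x + h)))
        \<le> (\<integral>\<^sup>+x. ennreal ((norm (f x))\<^sup>2) + ennreal ((norm (f (x + h)))\<^sup>2) \<partial>lborel)"
    proof (rule nn_integral_mono)
      fix x
      have "2 * (norm (f x) * norm (f (x + h))) \<le> (norm (f x))\<^sup>2 + (norm (f (x + h)))\<^sup>2"
        using sum_squares_bound[of "norm (f x)" "norm (f (x + h))"] by (simp add: mult.assoc)
      moreover have "0 \<le> norm (f x) * norm (f (x + h))" by simp
      ultimately have "norm (f x) * norm (f (x + h)) \<le> (norm (f x))\<^sup>2 + (norm (f (x + h)))\<^sup>2" by linarith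
      then show "ennreal (norm (f x * cnj (f (x + h)))) \<le> ennreal ((norm (f x))\<^sup>2) + ennreal ((norm (f (x + h)))\<^sup>2)"
        by (simp add: norm_mult flip: ennreal_plus)
    qed
    also have "\<dots> = ennreal ((norm (abs_L2 f))\<^sup>2) + ennreal ((norm (abs_L2 f))\<^sup>2)"
      using norm_abs_L2_nn[OF f] norm_abs_L2_nn[OF square_integrable_translate(1)[OF f], of h]
      by (simp add: nn_integral_add square_integrable_translate(2)[OF f])
    also have "\<dots> = ennreal (2 * (norm (abs_L2 f))\<^sup>2)" by (simp flip: ennreal_plus)
    finally show ?thesis .
  qed
  have "(\<integral>\<^sup>+w. L1_nn (\<lambda>x. of_real (gauss w) * (f x * cnj (f (x + e *\<^sub>R w)))) \<partial>lborel)
      = (\<integral>\<^sup>+w. ennreal (gauss w) * (L1_nn (\<lambda>x. f x * cnj (f (x + e *\<^sub>R w)))) \<partial>lborel)"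
    by (simp add: norm_mult[of "of_real (gauss _)"] gauss_nonneg ennreal_mult nn_integral_cmult)
  also have "\<dots> \<le> (\<integral>\<^sup>+w. ennreal (gauss w) * ennreal (2 * (norm (abs_L2 f))\<^sup>2) \<partial>lborel)"
    by (intro nn_integral_mono mult_left_mono le) simp
  also have "\<dots> = (\<integral>\<^sup>+w. ennreal (gauss w) \<partial>lborel) * ennreal (2 * (norm (abs_L2 f))\<^sup>2)"
    by (rule nn_integral_multc) simp
  also have "(\<integral>\<^sup>+w. ennreal (gauss w) \<partial>lborel) = 1"
    using gauss_integrable by (simp add: nn_integral_eq_integral gauss_nonneg)
  finally show "(\<integral>\<^sup>+w. \<integral>\<^sup>+x. ennreal (norm (of_real (gauss (fst (w, x))) * (f (snd (w, x)) *
      cnj (f (snd (w, x) + e *\<^sub>R fst (w, x)))))) \<partial>lborel \<partial>lborel) < \<infinity>"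
    by (simp add: le_less_trans)
qed

text \<open>Multiplying $|\hat f|^2$ by a dilated Gaussian makes the triple integral absolutely convergent;
  integrating the frequency first turns it into a Gaussian average of autocorrelations of \<open>f\<close>.
  Letting \<open>e\<close> tend to \<open>0\<close> gives Plancherel's identity.\<close>

lemma plancherel_regularized:
  assumes f: "square_integrable f" and fi: "integrable lborel f" and "e > 0"
  defines "h \<equiv> \<lambda>\<zeta>. (LINT x|lborel. cis (x \<bullet> (- \<zeta>)) * f x)"
  shows "(LINT \<zeta>|lborel. of_real (gauss (e *\<^sub>R \<zeta>)) * (h \<zeta> * cnj (h \<zeta>)))
    = of_real (2 * pi) * (LINT w|lborel. of_real (gauss w) * (LINT x|lborel. f x * cnj (f (x + e *\<^sub>R w))))"
proof -
  have [measurable]: "f \<in> borel_measurable borel" using f by (rule square_integrable_measurable)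
  have cfi: "integrable lborel (\<lambda>x. cnj (f x))" using fi by simp
  define G where "G p = f (fst p) * cnj (f (snd p))" for p :: "plane \<times> plane"
  define H where "H p \<zeta> = G p * (cis ((snd p - fst p) \<bullet> \<zeta>) * of_real (gauss (e *\<^sub>R \<zeta>)))"
    for p :: "plane \<times> plane" and \<zeta> :: "plane"
  have [measurable]: "G \<in> borel_measurable borel"
    unfolding G_def by measurable
  have G: "integrable lborel G" unfolding G_def by (rule integrable_pair_mult(1)[OF fi cfi])
  have ge: "integrable lborel (\<lambda>\<zeta>. complex_of_real (gauss (e *\<^sub>R \<zeta>)))"
    using gauss_scaled_integrable[of e] \<open>e > 0\<close> by simp
  have "integrable lborel (\<lambda>q. G (fst q) * complex_of_real (gauss (e *\<^sub>R (snd q))))"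
    by (rule integrable_pair_mult(1)[OF G ge])
  then have Hint: "integrable (lborel \<Otimes>\<^sub>M lborel) (case_prod H)"
    unfolding lborel_prod
    by (rule Bochner_Integration.integrable_bound)
       (auto simp: H_def norm_mult case_prod_unfold)
  have "of_real (gauss (e *\<^sub>R \<zeta>)) * (h \<zeta> * cnj (h \<zeta>)) = (LINT p|lborel. H p \<zeta>)" for \<zeta>
  proof -
    have "cnj (h \<zeta>) = (LINT x|lborel. cis (x \<bullet> \<zeta>) * cnj (f x))"
      unfolding h_def by (subst Bochner_Integration.integral_cnj[symmetric]) (simp add: cis_cnj del: Bochner_Integration.integral_cnj)
    then have "h \<zeta> * cnj (h \<zeta>) = (LINT p|lborel. (cis (fst p \<bullet> (- \<zeta>)) * f (fst p)) * (cis (snd p \<bullet> \<zeta>) * cnj (f (snd p))))"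
      unfolding h_def
      by (subst integrable_pair_mult(2)) (auto intro!: integrable_cis_mult fi cfi simp del: inner_minus_right)
    also have "\<dots> = (LINT p|lborel. G p * cis ((snd p - fst p) \<bullet> \<zeta>))"
    proof (intro Bochner_Integration.integral_cong refl)
      fix p :: "plane \<times> plane"
      have "cis (fst p \<bullet> (- \<zeta>)) * cis (snd p \<bullet> \<zeta>) = cis ((snd p - fst p) \<bullet> \<zeta>)"
        by (simp add: cis_mult inner_diff_left)
      note eq = this[symmetric]
      show "(cis (fst p \<bullet> (- \<zeta>)) * f (fst p)) * (cis (snd p \<bullet> \<zeta>) * cnj (f (snd p)))
          = G p * cis ((snd p - fst p) \<bullet> \<zeta>)"
        unfolding eq G_def by (simp only: mult_ac)
    qed
    finally have "h \<zeta> * cnj (h \<zeta>) = (LINT p|lborel. G p * cis ((snd p - fst p) \<bullet> \<zeta>))" .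
    then have "of_real (gauss (e *\<^sub>R \<zeta>)) * (h \<zeta> * cnj (h \<zeta>))
        = (LINT p|lborel. of_real (gauss (e *\<^sub>R \<zeta>)) * (G p * cis ((snd p - fst p) \<bullet> \<zeta>)))"
      by simp
    also have "\<dots> = (LINT p|lborel. H p \<zeta>)"
      by (intro Bochner_Integration.integral_cong refl) (simp only: H_def mult_ac)
    finally show ?thesis .
  qed
  then have "(LINT \<zeta>|lborel. of_real (gauss (e *\<^sub>R \<zeta>)) * (h \<zeta> * cnj (h \<zeta>)))
      = (LINT \<zeta>|lborel. LINT p|lborel. H p \<zeta>)" by simp
  also have "\<dots> = (LINT p|lborel. LINT \<zeta>|lborel. H p \<zeta>)"
    by (rule lborel_pair.Fubini_integral[OF Hint])
  also have "\<dots> = (LINT p|lborel. G p * of_real (2 * pi / e\<^sup>2 * gauss ((1 / e) *\<^sub>R (snd p - fst p))))"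
  proof (intro Bochner_Integration.integral_cong refl)
    fix p :: "plane \<times> plane"
    let ?v = "(1 / e) *\<^sub>R (snd p - fst p)"
    have "(LINT \<zeta>|lborel. cis ((snd p - fst p) \<bullet> \<zeta>) * complex_of_real (gauss (e *\<^sub>R \<zeta>)))
       = (LINT \<zeta>|lborel. (\<lambda>\<theta>. cis (\<theta> \<bullet> ?v) * complex_of_real (gauss \<theta>)) (0 + e *\<^sub>R \<zeta>))"
      using \<open>e > 0\<close> by (simp add: inner_commute)
    also have "\<dots> = (1 / e\<^sup>2) *\<^sub>R complex_of_real (2 * pi * gauss ?v)"
      by (subst integral_plane_affine) (use \<open>e > 0\<close> in \<open>auto simp only: gauss_fourier(2)\<close>, measurable)
    finally show "(LINT \<zeta>|lborel. H p \<zeta>) = G p * of_real (2 * pi / e\<^sup>2 * gauss ?v)"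
      unfolding H_def by (simp add: scaleR_conv_of_real)
  qed
  also have "\<dots> = (LINT x|lborel. LINT y|lborel. G (x, y) * of_real (2 * pi / e\<^sup>2 * gauss ((1 / e) *\<^sub>R (y - x))))"
  proof -
    have "integrable lborel (\<lambda>p. G p * of_real (2 * pi / e\<^sup>2 * gauss ((1 / e) *\<^sub>R (snd p - fst p))))"
    proof (rule Bochner_Integration.integrable_bound[where f = "\<lambda>p. of_real (1 / e\<^sup>2) * G p"])
      have "gauss z \<le> 1 / (2 * pi)" for z by (simp add: gauss_eq divide_right_mono)
      then have le: "2 * pi / e\<^sup>2 * gauss z \<le> 1 / e\<^sup>2" for z
        using \<open>e > 0\<close> by (simp add: field_simps)
      show "AE p in lborel. norm (G p * of_real (2 * pi / e\<^sup>2 * gauss ((1 / e) *\<^sub>R (snd p - fst p))))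
          \<le> norm (of_real (1 / e\<^sup>2) * G p)"
      proof (intro AE_I2)
        fix p :: "plane \<times> plane"
        let ?v = "(1 / e) *\<^sub>R (snd p - fst p)"
        have n1: "norm (complex_of_real (2 * pi / e\<^sup>2 * gauss ?v)) = 2 * pi / e\<^sup>2 * gauss ?v"
          unfolding norm_of_real by (rule abs_of_nonneg) (simp add: gauss_nonneg)
        have n2: "norm (complex_of_real (1 / e\<^sup>2)) = 1 / e\<^sup>2"
          unfolding norm_of_real by (rule abs_of_nonneg) simp
        show "norm (G p * of_real (2 * pi / e\<^sup>2 * gauss ?v)) \<le> norm (of_real (1 / e\<^sup>2) * G p)"
          unfolding norm_mult[of "G p"] norm_mult[of "complex_of_real (1 / e\<^sup>2)"] n1 n2 mult.commute[of "1 / e\<^sup>2"]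
          by (rule mult_left_mono[OF le norm_ge_zero])
      qed
    qed (use G in simp_all)
    from lborel_pair.integral_fst'[unfolded lborel_prod, OF this]
    show ?thesis by (simp only: fst_conv snd_conv)
  qed
  also have "\<dots> = (LINT x|lborel. LINT w|lborel. of_real (2 * pi) * (of_real (gauss w) * (f x * cnj (f (x + e *\<^sub>R w)))))"
  proof (rule Bochner_Integration.integral_cong[OF refl])
    fix x :: "plane"
    let ?k = "\<lambda>y. G (x, y) * complex_of_real (2 * pi / e\<^sup>2 * gauss ((1 / e) *\<^sub>R (y - x)))"
    \<comment> \<open>Substitution y = x + e w; the Jacobian e^2 cancels the 1/e^2 produced by the
      frequency integral.\<close>
    have "(LINT w|lborel. ?k (x + e *\<^sub>R w)) = (1 / e\<^sup>2) *\<^sub>R (LINT y|lborel. ?k y)"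
      by (rule integral_plane_affine) (use \<open>e > 0\<close> in \<open>auto simp: G_def\<close>)
    moreover have "I2 = of_real (e\<^sup>2) * I1" if "I1 = (1 / e\<^sup>2) *\<^sub>R I2" for I1 I2 :: complex
      using that \<open>e > 0\<close> by (simp add: scaleR_conv_of_real)
    ultimately have "(LINT y|lborel. ?k y) = of_real (e\<^sup>2) * (LINT w|lborel. ?k (x + e *\<^sub>R w))" by blast
    also have "\<dots> = (LINT w|lborel. of_real (e\<^sup>2) * ?k (x + e *\<^sub>R w))"
      by (rule integral_mult_right_zero[symmetric])
    also have "\<dots> = (LINT w|lborel. of_real (2 * pi) * (of_real (gauss w) * (f x * cnj (f (x + e *\<^sub>R w)))))"
      by (intro Bochner_Integration.integral_cong) (use \<open>e > 0\<close> in \<open>auto simp: G_def\<close>)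
    finally show "(LINT y|lborel. ?k y) = (LINT w|lborel. of_real (2 * pi) * (of_real (gauss w) * (f x * cnj (f (x + e *\<^sub>R w)))))" .
  qed
  also have "\<dots> = of_real (2 * pi) * (LINT x|lborel. LINT w|lborel. (of_real (gauss w) * (f x * cnj (f (x + e *\<^sub>R w)))))"
    by simp
  also have "(LINT x|lborel. LINT w|lborel. (of_real (gauss w) * (f x * cnj (f (x + e *\<^sub>R w)))))
     = (LINT w|lborel. LINT x|lborel. (of_real (gauss w) * (f x * cnj (f (x + e *\<^sub>R w)))))"
    by (rule lborel_pair.Fubini_integral)
       (use autocorrelation_integrable[OF f, of e] in \<open>simp add: lborel_prod case_prod_unfold\<close>)
  finally show ?thesis by simp
qed

text \<open>On the spatial side the autocorrelation is an inner product of \<open>f\<close> with a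
  translate: continuity of translations gives its limit and Cauchy-Schwarz a constant bound. On the
  frequency side the dilated Gaussians increase to 1/(2 pi) because \<open>e n\<close>
  decreases.\<close>

lemma plancherel:
  assumes f: "square_integrable f" and fi: "integrable lborel f"
  shows "square_integrable (fourier_integral f)"
    "norm (abs_L2 (fourier_integral f)) = norm (abs_L2 f)"
proof -
  have [measurable]: "f \<in> borel_measurable borel" using f by (rule square_integrable_measurable)
  define h where "h \<zeta> = (LINT x|lborel. cis (x \<bullet> (- \<zeta>)) * f x)" for \<zeta>
  have [measurable]: "h \<in> borel_measurable borel" unfolding h_def by measurable
  define e where "e n = 1 / real (Suc n)" for n
  have e: "e n > 0" "e (Suc n) \<le> e n" for n by (auto simp: e_def field_simps)
  have e0: "e \<longlonglongrightarrow> 0" unfolding e_def by (rule LIMSEQ_Suc[OF lim_1_over_n])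
  define c where "c n w = inner (abs_L2 f) (abs_L2 (\<lambda>x. f (x + e n *\<^sub>R w)))" for n w
  have c_eq: "c n w = Re (LINT x|lborel. f x * cnj (f (x + e n *\<^sub>R w)))" for n w
    unfolding c_def by (rule inner_abs_L2[OF f square_integrable_translate(1)[OF f]])
  have [measurable]: "c n \<in> borel_measurable borel" for n unfolding c_eq[abs_def] by measurable
  have auto: "integrable lborel (\<lambda>w. of_real (gauss w) * (LINT x|lborel. f x * cnj (f (x + e n *\<^sub>R w))))" for n
    using lborel_pair.integrable_fst'[of "\<lambda>p. of_real (gauss (fst p)) * (f (snd p) * cnj (f (snd p + e n *\<^sub>R fst p)))"]
      autocorrelation_integrable[OF f, of "e n"] by (simp add: lborel_prod)
  have "complex_of_real (LINT \<zeta>|lborel. gauss (e n *\<^sub>R \<zeta>) * (norm (h \<zeta>))\<^sup>2)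
      = of_real (2 * pi) * (LINT w|lborel. of_real (gauss w) * (LINT x|lborel. f x * cnj (f (x + e n *\<^sub>R w))))" for n
    using plancherel_regularized[OF f fi e(1)[of n]] unfolding h_def[symmetric]
    by (simp add: complex_norm_square[symmetric] flip: of_real_mult of_real_power)
  from arg_cong[OF this, of Re] have "(LINT \<zeta>|lborel. gauss (e n *\<^sub>R \<zeta>) * (norm (h \<zeta>))\<^sup>2)
      = 2 * pi * (LINT w|lborel. gauss w * c n w)" for n
    by (simp add: integral_Re[OF auto, symmetric] c_eq)
  moreover have "(\<lambda>n. LINT w|lborel. gauss w * c n w) \<longlonglongrightarrow> (LINT w|lborel. gauss w * (norm (abs_L2 f))\<^sup>2)"
  proof (rule integral_dominated_convergence[where w = "\<lambda>w. gauss w * (norm (abs_L2 f))\<^sup>2"])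
    show "AE w in lborel. (\<lambda>n. gauss w * c n w) \<longlonglongrightarrow> gauss w * (norm (abs_L2 f))\<^sup>2"
    proof (rule AE_I2)
      fix w :: "plane"
      have "(\<lambda>n. e n *\<^sub>R w) \<longlonglongrightarrow> 0 *\<^sub>R w" by (intro tendsto_intros e0)
      then have "(\<lambda>n. abs_L2 (\<lambda>x. f (x + e n *\<^sub>R w))) \<longlonglongrightarrow> abs_L2 f"
        by (intro translate_tendsto_L2[OF f]) simp
      then show "(\<lambda>n. gauss w * c n w) \<longlonglongrightarrow> gauss w * (norm (abs_L2 f))\<^sup>2"
        unfolding c_def power2_norm_eq_inner by (intro tendsto_intros)
    qed
    show "AE w in lborel. norm (gauss w * c n w) \<le> gauss w * (norm (abs_L2 f))\<^sup>2" for n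
    proof (rule AE_I2)
      fix w
      have "\<bar>c n w\<bar> \<le> norm (abs_L2 f) * norm (abs_L2 f)"
        unfolding c_def using Cauchy_Schwarz_ineq2[of "abs_L2 f" "abs_L2 (\<lambda>x. f (x + e n *\<^sub>R w))"]
        by (simp add: square_integrable_translate(2)[OF f])
      then show "norm (gauss w * c n w) \<le> gauss w * (norm (abs_L2 f))\<^sup>2"
        by (simp add: abs_mult gauss_nonneg mult_left_mono power2_eq_square)
    qed
  qed (use gauss_integrable in auto)
  ultimately have lim: "(\<lambda>n. LINT \<zeta>|lborel. gauss (e n *\<^sub>R \<zeta>) * (norm (h \<zeta>))\<^sup>2) \<longlonglongrightarrow> 2 * pi * (norm (abs_L2 f))\<^sup>2"
    using gauss_integrable by (auto intro!: tendsto_mult_left)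
  have hbound: "norm (h \<zeta>) \<le> (LINT x|lborel. norm (f x))" for \<zeta>
    unfolding h_def using integral_norm_bound[of lborel "\<lambda>x. cis (x \<bullet> (- \<zeta>)) * f x"] by (simp add: norm_mult)
  have int: "integrable lborel (\<lambda>\<zeta>. gauss (e n *\<^sub>R \<zeta>) * (norm (h \<zeta>))\<^sup>2)" for n
  proof (rule Bochner_Integration.integrable_bound[where f = "\<lambda>\<zeta>. gauss (e n *\<^sub>R \<zeta>) * (LINT x|lborel. norm (f x))\<^sup>2"])
    have "integrable lborel (\<lambda>\<zeta>. gauss (e n *\<^sub>R \<zeta>))" using e(1)[of n] by (intro gauss_scaled_integrable) simp
    then show "integrable lborel (\<lambda>\<zeta>. gauss (e n *\<^sub>R \<zeta>) * (LINT x|lborel. norm (f x))\<^sup>2)" by simp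
    show "AE \<zeta> in lborel. norm (gauss (e n *\<^sub>R \<zeta>) * (norm (h \<zeta>))\<^sup>2) \<le> norm (gauss (e n *\<^sub>R \<zeta>) * (LINT x|lborel. norm (f x))\<^sup>2)"
      using hbound by (intro AE_I2) (auto simp: abs_mult gauss_nonneg intro!: mult_left_mono power_mono)
  qed simp
  have mono: "mono (\<lambda>n. gauss (e n *\<^sub>R \<zeta>) * (norm (h \<zeta>))\<^sup>2)" for \<zeta>
  proof (rule incseq_SucI)
    fix n
    have "norm (e (Suc n) *\<^sub>R \<zeta>) \<le> norm (e n *\<^sub>R \<zeta>)" using e(1)[of n] e(1)[of "Suc n"] e(2)[of n] by (simp add: mult_right_mono)
    then have "(norm (e (Suc n) *\<^sub>R \<zeta>))\<^sup>2 \<le> (norm (e n *\<^sub>R \<zeta>))\<^sup>2" by (intro power_mono) auto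
    then show "gauss (e n *\<^sub>R \<zeta>) * (norm (h \<zeta>))\<^sup>2 \<le> gauss (e (Suc n) *\<^sub>R \<zeta>) * (norm (h \<zeta>))\<^sup>2"
      unfolding gauss_eq by (intro mult_right_mono divide_right_mono) auto
  qed
  have pw: "(\<lambda>n. gauss (e n *\<^sub>R \<zeta>) * (norm (h \<zeta>))\<^sup>2) \<longlonglongrightarrow> 1 / (2 * pi) * (norm (h \<zeta>))\<^sup>2" for \<zeta>
  proof -
    have "(\<lambda>n. gauss (e n *\<^sub>R \<zeta>) * (norm (h \<zeta>))\<^sup>2) \<longlonglongrightarrow> exp (- (norm (0 *\<^sub>R \<zeta>))\<^sup>2 / 2) / (2 * pi) * (norm (h \<zeta>))\<^sup>2"
      unfolding gauss_eq by (intro tendsto_intros e0) simp_all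
    then show ?thesis by simp
  qed
  \<comment> \<open>Square integrability of \<open>h\<close> is a conclusion, so no majorant is
    available; monotone convergence derives it from the finite limit \<open>lim\<close>.\<close>
  have hint: "integrable lborel (\<lambda>\<zeta>. 1 / (2 * pi) * (norm (h \<zeta>))\<^sup>2)"
    by (rule integrable_monotone_convergence[OF int AE_I2[OF mono] AE_I2[OF pw] lim]) simp
  have hval: "(LINT \<zeta>|lborel. 1 / (2 * pi) * (norm (h \<zeta>))\<^sup>2) = 2 * pi * (norm (abs_L2 f))\<^sup>2"
    by (rule integral_monotone_convergence[OF int AE_I2[OF mono] AE_I2[OF pw] lim]) simp
  have F: "fourier_integral f = (\<lambda>\<zeta>. 1 / (2 * of_real pi) * h \<zeta>)"
    by (rule ext) (simp only: fourier_integral_cis h_def)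
  have F2: "(norm (fourier_integral f \<zeta>))\<^sup>2 = 1 / (2 * pi) * (1 / (2 * pi) * (norm (h \<zeta>))\<^sup>2)" for \<zeta>
    unfolding F by (simp add: norm_mult norm_divide power_divide power2_eq_square)
  show sq: "square_integrable (fourier_integral f)"
    unfolding square_integrable_def F2 using integrable_mult_right[OF hint, of "1 / (2 * pi)"] by simp
  have "(norm (abs_L2 (fourier_integral f)))\<^sup>2 = (norm (abs_L2 f))\<^sup>2"
    unfolding norm_abs_L2_sq[OF sq] F2
    by (subst integral_mult_right_zero) (simp only: hval, simp)
  then show "norm (abs_L2 (fourier_integral f)) = norm (abs_L2 f)" by (simp add: power2_eq_iff_nonneg)
qed

section \<open>The Fourier transform as a unitary operator\<close>

definition L1_L2 :: "(plane \<Rightarrow> complex) \<Rightarrow> bool" where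
  "L1_L2 f \<longleftrightarrow> square_integrable f \<and> integrable lborel f"

lemma L1_L2_add: "L1_L2 f \<Longrightarrow> L1_L2 g \<Longrightarrow> L1_L2 (\<lambda>z. f z + g z)"
  by (simp add: L1_L2_def square_integrable_add)

lemma L1_L2_cmult: "L1_L2 f \<Longrightarrow> L1_L2 (\<lambda>z. c * f z)"
  by (simp add: L1_L2_def square_integrable_cmult)

lemma fourier_integral_add:
  assumes "integrable lborel f" "integrable lborel g"
  shows "fourier_integral (\<lambda>z. f z + g z) = (\<lambda>\<zeta>. fourier_integral f \<zeta> + fourier_integral g \<zeta>)"
proof (rule ext)
  fix \<zeta>
  show "fourier_integral (\<lambda>z. f z + g z) \<zeta> = fourier_integral f \<zeta> + fourier_integral g \<zeta>"
    using integrable_cis_mult[OF assms(1), of "- \<zeta>"] integrable_cis_mult[OF assms(2), of "- \<zeta>"]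
    by (simp add: fourier_integral_cis distrib_left add_divide_distrib)
qed

lemma fourier_integral_diff:
  assumes "integrable lborel f" "integrable lborel g"
  shows "fourier_integral (\<lambda>z. f z - g z) = (\<lambda>\<zeta>. fourier_integral f \<zeta> - fourier_integral g \<zeta>)"
proof (rule ext)
  fix \<zeta>
  show "fourier_integral (\<lambda>z. f z - g z) \<zeta> = fourier_integral f \<zeta> - fourier_integral g \<zeta>"
    using integrable_cis_mult[OF assms(1), of "- \<zeta>"] integrable_cis_mult[OF assms(2), of "- \<zeta>"]
    by (simp add: fourier_integral_cis right_diff_distrib diff_divide_distrib)
qed

lemma fourier_integral_cmult:
  "fourier_integral (\<lambda>z. c * f z) \<zeta> = c * fourier_integral f \<zeta>"
  by (simp add: fourier_integral_cis mult.left_commute[of _ c])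

section \<open>Reflection and complex scaling\<close>

lemma distr_lborel_uminus: "distr lborel borel uminus = (lborel :: plane measure)"
  using lborel_affine[of "-1" "0 :: plane"]
  by (simp add: density_1)

lemma AE_lborel_uminus:
  assumes "AE z in lborel. P (z :: plane)"
  shows "AE z in lborel. P (- z)"
proof -
  have "AE z in distr lborel borel uminus. P (z :: plane)"
    by (subst distr_lborel_uminus) (rule assms)
  then show ?thesis by (rule AE_distrD[rotated]) simp
qed

lemma nn_integral_uminus:
  assumes [measurable]: "f \<in> borel_measurable borel"
  shows "(\<integral>\<^sup>+z. f (- z) \<partial>lborel) = (\<integral>\<^sup>+z. f z \<partial>(lborel :: plane measure))"
  by (subst distr_lborel_uminus[symmetric]) (simp add: nn_integral_distr)

lemma integral_uminus_plane:
  fixes f :: "plane \<Rightarrow> complex"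
  assumes [measurable]: "f \<in> borel_measurable borel"
  shows "(LINT z|lborel. f (- z)) = (LINT z|lborel. f z)"
  using integral_plane_affine[of f "-1" 0] by simp

lemma square_integrable_uminus:
  assumes "square_integrable f"
  shows "square_integrable (\<lambda>z. f (- z))"
proof -
  have [measurable]: "f \<in> borel_measurable borel" using assms by (rule square_integrable_measurable)
  show ?thesis using assms nn_integral_uminus[of "\<lambda>z. ennreal ((norm (f z))\<^sup>2)"]
    by (simp add: square_integrable_iff_nn)
qed

lemma integrable_uminus_plane:
  fixes f :: "plane \<Rightarrow> complex"
  assumes "integrable lborel f"
  shows "integrable lborel (\<lambda>z. f (- z))"
proof -
  have [measurable]: "f \<in> borel_measurable borel" using assms borel_measurable_integrable by force
  show ?thesis using assms nn_integral_uminus[of "\<lambda>z. ennreal (norm (f z))"]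
    by (simp add: integrable_iff_bounded)
qed

lift_definition reflect :: "L2 \<Rightarrow> L2" is "\<lambda>f z. f (- z)"
proof -
  fix f g :: "plane \<Rightarrow> complex"
  assume "L2_rel f g"
  then show "L2_rel (\<lambda>z. f (- z)) (\<lambda>z. g (- z))"
    using AE_lborel_uminus[of "\<lambda>z. f z = g z"] by (simp add: L2_rel_def square_integrable_uminus)
qed

lemma reflect_abs: "square_integrable f \<Longrightarrow> reflect (abs_L2 f) = abs_L2 (\<lambda>z. f (- z))"
  by (simp add: reflect.abs_eq L2_rel_def)

lemma reflect_diff: "reflect (u - v) = reflect u - reflect v"
proof -
  note s = square_integrable_rep[of u] square_integrable_rep[of v]
  have "reflect (abs_L2 (rep_L2 u) - abs_L2 (rep_L2 v)) = reflect (abs_L2 (rep_L2 u)) - reflect (abs_L2 (rep_L2 v))"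
    using s by (simp add: abs_L2_diff square_integrable_diff reflect_abs square_integrable_uminus)
  then show ?thesis by (simp add: abs_rep_L2)
qed

lemma norm_reflect: "norm (reflect u) = norm u"
proof -
  have "ennreal ((norm (reflect (abs_L2 (rep_L2 u))))\<^sup>2) = ennreal ((norm u)\<^sup>2)"
    using norm_abs_L2_nn[OF square_integrable_uminus[OF square_integrable_rep[of u]]] norm_L2_nn[of u]
      nn_integral_uminus[of "\<lambda>z. ennreal ((norm (rep_L2 u z))\<^sup>2)"]
    by (simp add: reflect_abs square_integrable_rep)
  then show ?thesis by (simp add: abs_rep_L2 power2_eq_iff_nonneg)
qed

lemma reflect_tendsto:
  assumes "X \<longlonglongrightarrow> u"
  shows "(\<lambda>n. reflect (X n)) \<longlonglongrightarrow> reflect u"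
proof -
  have "(\<lambda>n. norm (reflect (X n) - reflect u)) \<longlonglongrightarrow> 0"
    using assms by (simp add: reflect_diff[symmetric] norm_reflect LIM_zero tendsto_norm_zero)
  then show ?thesis by (simp add: LIM_zero_iff tendsto_norm_zero_iff)
qed

lemma norm_cscale: "norm (cscale c u) = norm c * norm u"
proof -
  have "ennreal ((norm (cscale c u))\<^sup>2) = (\<integral>\<^sup>+z. ennreal ((norm c)\<^sup>2) * ennreal ((norm (rep_L2 u z))\<^sup>2) \<partial>lborel)"
    unfolding norm_L2_nn using rep_L2_cscale[of c u]
    by (intro nn_integral_cong_AE) (auto simp: norm_mult power_mult_distrib ennreal_mult)
  also have "\<dots> = ennreal ((norm c * norm u)\<^sup>2)"
    by (simp add: nn_integral_cmult norm_L2_nn[symmetric] ennreal_mult power_mult_distrib)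
  finally show ?thesis by (simp add: power2_eq_iff_nonneg)
qed

lemma cscale_add: "cscale c (u + v) = cscale c u + cscale c v"
  by transfer (auto simp: L2_rel_def distrib_left square_integrable_add square_integrable_cmult)

lemma cscale_cscale: "cscale c (cscale d u) = cscale (c * d) u"
  by transfer (auto simp: L2_rel_def mult.assoc intro!: square_integrable_cmult
      square_integrable_cmult[where c = "c * d" for c d, simplified mult.assoc])

lemma bounded_linear_cscale: "bounded_linear (cscale c)"
proof (rule bounded_linear_intro[of _ "norm c"])
  show "cscale c (r *\<^sub>R u) = r *\<^sub>R cscale c u" for r u
    by (simp add: scaleR_eq_cscale cscale_cscale mult.commute)
qed (simp_all add: cscale_add norm_cscale mult.commute)

section \<open>Extension of the Fourier integral by density\<close>

lemma fourier_L1_L2_diff: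
  assumes "L1_L2 f" "L1_L2 g"
  shows "norm (abs_L2 (fourier_integral f) - abs_L2 (fourier_integral g)) = norm (abs_L2 f - abs_L2 g)"
proof -
  have "abs_L2 (fourier_integral f) - abs_L2 (fourier_integral g) = abs_L2 (fourier_integral (\<lambda>z. f z - g z))"
    using assms plancherel(1)[of f] plancherel(1)[of g]
    by (simp add: L1_L2_def abs_L2_diff fourier_integral_diff)
  then show ?thesis
    using assms plancherel(2)[of "\<lambda>z. f z - g z"]
    by (simp add: L1_L2_def abs_L2_diff square_integrable_diff)
qed

definition trunc :: "nat \<Rightarrow> L2 \<Rightarrow> plane \<Rightarrow> complex" where
  "trunc n u = cutoff n (rep_L2 u)"

lemma trunc_L1_L2: "L1_L2 (trunc n u)"
  unfolding trunc_def L1_L2_def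
  by (intro conjI integrable_cutoff rep_L2_measurable square_integrable_bound[OF square_integrable_rep cutoff_measurable cutoff_norm_le])

lemma trunc_tendsto: "(\<lambda>n. abs_L2 (trunc n u)) \<longlonglongrightarrow> u"
  unfolding trunc_def using cutoff_tendsto_L2[OF square_integrable_rep[of u]] by (simp add: abs_rep_L2)

text \<open>Defined through one fixed approximating sequence; its independence of that choice is
  \<open>fourier_ext_approx\<close>.\<close>

definition fourier_ext :: "L2 \<Rightarrow> L2" where
  "fourier_ext u = lim (\<lambda>n. abs_L2 (fourier_integral (trunc n u)))"

text \<open>The isometry on \<open>L1_L2\<close> makes images of two sequences with the same limit
  come together. Algebraic properties of \<open>fourier_ext\<close> can then be read off from
  whichever approximants are convenient, such as sums or reflections of truncations.\<close>

lemma fourier_ext_approx: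
  assumes f: "\<And>n. L1_L2 (f n)" and lim: "(\<lambda>n. abs_L2 (f n)) \<longlonglongrightarrow> u"
  shows "(\<lambda>n. abs_L2 (fourier_integral (f n))) \<longlonglongrightarrow> fourier_ext u"
proof -
  have "Cauchy (\<lambda>n. abs_L2 (fourier_integral (trunc n u)))"
    using LIMSEQ_imp_Cauchy[OF trunc_tendsto[of u]]
    unfolding Cauchy_def dist_norm fourier_L1_L2_diff[OF trunc_L1_L2 trunc_L1_L2] .
  then have *: "(\<lambda>n. abs_L2 (fourier_integral (trunc n u))) \<longlonglongrightarrow> fourier_ext u"
    unfolding fourier_ext_def by (simp add: Cauchy_convergent_iff convergent_LIMSEQ_iff)
  have "(\<lambda>n. abs_L2 (f n) - abs_L2 (trunc n u)) \<longlonglongrightarrow> u - u"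
    by (intro tendsto_diff lim trunc_tendsto)
  then have "(\<lambda>n. norm (abs_L2 (f n) - abs_L2 (trunc n u))) \<longlonglongrightarrow> 0"
    by (simp add: tendsto_norm_zero)
  then have "(\<lambda>n. norm (abs_L2 (fourier_integral (f n)) - abs_L2 (fourier_integral (trunc n u)))) \<longlonglongrightarrow> 0"
    by (simp only: fourier_L1_L2_diff[OF f trunc_L1_L2])
  from tendsto_add[OF tendsto_norm_zero_cancel[OF this] *] show ?thesis by simp
qed

lemma fourier_ext_abs:
  assumes "L1_L2 f"
  shows "fourier_ext (abs_L2 f) = abs_L2 (fourier_integral f)"
  using LIMSEQ_unique[OF tendsto_const fourier_ext_approx[of "\<lambda>_. f" "abs_L2 f"]] assms by simp

lemma norm_fourier_ext: "norm (fourier_ext u) = norm u"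
proof (rule LIMSEQ_unique)
  show "(\<lambda>n. norm (abs_L2 (fourier_integral (trunc n u)))) \<longlonglongrightarrow> norm (fourier_ext u)"
    by (intro tendsto_norm fourier_ext_approx trunc_L1_L2 trunc_tendsto)
  have "(\<lambda>n. norm (abs_L2 (trunc n u))) \<longlonglongrightarrow> norm u" by (intro tendsto_norm trunc_tendsto)
  then show "(\<lambda>n. norm (abs_L2 (fourier_integral (trunc n u)))) \<longlonglongrightarrow> norm u"
    using plancherel(2) trunc_L1_L2 by (simp add: L1_L2_def)
qed

lemma fourier_ext_add: "fourier_ext (u + v) = fourier_ext u + fourier_ext v"
proof (rule LIMSEQ_unique)
  let ?f = "\<lambda>n z. trunc n u z + trunc n v z"
  show "(\<lambda>n. abs_L2 (fourier_integral (?f n))) \<longlonglongrightarrow> fourier_ext (u + v)"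
  proof (rule fourier_ext_approx)
    show "L1_L2 (?f n)" for n by (intro L1_L2_add trunc_L1_L2)
    have "(\<lambda>n. abs_L2 (trunc n u) + abs_L2 (trunc n v)) \<longlonglongrightarrow> u + v"
      by (intro tendsto_add trunc_tendsto)
    then show "(\<lambda>n. abs_L2 (?f n)) \<longlonglongrightarrow> u + v"
      using trunc_L1_L2 by (simp add: L1_L2_def abs_L2_add)
  qed
  have "abs_L2 (fourier_integral (?f n)) = abs_L2 (fourier_integral (trunc n u)) + abs_L2 (fourier_integral (trunc n v))" for n
    using trunc_L1_L2[of n u] trunc_L1_L2[of n v] plancherel(1)[of "trunc n u"] plancherel(1)[of "trunc n v"]
    by (simp add: L1_L2_def abs_L2_add fourier_integral_add)
  then show "(\<lambda>n. abs_L2 (fourier_integral (?f n))) \<longlonglongrightarrow> fourier_ext u + fourier_ext v"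
    by (simp add: tendsto_add fourier_ext_approx trunc_L1_L2 trunc_tendsto)
qed

lemma fourier_ext_cscale: "fourier_ext (cscale c u) = cscale c (fourier_ext u)"
proof (rule LIMSEQ_unique)
  let ?f = "\<lambda>n z. c * trunc n u z"
  show "(\<lambda>n. abs_L2 (fourier_integral (?f n))) \<longlonglongrightarrow> fourier_ext (cscale c u)"
  proof (rule fourier_ext_approx)
    show "L1_L2 (?f n)" for n by (intro L1_L2_cmult trunc_L1_L2)
    have "(\<lambda>n. cscale c (abs_L2 (trunc n u))) \<longlonglongrightarrow> cscale c u"
      by (intro bounded_linear.tendsto[OF bounded_linear_cscale] trunc_tendsto)
    then show "(\<lambda>n. abs_L2 (?f n)) \<longlonglongrightarrow> cscale c u"
      using trunc_L1_L2 by (simp add: L1_L2_def abs_L2_cscale)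
  qed
  have "abs_L2 (fourier_integral (?f n)) = cscale c (abs_L2 (fourier_integral (trunc n u)))" for n
    using trunc_L1_L2[of n u] plancherel(1)[of "trunc n u"]
    by (simp add: L1_L2_def abs_L2_cscale fourier_integral_cmult[abs_def])
  then show "(\<lambda>n. abs_L2 (fourier_integral (?f n))) \<longlonglongrightarrow> cscale c (fourier_ext u)"
    by (simp add: bounded_linear.tendsto[OF bounded_linear_cscale] fourier_ext_approx trunc_L1_L2 trunc_tendsto)
qed

lemma bounded_linear_fourier_ext: "bounded_linear fourier_ext"
  by (rule bounded_linear_intro[of _ 1])
     (simp_all add: fourier_ext_add fourier_ext_cscale scaleR_eq_cscale norm_fourier_ext)

lemma fourier_ext_rep:
  assumes "integrable lborel (rep_L2 u)"
  shows "AE \<zeta> in lborel. rep_L2 (fourier_ext u) \<zeta> = fourier_integral (rep_L2 u) \<zeta>"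
  using fourier_ext_abs[of "rep_L2 u"] rep_abs_L2[OF plancherel(1)[OF square_integrable_rep assms]] assms
  by (simp add: L1_L2_def square_integrable_rep abs_rep_L2)

lemma integrable_rep_abs_L2:
  assumes "L1_L2 f"
  shows "integrable lborel (rep_L2 (abs_L2 f))"
proof -
  have sq: "square_integrable f" and int: "integrable lborel f" using assms by (auto simp: L1_L2_def)
  show ?thesis
    by (rule integrable_cong_AE_imp[OF int])
       (use rep_abs_L2[OF sq] in auto)
qed

text \<open>Evaluates the definite description: a competitor is continuous and agrees with
  \<open>fourier_ext\<close> on the dense set of truncations. Its defining property speaks of the
  representative chosen by \<open>rep_L2\<close>, which is only almost everywhere the truncation;
  integrability is insensitive to that.\<close>

lemma fourier_eq_ext: "fourier = fourier_ext"
  unfolding fourier_def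
proof (rule the_equality)
  show "bounded_linear fourier_ext \<and> (\<forall>u. integrable lborel (rep_L2 u) \<longrightarrow>
      (AE \<zeta> in lborel. rep_L2 (fourier_ext u) \<zeta> = fourier_integral (rep_L2 u) \<zeta>))"
    using bounded_linear_fourier_ext fourier_ext_rep by auto
  fix F
  assume F: "bounded_linear F \<and> (\<forall>u. integrable lborel (rep_L2 u) \<longrightarrow>
      (AE \<zeta> in lborel. rep_L2 (F u) \<zeta> = fourier_integral (rep_L2 u) \<zeta>))"
  show "F = fourier_ext"
  proof
    fix u
    have "F (abs_L2 (trunc n u)) = fourier_ext (abs_L2 (trunc n u))" for n
    proof (rule L2_eqI)
      have int: "integrable lborel (rep_L2 (abs_L2 (trunc n u)))" by (rule integrable_rep_abs_L2[OF trunc_L1_L2])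
      with F have "AE \<zeta> in lborel. rep_L2 (F (abs_L2 (trunc n u))) \<zeta> = fourier_integral (rep_L2 (abs_L2 (trunc n u))) \<zeta>" by blast
      with fourier_ext_rep[OF int]
      show "AE z in lborel. rep_L2 (F (abs_L2 (trunc n u))) z = rep_L2 (fourier_ext (abs_L2 (trunc n u))) z"
        by eventually_elim simp
    qed
    moreover have "(\<lambda>n. F (abs_L2 (trunc n u))) \<longlonglongrightarrow> F u"
      by (rule bounded_linear.tendsto[OF _ trunc_tendsto]) (use F in auto)
    moreover have "(\<lambda>n. fourier_ext (abs_L2 (trunc n u))) \<longlonglongrightarrow> fourier_ext u"
      by (rule bounded_linear.tendsto[OF bounded_linear_fourier_ext trunc_tendsto])
    ultimately show "F u = fourier_ext u" by (simp add: LIMSEQ_unique)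
  qed
qed

lemma bounded_linear_fourier: "bounded_linear fourier"
  by (simp add: fourier_eq_ext bounded_linear_fourier_ext)

lemma norm_fourier: "norm (fourier u) = norm u"
  by (simp add: fourier_eq_ext norm_fourier_ext)

lemma fourier_cscale: "fourier (cscale c u) = cscale c (fourier u)"
  by (simp add: fourier_eq_ext fourier_ext_cscale)

lemmas fourier_add = bounded_linear.axioms(1)[OF bounded_linear_fourier, THEN linear_add]
lemmas fourier_diff = bounded_linear.axioms(1)[OF bounded_linear_fourier, THEN linear_diff]

section \<open>Adjoint and inversion\<close>

lemma fourier_integral_uminus:
  assumes [measurable]: "f \<in> borel_measurable borel"
  shows "fourier_integral (\<lambda>z. f (- z)) \<zeta> = fourier_integral f (- \<zeta>)"
  using integral_uminus_plane[of "\<lambda>x. cis (x \<bullet> \<zeta>) * f x"] unfolding fourier_integral_cis by simp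

lemma reflect_fourier: "reflect (fourier u) = fourier (reflect u)"
  unfolding fourier_eq_ext
proof (rule LIMSEQ_unique)
  show "(\<lambda>n. reflect (abs_L2 (fourier_integral (trunc n u)))) \<longlonglongrightarrow> reflect (fourier_ext u)"
    by (intro reflect_tendsto fourier_ext_approx trunc_L1_L2 trunc_tendsto)
  have L: "L1_L2 (\<lambda>z. trunc n u (- z))" for n
    using trunc_L1_L2[of n u] by (simp add: L1_L2_def square_integrable_uminus integrable_uminus_plane)
  have m: "trunc n u \<in> borel_measurable borel" for n
    using trunc_L1_L2[of n u] by (simp add: L1_L2_def square_integrable_measurable)
  have "reflect (abs_L2 (fourier_integral (trunc n u))) = abs_L2 (fourier_integral (\<lambda>z. trunc n u (- z)))" for n
    using trunc_L1_L2[of n u] plancherel(1)[of "trunc n u"]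
    by (simp add: L1_L2_def reflect_abs fourier_integral_uminus[OF m, abs_def])
  moreover have "(\<lambda>n. abs_L2 (fourier_integral (\<lambda>z. trunc n u (- z)))) \<longlonglongrightarrow> fourier_ext (reflect u)"
  proof (rule fourier_ext_approx[OF L])
    have "(\<lambda>n. reflect (abs_L2 (trunc n u))) \<longlonglongrightarrow> reflect u" by (intro reflect_tendsto trunc_tendsto)
    then show "(\<lambda>n. abs_L2 (\<lambda>z. trunc n u (- z))) \<longlonglongrightarrow> reflect u"
      using trunc_L1_L2 by (simp add: L1_L2_def reflect_abs)
  qed
  ultimately show "(\<lambda>n. reflect (abs_L2 (fourier_integral (trunc n u)))) \<longlonglongrightarrow> fourier_ext (reflect u)"
    by simp
qed

text \<open>The kernel is symmetric in its two variables and conjugation reverses the sign of its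
  phase, which is the origin of \<open>- x\<close>; Fubini's theorem does the rest.\<close>

lemma fourier_integral_adjoint:
  assumes f: "integrable lborel f" and g: "integrable lborel g"
  shows "(LINT \<zeta>|lborel. fourier_integral f \<zeta> * cnj (g \<zeta>)) = (LINT x|lborel. f x * cnj (fourier_integral g (- x)))"
proof -
  have [measurable]: "f \<in> borel_measurable borel" "g \<in> borel_measurable borel"
    using f g borel_measurable_integrable by force+
  have cg: "integrable lborel (\<lambda>x. cnj (g x))" using g by simp
  let ?H = "\<lambda>x \<zeta>. 1 / (2 * of_real pi) * (cis (- (x \<bullet> \<zeta>)) * (f x * cnj (g \<zeta>)))"
  have int: "integrable lborel (\<lambda>p. 1 / (2 * complex_of_real pi) * (f (fst p) * cnj (g (snd p))))"
    by (intro integrable_mult_right integrable_pair_mult(1)[OF f cg])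
  have H: "integrable (lborel \<Otimes>\<^sub>M lborel) (case_prod ?H)"
    unfolding lborel_prod
    by (rule Bochner_Integration.integrable_bound[OF int]) (auto simp: norm_mult norm_divide case_prod_unfold)
  have "(LINT \<zeta>|lborel. fourier_integral f \<zeta> * cnj (g \<zeta>)) = (LINT \<zeta>|lborel. LINT x|lborel. ?H x \<zeta>)"
  proof (intro Bochner_Integration.integral_cong refl)
    fix \<zeta>
    have "fourier_integral f \<zeta> * cnj (g \<zeta>) = (LINT x|lborel. 1 / (2 * of_real pi) * (cis (- (x \<bullet> \<zeta>)) * f x) * cnj (g \<zeta>))"
      unfolding fourier_integral_cis by simp
    also have "\<dots> = (LINT x|lborel. ?H x \<zeta>)" by (simp add: mult.assoc)
    finally show "fourier_integral f \<zeta> * cnj (g \<zeta>) = (LINT x|lborel. ?H x \<zeta>)" .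
  qed
  also have "\<dots> = (LINT x|lborel. LINT \<zeta>|lborel. ?H x \<zeta>)"
    by (rule lborel_pair.Fubini_integral[OF H])
  also have "\<dots> = (LINT x|lborel. f x * cnj (fourier_integral g (- x)))"
  proof (intro Bochner_Integration.integral_cong refl)
    fix x
    have "cnj (fourier_integral g (- x)) = 1 / (2 * of_real pi) * (LINT \<zeta>|lborel. cnj (cis (\<zeta> \<bullet> (- (- x))) * g \<zeta>))"
      unfolding fourier_integral_cis Bochner_Integration.integral_cnj by simp
    also have "(LINT \<zeta>|lborel. cnj (cis (\<zeta> \<bullet> (- (- x))) * g \<zeta>)) = (LINT \<zeta>|lborel. cis (- (x \<bullet> \<zeta>)) * cnj (g \<zeta>))"
      by (intro Bochner_Integration.integral_cong refl) (simp add: cis_cnj inner_commute)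
    finally have "f x * cnj (fourier_integral g (- x))
        = 1 / (2 * of_real pi) * (f x * (LINT \<zeta>|lborel. cis (- (x \<bullet> \<zeta>)) * cnj (g \<zeta>)))" by simp
    also have "\<dots> = (LINT \<zeta>|lborel. 1 / (2 * of_real pi) * (f x * (cis (- (x \<bullet> \<zeta>)) * cnj (g \<zeta>))))"
      by simp
    also have "\<dots> = (LINT \<zeta>|lborel. ?H x \<zeta>)"
      by (intro Bochner_Integration.integral_cong refl) (simp only: mult_ac)
    finally show "(LINT \<zeta>|lborel. ?H x \<zeta>) = f x * cnj (fourier_integral g (- x))" by simp
  qed
  finally show ?thesis .
qed

lemma inner_fourier: "inner (fourier u) v = inner u (reflect (fourier v))"
proof (rule LIMSEQ_unique)
  let ?u = "\<lambda>n. abs_L2 (fourier_integral (trunc n u))" and ?v = "\<lambda>n. abs_L2 (fourier_integral (trunc n v))"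
  show "(\<lambda>n. inner (?u n) (abs_L2 (trunc n v))) \<longlonglongrightarrow> inner (fourier u) v"
    unfolding fourier_eq_ext by (intro tendsto_inner fourier_ext_approx trunc_L1_L2 trunc_tendsto)
  have "(\<lambda>n. inner (abs_L2 (trunc n u)) (reflect (?v n))) \<longlonglongrightarrow> inner u (reflect (fourier v))"
    unfolding fourier_eq_ext by (intro tendsto_inner reflect_tendsto fourier_ext_approx trunc_L1_L2 trunc_tendsto)
  moreover have "inner (?u n) (abs_L2 (trunc n v)) = inner (abs_L2 (trunc n u)) (reflect (?v n))" for n
  proof -
    have s: "square_integrable (trunc n u)" "integrable lborel (trunc n u)"
      "square_integrable (trunc n v)" "integrable lborel (trunc n v)"
      using trunc_L1_L2[of n u] trunc_L1_L2[of n v] by (auto simp: L1_L2_def)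
    show ?thesis using fourier_integral_adjoint[OF s(2) s(4)] s plancherel(1)
      by (simp add: reflect_abs inner_abs_L2 square_integrable_uminus)
  qed
  ultimately show "(\<lambda>n. inner (?u n) (abs_L2 (trunc n v))) \<longlonglongrightarrow> inner u (reflect (fourier v))" by simp
qed

text \<open>The adjoint of the isometry \<open>fourier\<close> is \<open>reflect \<circ> fourier\<close>, which is therefore a left inverse;
  it is also a right inverse because \<open>reflect\<close> commutes with \<open>fourier\<close>.\<close>

lemma reflect_fourier_fourier: "reflect (fourier (fourier v)) = v"
proof -
  \<comment> \<open>Polarization: an additive isometry preserves inner products.\<close>
  have "inner (fourier u) (fourier v) = inner u v" for u
    unfolding dot_norm fourier_add[symmetric] norm_fourier ..
  then have "inner u (reflect (fourier (fourier v)) - v) = 0" for u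
    by (simp add: inner_fourier inner_diff_right)
  from this[of "reflect (fourier (fourier v)) - v"] show ?thesis by simp
qed

definition inv_fourier :: "L2 \<Rightarrow> L2" where "inv_fourier u = reflect (fourier u)"

lemma inv_fourier_fourier: "inv_fourier (fourier u) = u"
  by (simp add: inv_fourier_def reflect_fourier_fourier)

lemma fourier_inv_fourier: "fourier (inv_fourier u) = u"
  by (simp add: inv_fourier_def reflect_fourier[symmetric] reflect_fourier_fourier)

lemma inj_fourier: "fourier u = fourier v \<Longrightarrow> u = v"
  by (metis inv_fourier_fourier)

lemma inv_fourier_abs:
  assumes "square_integrable f" "integrable lborel f"
  shows "square_integrable (\<lambda>z. fourier_integral f (- z))"
    "inv_fourier (abs_L2 f) = abs_L2 (\<lambda>z. fourier_integral f (- z))"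
  using assms fourier_ext_abs[of f] plancherel(1)[OF assms]
  by (simp_all add: inv_fourier_def fourier_eq_ext L1_L2_def reflect_abs square_integrable_uminus)

section \<open>Fourier multipliers and the propagator\<close>

text \<open>Injectivity of \<open>fourier\<close> gives uniqueness in the definite description, so
  any witness evaluates it.\<close>

lemma fourier_multiplier_eqI:
  assumes "AE \<zeta> in lborel. rep_L2 (fourier v) \<zeta> = m \<zeta> * rep_L2 (fourier u) \<zeta>"
  shows "fourier_multiplier m u = v"
  unfolding fourier_multiplier_def
proof (rule the_equality)
  show "AE \<zeta> in lborel. rep_L2 (fourier v) \<zeta> = m \<zeta> * rep_L2 (fourier u) \<zeta>" by (rule assms)
  fix w assume "AE \<zeta> in lborel. rep_L2 (fourier w) \<zeta> = m \<zeta> * rep_L2 (fourier u) \<zeta>"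
  with assms have "AE \<zeta> in lborel. rep_L2 (fourier w) \<zeta> = rep_L2 (fourier v) \<zeta>"
    by eventually_elim simp
  then have "fourier w = fourier v" by (rule L2_eqI)
  then show "w = v" by (rule inj_fourier)
qed

text \<open>The witness comes from surjectivity of \<open>fourier\<close>; square integrability of
  the product is exactly what makes it exist.\<close>

lemma fourier_fourier_multiplier:
  assumes "square_integrable (\<lambda>\<zeta>. m \<zeta> * rep_L2 (fourier u) \<zeta>)"
  shows "fourier (fourier_multiplier m u) = abs_L2 (\<lambda>\<zeta>. m \<zeta> * rep_L2 (fourier u) \<zeta>)"
proof -
  let ?v = "inv_fourier (abs_L2 (\<lambda>\<zeta>. m \<zeta> * rep_L2 (fourier u) \<zeta>))"
  have "fourier_multiplier m u = ?v"
    using rep_abs_L2[OF assms] by (intro fourier_multiplier_eqI) (simp add: fourier_inv_fourier)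
  then show ?thesis by (simp add: fourier_inv_fourier)
qed

definition phase :: "real \<Rightarrow> plane \<Rightarrow> complex" where
  "phase t \<zeta> = cis (- (t * ((fst \<zeta>)\<^sup>2 + \<bar>snd \<zeta>\<bar>)))"

lemma phase_measurable [measurable]: "phase t \<in> borel_measurable borel"
  unfolding phase_def by (intro borel_measurable_continuous_onI continuous_intros)

lemma norm_phase [simp]: "norm (phase t \<zeta>) = 1"
  by (simp add: phase_def)

lemma phase_add: "phase (s + t) \<zeta> = phase s \<zeta> * phase t \<zeta>"
  unfolding phase_def cis_mult by (simp add: distrib_right)

lemma propagator_eq: "propagator t = fourier_multiplier (phase t)"
proof -
  have "(\<lambda>(\<xi>, \<eta>). exp (- \<i> * of_real (t * (\<xi>\<^sup>2 + \<bar>\<eta>\<bar>)))) = phase t"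
    by (rule ext) (simp add: phase_def cis_conv_exp case_prod_unfold)
  then show ?thesis by (simp add: propagator_def)
qed

lemma square_integrable_phase_mult:
  "square_integrable f \<Longrightarrow> square_integrable (\<lambda>\<zeta>. phase t \<zeta> * f \<zeta>)"
proof -
  assume f: "square_integrable f"
  have [measurable]: "f \<in> borel_measurable borel" using f by (rule square_integrable_measurable)
  show "square_integrable (\<lambda>\<zeta>. phase t \<zeta> * f \<zeta>)"
    by (rule square_integrable_bound[OF f]) (auto simp: norm_mult)
qed

lemma rep_fourier_propagator:
  "AE \<zeta> in lborel. rep_L2 (fourier (propagator t u)) \<zeta> = phase t \<zeta> * rep_L2 (fourier u) \<zeta>"
  unfolding propagator_eq
  using rep_abs_L2[OF square_integrable_phase_mult[OF square_integrable_rep]]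
  by (simp add: fourier_fourier_multiplier square_integrable_phase_mult square_integrable_rep)

lemma propagator_eqI:
  "AE \<zeta> in lborel. rep_L2 (fourier v) \<zeta> = phase t \<zeta> * rep_L2 (fourier u) \<zeta> \<Longrightarrow> propagator t u = v"
  unfolding propagator_eq by (rule fourier_multiplier_eqI)

lemma norm_propagator: "norm (propagator t u) = norm u"
proof -
  have "ennreal ((norm (fourier (propagator t u)))\<^sup>2) = ennreal ((norm (fourier u))\<^sup>2)"
    unfolding norm_L2_nn using rep_fourier_propagator[of t u]
    by (intro nn_integral_cong_AE) (auto simp: norm_mult)
  then show ?thesis by (simp add: norm_fourier power2_eq_iff_nonneg)
qed

lemma propagator_add: "propagator t (u + v) = propagator t u + propagator t v"
proof (rule propagator_eqI)
  show "AE \<zeta> in lborel. rep_L2 (fourier (propagator t u + propagator t v)) \<zeta> = phase t \<zeta> * rep_L2 (fourier (u + v)) \<zeta>"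
    using rep_L2_add[of "fourier (propagator t u)" "fourier (propagator t v)"] rep_L2_add[of "fourier u" "fourier v"]
      rep_fourier_propagator[of t u] rep_fourier_propagator[of t v]
    unfolding fourier_add by eventually_elim (simp add: algebra_simps)
qed

lemma propagator_cscale: "propagator t (cscale c u) = cscale c (propagator t u)"
proof (rule propagator_eqI)
  show "AE \<zeta> in lborel. rep_L2 (fourier (cscale c (propagator t u))) \<zeta> = phase t \<zeta> * rep_L2 (fourier (cscale c u)) \<zeta>"
    using rep_L2_cscale[of c "fourier (propagator t u)"] rep_L2_cscale[of c "fourier u"]
      rep_fourier_propagator[of t u]
    unfolding fourier_cscale by eventually_elim (simp add: algebra_simps)
qed

lemma bounded_linear_propagator: "bounded_linear (propagator t)"
  by (rule bounded_linear_intro[of _ 1])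
     (simp_all add: propagator_add propagator_cscale scaleR_eq_cscale norm_propagator)

lemmas propagator_diff = bounded_linear.axioms(1)[OF bounded_linear_propagator, THEN linear_diff]

lemma propagator_propagator: "propagator s (propagator t u) = propagator (s + t) u"
proof (rule propagator_eqI)
  show "AE \<zeta> in lborel. rep_L2 (fourier (propagator (s + t) u)) \<zeta> = phase s \<zeta> * rep_L2 (fourier (propagator t u)) \<zeta>"
    using rep_fourier_propagator[of t u] rep_fourier_propagator[of "s + t" u]
    by eventually_elim (simp add: phase_add mult.assoc)
qed

text \<open>Stated for arbitrary \<open>f\<close> in order to serve twice: for transforms in
  \<open>L2\<close>, and for weighted transforms when continuity in the energy norm is
  proved.\<close>

lemma phase_tendsto_L2:
  assumes f: "square_integrable f" and t: "t \<longlonglongrightarrow> s"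
  shows "(\<lambda>n. abs_L2 (\<lambda>\<zeta>. phase (t n) \<zeta> * f \<zeta>)) \<longlonglongrightarrow> abs_L2 (\<lambda>\<zeta>. phase s \<zeta> * f \<zeta>)"
proof (rule L2_dominated_convergence(2)[OF f])
  have [measurable]: "f \<in> borel_measurable borel" using f by (rule square_integrable_measurable)
  show "(\<lambda>\<zeta>. phase (t n) \<zeta> * f \<zeta>) \<in> borel_measurable borel" for n by measurable
  show "(\<lambda>\<zeta>. phase s \<zeta> * f \<zeta>) \<in> borel_measurable borel" by measurable
  show "AE z in lborel. (\<lambda>n. phase (t n) z * f z) \<longlonglongrightarrow> phase s z * f z"
    unfolding phase_def cis_conv_exp by (intro AE_I2 tendsto_intros t)
qed (simp add: norm_mult)

text \<open>The group is continuous in time only for a fixed argument. Joint convergence follows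
  because changing the argument is harmless uniformly in time: each \<open>propagator t\<close> is
  an isometry.\<close>

lemma propagator_tendsto:
  assumes t: "t \<longlonglongrightarrow> s" and X: "X \<longlonglongrightarrow> u"
  shows "(\<lambda>n. propagator (t n) (X n)) \<longlonglongrightarrow> propagator s u"
proof -
  have f: "fourier (propagator r u) = abs_L2 (\<lambda>\<zeta>. phase r \<zeta> * rep_L2 (fourier u) \<zeta>)" for r
    unfolding propagator_eq by (intro fourier_fourier_multiplier square_integrable_phase_mult square_integrable_rep)
  have "(\<lambda>n. fourier (propagator (t n) u)) \<longlonglongrightarrow> fourier (propagator s u)"
    unfolding f by (rule phase_tendsto_L2[OF square_integrable_rep t])
  then have "(\<lambda>n. norm (fourier (propagator (t n) u) - fourier (propagator s u))) \<longlonglongrightarrow> 0"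
    by (simp add: LIM_zero tendsto_norm_zero)
  then have 1: "(\<lambda>n. propagator (t n) u - propagator s u) \<longlonglongrightarrow> 0"
    by (simp add: fourier_diff[symmetric] norm_fourier tendsto_norm_zero_iff)
  have "(\<lambda>n. norm (X n - u)) \<longlonglongrightarrow> 0" using X by (simp add: LIM_zero tendsto_norm_zero)
  then have "(\<lambda>n. norm (propagator (t n) (X n) - propagator (t n) u)) \<longlonglongrightarrow> 0"
    by (simp add: propagator_diff[symmetric] norm_propagator)
  then have 2: "(\<lambda>n. propagator (t n) (X n) - propagator (t n) u) \<longlonglongrightarrow> 0"
    by (simp add: tendsto_norm_zero_iff)
  from tendsto_add[OF 2 1] show ?thesis by (simp add: LIM_zero_iff)
qed

lemma continuous_on_propagator:
  fixes t :: "real \<Rightarrow> real"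
  assumes t: "continuous_on S t" and u: "continuous_on S u"
  shows "continuous_on S (\<lambda>x. propagator (t x) (u x))"
  unfolding continuous_on_sequentially comp_def
proof (intro allI ballI impI)
  fix x a assume a: "a \<in> S" "(\<forall>n. x n \<in> S) \<and> x \<longlonglongrightarrow> a"
  show "(\<lambda>n. propagator (t (x n)) (u (x n))) \<longlonglongrightarrow> propagator (t a) (u a)"
    using t u a unfolding continuous_on_sequentially comp_def by (intro propagator_tendsto) blast+
qed

section \<open>Balls defined on the Fourier side\<close>

definition weight :: "plane \<Rightarrow> real" where
  "weight \<zeta> = sqrt (1 + (fst \<zeta>)\<^sup>2 + \<bar>snd \<zeta>\<bar>)"

lemma weight_measurable [measurable]: "weight \<in> borel_measurable borel"
  unfolding weight_def by (intro borel_measurable_continuous_onI continuous_intros)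

lemma weight_ge_1: "1 \<le> weight \<zeta>"
  by (simp add: weight_def)

lemma weight_nonneg [simp]: "0 \<le> weight \<zeta>"
  using weight_ge_1[of \<zeta>] by simp

lemma weight_sq: "(weight \<zeta>)\<^sup>2 = 1 + (fst \<zeta>)\<^sup>2 + \<bar>snd \<zeta>\<bar>"
  by (simp add: weight_def)

lemma weight_uminus [simp]: "weight (- \<zeta>) = weight \<zeta>"
  by (simp add: weight_def)

text \<open>After squaring, the cross term of the first frequencies is absorbed by
  \<open>2 * weight \<zeta> * weight \<eta>\<close>, since each first frequency is at most its
  weight; the absolute values of the second frequencies are subadditive already.\<close>

lemma weight_add: "weight (\<zeta> + \<eta>) \<le> weight \<zeta> + weight \<eta>"
proof (rule power2_le_imp_le)
  have "\<bar>fst \<zeta>\<bar> \<le> weight \<zeta>" "\<bar>fst \<eta>\<bar> \<le> weight \<eta>"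
    using real_sqrt_le_mono[of "(fst \<zeta>)\<^sup>2" "1 + (fst \<zeta>)\<^sup>2 + \<bar>snd \<zeta>\<bar>"]
      real_sqrt_le_mono[of "(fst \<eta>)\<^sup>2" "1 + (fst \<eta>)\<^sup>2 + \<bar>snd \<eta>\<bar>"] by (auto simp: weight_def)
  then have "\<bar>fst \<zeta> * fst \<eta>\<bar> \<le> weight \<zeta> * weight \<eta>"
    unfolding abs_mult by (intro mult_mono) auto
  then have "fst \<zeta> * fst \<eta> \<le> weight \<zeta> * weight \<eta>" by linarith
  moreover have "\<bar>snd \<zeta> + snd \<eta>\<bar> \<le> \<bar>snd \<zeta>\<bar> + \<bar>snd \<eta>\<bar>" by (rule abs_triangle_ineq)
  ultimately show "(weight (\<zeta> + \<eta>))\<^sup>2 \<le> (weight \<zeta> + weight \<eta>)\<^sup>2"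
    unfolding weight_sq power2_sum by (simp add: power2_sum)
qed simp

abbreviation W2_nn :: "(plane \<Rightarrow> complex) \<Rightarrow> ennreal" where
  "W2_nn f \<equiv> \<integral>\<^sup>+\<zeta>. ennreal ((weight \<zeta> * norm (f \<zeta>))\<^sup>2) \<partial>lborel"

text \<open>The square of the weight is the symbol of the energy norm, and the weight itself is subadditive;
  this is what makes the space an algebra under convolution.  Radii must be nonnegative to be
  meaningful: \<open>ennreal\<close> sends negative numbers to \<open>0\<close>.\<close>

definition in_ball :: "real \<Rightarrow> (plane \<Rightarrow> complex) \<Rightarrow> bool" where
  "in_ball R f \<longleftrightarrow> f \<in> borel_measurable borel \<and>
     L1_nn f \<le> ennreal R \<and>
     W2_nn f \<le> ennreal (R\<^sup>2)"

definition fourier_ball :: "real \<Rightarrow> L2 \<Rightarrow> bool" where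
  "fourier_ball R u \<longleftrightarrow> in_ball R (rep_L2 (fourier u))"

text \<open>Membership sees only moduli almost everywhere. It therefore survives a change of
  representative and multiplication by the phases of the propagator.\<close>

lemma in_ball_cong_AE:
  assumes "in_ball R f" "g \<in> borel_measurable borel" "AE \<zeta> in lborel. norm (g \<zeta>) = norm (f \<zeta>)"
  shows "in_ball R g"
proof -
  have "L1_nn g = L1_nn f"
    "W2_nn g = W2_nn f"
    by (rule nn_integral_cong_AE, use assms(3) in auto)+
  then show ?thesis using assms(1,2) by (simp add: in_ball_def)
qed

lemma in_ball_mono:
  assumes "in_ball R f" "0 \<le> R" "R \<le> S"
  shows "in_ball S f"
  using assms ennreal_leI[of R S] ennreal_leI[of "R\<^sup>2" "S\<^sup>2"] power_mono[of R S 2]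
  by (auto simp: in_ball_def intro: order_trans)

lemma weighted_square_integrable:
  assumes [measurable]: "f \<in> borel_measurable borel"
    and "W2_nn f \<le> ennreal (R\<^sup>2)"
  shows "square_integrable (\<lambda>\<zeta>. of_real (weight \<zeta>) * f \<zeta>)"
    "0 \<le> R \<Longrightarrow> norm (abs_L2 (\<lambda>\<zeta>. of_real (weight \<zeta>) * f \<zeta>)) \<le> R"
proof -
  have "L2_nn (\<lambda>\<zeta>. of_real (weight \<zeta>) * f \<zeta>) \<le> ennreal (R\<^sup>2)"
    using assms(2) by (simp add: norm_mult)
  then show "square_integrable (\<lambda>\<zeta>. of_real (weight \<zeta>) * f \<zeta>)"
    "0 \<le> R \<Longrightarrow> norm (abs_L2 (\<lambda>\<zeta>. of_real (weight \<zeta>) * f \<zeta>)) \<le> R"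
    by (auto intro!: square_integrableI_nn norm_abs_L2_leI)
qed

lemma weighted_nn:
  assumes "square_integrable (\<lambda>\<zeta>. of_real (weight \<zeta>) * f \<zeta>)"
  shows "W2_nn f
    = ennreal ((norm (abs_L2 (\<lambda>\<zeta>. of_real (weight \<zeta>) * f \<zeta>)))\<^sup>2)"
  using norm_abs_L2_nn[OF assms] by (simp add: norm_mult)

lemma in_ball_L1_L2:
  assumes "in_ball R f"
  shows "L1_L2 f"
proof -
  have [measurable]: "f \<in> borel_measurable borel" using assms by (simp add: in_ball_def)
  have "norm (f \<zeta>) \<le> norm (of_real (weight \<zeta>) * f \<zeta>)" for \<zeta>
    using mult_right_mono[OF weight_ge_1, of "norm (f \<zeta>)"] by (simp add: norm_mult)
  then have "square_integrable f"
    using assms by (intro square_integrable_bound[OF weighted_square_integrable(1)[of f R]]) (auto simp: in_ball_def)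
  moreover have "integrable lborel f"
    using assms by (auto simp: in_ball_def intro!: integrableI_bounded le_less_trans[OF _ ennreal_less_top])
  ultimately show ?thesis by (simp add: L1_L2_def)
qed

lemma in_ball_add:
  assumes f: "in_ball R f" and g: "in_ball S g" and "0 \<le> R" "0 \<le> S"
  shows "in_ball (R + S) (\<lambda>\<zeta>. f \<zeta> + g \<zeta>)"
proof -
  have [measurable]: "f \<in> borel_measurable borel" "g \<in> borel_measurable borel"
    using f g by (auto simp: in_ball_def)
  have "L1_nn (\<lambda>\<zeta>. f \<zeta> + g \<zeta>)
      \<le> (\<integral>\<^sup>+\<zeta>. ennreal (norm (f \<zeta>)) + ennreal (norm (g \<zeta>)) \<partial>lborel)"
    by (intro nn_integral_mono) (auto simp flip: ennreal_plus intro: ennreal_leI norm_triangle_ineq)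
  also have "\<dots> = L1_nn f + L1_nn g"
    by (rule nn_integral_add) auto
  also have "\<dots> \<le> ennreal R + ennreal S" using f g by (intro add_mono) (auto simp: in_ball_def)
  finally have 1: "L1_nn (\<lambda>\<zeta>. f \<zeta> + g \<zeta>) \<le> ennreal (R + S)"
    using assms by simp
  have wf: "square_integrable (\<lambda>\<zeta>. of_real (weight \<zeta>) * f \<zeta>)" "norm (abs_L2 (\<lambda>\<zeta>. of_real (weight \<zeta>) * f \<zeta>)) \<le> R"
    using f assms(3) by (auto simp: in_ball_def intro!: weighted_square_integrable)
  have wg: "square_integrable (\<lambda>\<zeta>. of_real (weight \<zeta>) * g \<zeta>)" "norm (abs_L2 (\<lambda>\<zeta>. of_real (weight \<zeta>) * g \<zeta>)) \<le> S"
    using g assms(4) by (auto simp: in_ball_def intro!: weighted_square_integrable)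
  have sq: "square_integrable (\<lambda>\<zeta>. of_real (weight \<zeta>) * (f \<zeta> + g \<zeta>))"
    using square_integrable_add[OF wf(1) wg(1)] by (simp add: distrib_left)
  have "norm (abs_L2 (\<lambda>\<zeta>. of_real (weight \<zeta>) * (f \<zeta> + g \<zeta>))) \<le> R + S"
    using norm_triangle_ineq[of "abs_L2 (\<lambda>\<zeta>. of_real (weight \<zeta>) * f \<zeta>)" "abs_L2 (\<lambda>\<zeta>. of_real (weight \<zeta>) * g \<zeta>)"] wf wg
    by (simp add: abs_L2_add distrib_left)
  then have "(\<integral>\<^sup>+\<zeta>. ennreal ((weight \<zeta> * norm (f \<zeta> + g \<zeta>))\<^sup>2) \<partial>lborel) \<le> ennreal ((R + S)\<^sup>2)"
    unfolding weighted_nn[OF sq] by (intro ennreal_leI power_mono) auto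
  with 1 show ?thesis by (simp add: in_ball_def)
qed

lemma in_ball_cmult:
  assumes f: "in_ball R f" and "0 \<le> R"
  shows "in_ball (norm c * R) (\<lambda>\<zeta>. c * f \<zeta>)"
proof -
  have [measurable]: "f \<in> borel_measurable borel" using f by (auto simp: in_ball_def)
  have "L1_nn (\<lambda>\<zeta>. c * f \<zeta>) = ennreal (norm c) * L1_nn f"
    by (simp add: norm_mult ennreal_mult nn_integral_cmult)
  also have "\<dots> \<le> ennreal (norm c) * ennreal R" using f by (intro mult_left_mono) (auto simp: in_ball_def)
  finally have 1: "L1_nn (\<lambda>\<zeta>. c * f \<zeta>) \<le> ennreal (norm c * R)"
    using \<open>0 \<le> R\<close> by (simp add: ennreal_mult)
  have "(\<integral>\<^sup>+\<zeta>. ennreal ((weight \<zeta> * norm (c * f \<zeta>))\<^sup>2) \<partial>lborel)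
      = (\<integral>\<^sup>+\<zeta>. ennreal ((norm c)\<^sup>2) * ennreal ((weight \<zeta> * norm (f \<zeta>))\<^sup>2) \<partial>lborel)"
    by (intro nn_integral_cong) (simp add: norm_mult power_mult_distrib ennreal_mult[symmetric] mult_ac)
  also have "\<dots> = ennreal ((norm c)\<^sup>2) * W2_nn f"
    by (rule nn_integral_cmult) simp
  also have "\<dots> \<le> ennreal ((norm c)\<^sup>2) * ennreal (R\<^sup>2)" using f by (intro mult_left_mono) (auto simp: in_ball_def)
  also have "\<dots> = ennreal ((norm c * R)\<^sup>2)" by (simp add: power_mult_distrib ennreal_mult)
  finally show ?thesis using 1 by (simp add: in_ball_def)
qed

section \<open>Stability of the balls under linear operations, limits and integrals\<close>

lemma fourier_ball_mono: "fourier_ball R u \<Longrightarrow> 0 \<le> R \<Longrightarrow> R \<le> S \<Longrightarrow> fourier_ball S u"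
  unfolding fourier_ball_def by (rule in_ball_mono)

lemma fourier_ball_add:
  assumes "fourier_ball R u" "fourier_ball S v" "0 \<le> R" "0 \<le> S"
  shows "fourier_ball (R + S) (u + v)"
  unfolding fourier_ball_def fourier_add
proof (rule in_ball_cong_AE[OF in_ball_add[OF assms(1,2)[unfolded fourier_ball_def] assms(3,4)]])
  show "AE \<zeta> in lborel. norm (rep_L2 (fourier u + fourier v) \<zeta>) = norm (rep_L2 (fourier u) \<zeta> + rep_L2 (fourier v) \<zeta>)"
    using rep_L2_add[of "fourier u" "fourier v"] by eventually_elim simp
qed simp

lemma fourier_ball_cscale:
  assumes "fourier_ball R u" "0 \<le> R"
  shows "fourier_ball (norm c * R) (cscale c u)"
  unfolding fourier_ball_def fourier_cscale
proof (rule in_ball_cong_AE[OF in_ball_cmult[OF assms(1)[unfolded fourier_ball_def] assms(2)]])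
  show "AE \<zeta> in lborel. norm (rep_L2 (cscale c (fourier u)) \<zeta>) = norm (c * rep_L2 (fourier u) \<zeta>)"
    using rep_L2_cscale[of c "fourier u"] by eventually_elim simp
qed simp

lemma fourier_ball_scaleR: "fourier_ball R u \<Longrightarrow> 0 \<le> R \<Longrightarrow> fourier_ball (\<bar>r\<bar> * R) (r *\<^sub>R u)"
  using fourier_ball_cscale[of R u "of_real r"] by (simp add: scaleR_eq_cscale)

lemma fourier_ball_propagator:
  assumes "fourier_ball R u"
  shows "fourier_ball R (propagator t u)"
  unfolding fourier_ball_def
proof (rule in_ball_cong_AE[OF assms[unfolded fourier_ball_def]])
  show "AE \<zeta> in lborel. norm (rep_L2 (fourier (propagator t u)) \<zeta>) = norm (rep_L2 (fourier u) \<zeta>)"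
    using rep_fourier_propagator[of t u] by eventually_elim (simp add: norm_mult)
qed simp

lemma fourier_ball_0: "0 \<le> R \<Longrightarrow> fourier_ball R 0"
proof -
  assume R: "0 \<le> R"
  have "AE z in lborel. rep_L2 (fourier 0) z = 0"
    using rep_L2_zero linear_0[OF bounded_linear.axioms(1)[OF bounded_linear_fourier]] by simp
  moreover have "in_ball R (\<lambda>_. 0)" by (simp add: in_ball_def)
  ultimately show ?thesis unfolding fourier_ball_def
    using in_ball_cong_AE[of R "\<lambda>_. 0" "rep_L2 (fourier 0)"] by auto
qed

text \<open>Fatou's lemma: the balls are closed in the weaker topology of $L^2$, so a contraction argument in
  $L^2$ alone stays inside them.\<close>

lemma fourier_ball_closed:
  assumes X: "\<And>n. fourier_ball R (X n)" and lim: "X \<longlonglongrightarrow> u"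
  shows "fourier_ball R u"
proof -
  have lim': "(\<lambda>n. fourier (X n)) \<longlonglongrightarrow> fourier u"
    by (rule bounded_linear.tendsto[OF bounded_linear_fourier lim])
  \<comment> \<open>The chosen indices need not increase: \<open>fast_conv_AE\<close> asks only for
    the rate.\<close>
  have "\<forall>n. \<exists>m. norm (fourier (X m) - fourier u) \<le> (1/2) ^ n"
  proof
    fix n
    from LIMSEQ_D[OF lim', of "(1/2) ^ n"] show "\<exists>m. norm (fourier (X m) - fourier u) \<le> (1/2) ^ n"
      by (auto intro: less_imp_le)
  qed
  then obtain r where r: "\<And>n. norm (fourier (X (r n)) - fourier u) \<le> (1/2) ^ n" by metis
  let ?f = "\<lambda>n. rep_L2 (fourier (X (r n)))" and ?g = "rep_L2 (fourier u)"
  have ae: "AE z in lborel. (\<lambda>n. ?f n z) \<longlonglongrightarrow> ?g z"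
    by (rule fast_conv_AE[OF r])
  \<comment> \<open>Stated for a general integrand continuous in the value, so that it covers the
    plain and the weighted norm.\<close>
  have fatou: "(\<integral>\<^sup>+z. ennreal (F z (?g z)) \<partial>lborel) \<le> ennreal c"
    if F: "\<And>z. isCont (F z) (?g z)" and [measurable]: "\<And>n. (\<lambda>z. F z (?f n z)) \<in> borel_measurable borel"
      and c: "\<And>n. (\<integral>\<^sup>+z. ennreal (F z (?f n z)) \<partial>lborel) \<le> ennreal c" for F c
  proof -
    have "(\<integral>\<^sup>+z. ennreal (F z (?g z)) \<partial>lborel) = (\<integral>\<^sup>+z. liminf (\<lambda>n. ennreal (F z (?f n z))) \<partial>lborel)"
    proof (rule nn_integral_cong_AE)
      show "AE z in lborel. ennreal (F z (?g z)) = liminf (\<lambda>n. ennreal (F z (?f n z)))"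
        using ae
      proof eventually_elim
        case (elim z)
        have "(\<lambda>n. ennreal (F z (?f n z))) \<longlonglongrightarrow> ennreal (F z (?g z))"
          by (intro tendsto_ennrealI isCont_tendsto_compose[OF F elim])
        then show ?case by (rule lim_imp_Liminf[OF trivial_limit_sequentially, symmetric])
      qed
    qed
    also have "\<dots> \<le> liminf (\<lambda>n. \<integral>\<^sup>+z. ennreal (F z (?f n z)) \<partial>lborel)"
      by (rule nn_integral_liminf) simp
    also have "\<dots> \<le> ennreal c"
      by (rule Liminf_le[OF trivial_limit_sequentially]) (simp add: c)
    finally show ?thesis .
  qed
  show ?thesis
    unfolding fourier_ball_def in_ball_def
  proof (intro conjI)
    have "isCont norm w" for w :: complex by (intro continuous_intros)
    then show "L1_nn ?g \<le> ennreal R"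
      by (rule fatou[of "\<lambda>z. norm"]) (use X in \<open>auto simp: fourier_ball_def in_ball_def\<close>)
    have "isCont (\<lambda>w. (weight z * norm w)\<^sup>2) w" for z and w :: complex by (intro continuous_intros)
    then show "W2_nn ?g \<le> ennreal (R\<^sup>2)"
      by (rule fatou[of "\<lambda>z w. (weight z * norm w)\<^sup>2"]) (use X in \<open>auto simp: fourier_ball_def in_ball_def\<close>)
  qed simp
qed

lemma fourier_ball_sum:
  assumes "finite A" "\<And>a. a \<in> A \<Longrightarrow> fourier_ball (c a) (f a)" "\<And>a. a \<in> A \<Longrightarrow> 0 \<le> c a"
  shows "fourier_ball (sum c A) (sum f A)"
  using assms
proof (induction A rule: finite_induct)
  case empty
  show ?case by (simp add: fourier_ball_0)
next
  case (insert a A)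
  have "fourier_ball (c a + sum c A) (f a + sum f A)"
    using insert by (intro fourier_ball_add sum_nonneg) simp_all
  then show ?case using insert(1,2) by simp
qed

text \<open>A Riemann sum is a combination with nonnegative coefficients of total
  \<open>b - a\<close>, so it lies in the asserted ball, and the integral is an \<open>L2\<close>
  limit of such sums. No integrability in the stronger norms is involved.\<close>

lemma fourier_ball_integral:
  fixes f :: "real \<Rightarrow> L2"
  assumes int: "(f has_integral I) {a..b}" and "a \<le> b" "0 \<le> B" and f: "\<And>x. x \<in> {a..b} \<Longrightarrow> fourier_ball B (f x)"
  shows "fourier_ball ((b - a) * B) I"
proof -
  have "\<exists>J. fourier_ball ((b - a) * B) J \<and> norm (J - I) < 1 / real (Suc n)" for n
  proof -
    have pos: "0 < 1 / real (Suc n)" by simp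
    obtain \<gamma> where \<gamma>: "gauge \<gamma>"
      "\<And>\<D>. \<D> tagged_division_of {a..b} \<and> \<gamma> fine \<D> \<Longrightarrow>
        norm ((\<Sum>(x, k)\<in>\<D>. measure lborel k *\<^sub>R f x) - I) < 1 / real (Suc n)"
      using int[unfolded has_integral_real, THEN spec, THEN mp, OF pos] by (elim exE conjE) blast
    obtain \<D> where D: "\<D> tagged_division_of {a..b}" "\<gamma> fine \<D>"
      using fine_division_exists_real[OF \<gamma>(1)] by blast
    have "fourier_ball (\<Sum>(x, k)\<in>\<D>. measure lborel k * B) (\<Sum>(x, k)\<in>\<D>. measure lborel k *\<^sub>R f x)"
    proof (rule fourier_ball_sum)
      show "finite \<D>" using D(1) by blast
      fix p assume p: "p \<in> \<D>"
      obtain x k where xk: "p = (x, k)" by (cases p)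
      have "x \<in> {a..b}" using tagged_division_ofD(2,3)[OF D(1)] p xk by blast
      from fourier_ball_scaleR[OF f[OF this] \<open>0 \<le> B\<close>, of "measure lborel k"]
      show "fourier_ball (case p of (x, k) \<Rightarrow> measure lborel k * B) (case p of (x, k) \<Rightarrow> measure lborel k *\<^sub>R f x)"
        by (simp add: xk)
      show "0 \<le> (case p of (x, k) \<Rightarrow> measure lborel k * B)" using \<open>0 \<le> B\<close> by (simp add: xk)
    qed
    moreover have "(\<Sum>(x, k)\<in>\<D>. measure lborel k * B) = (b - a) * B"
    proof -
      have "(\<Sum>(x, k)\<in>\<D>. measure lborel k) = measure lborel {a..b}"
        using additive_content_tagged_division[of \<D> a b] D(1) by simp
      then show ?thesis using \<open>a \<le> b\<close> by (simp add: case_prod_unfold sum_distrib_right[symmetric])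
    qed
    ultimately show ?thesis using \<gamma>(2)[OF conjI[OF D]] by (intro exI[of _ "\<Sum>(x, k)\<in>\<D>. measure lborel k *\<^sub>R f x"]) simp
  qed
  then obtain J where J: "\<And>n. fourier_ball ((b - a) * B) (J n)" "\<And>n. norm (J n - I) < 1 / real (Suc n)"
    by metis
  have "(\<lambda>n. J n - I) \<longlonglongrightarrow> 0"
    by (rule Lim_null_comparison[OF always_eventually LIMSEQ_Suc[OF lim_1_over_n]]) (use J(2) in \<open>auto intro: less_imp_le\<close>)
  then have "J \<longlonglongrightarrow> I" by (simp add: LIM_zero_iff)
  with J(1) show ?thesis by (rule fourier_ball_closed)
qed

section \<open>Convolution and the nonlinearity\<close>

lemma nn_integral_reflect_translate:
  assumes [measurable]: "f \<in> borel_measurable borel"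
  shows "(\<integral>\<^sup>+z. f (h - z) \<partial>lborel) = (\<integral>\<^sup>+z. f z \<partial>(lborel :: plane measure))"
proof -
  have "(\<integral>\<^sup>+z. f (h - z) \<partial>lborel) = (\<integral>\<^sup>+z. (\<lambda>y. f (h + y)) (- z) \<partial>lborel)" by simp
  also have "\<dots> = (\<integral>\<^sup>+z. f (h + z) \<partial>lborel)" by (rule nn_integral_uminus) simp
  also have "\<dots> = (\<integral>\<^sup>+z. f z \<partial>lborel)" using nn_integral_translate[of f h] by (simp add: add.commute)
  finally show ?thesis .
qed

lemma nn_integral_Fubini_plane:
  fixes F :: "plane \<Rightarrow> plane \<Rightarrow> ennreal"
  assumes "(\<lambda>p. F (fst p) (snd p)) \<in> borel_measurable borel"
  shows "(\<integral>\<^sup>+y. \<integral>\<^sup>+x. F x y \<partial>lborel \<partial>lborel) = (\<integral>\<^sup>+x. \<integral>\<^sup>+y. F x y \<partial>lborel \<partial>lborel)"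
proof (rule lborel_pair.Fubini')
  show "case_prod F \<in> borel_measurable (lborel \<Otimes>\<^sub>M lborel)"
    using assms by (simp add: lborel_prod case_prod_unfold)
qed

lemma young_L1_L1:
  fixes F G :: "plane \<Rightarrow> ennreal"
  assumes [measurable]: "F \<in> borel_measurable borel" "G \<in> borel_measurable borel"
  shows "(\<integral>\<^sup>+\<zeta>. \<integral>\<^sup>+\<eta>. F \<eta> * G (\<zeta> - \<eta>) \<partial>lborel \<partial>lborel)
    = (\<integral>\<^sup>+\<eta>. F \<eta> \<partial>lborel) * (\<integral>\<^sup>+\<eta>. G \<eta> \<partial>lborel)"
proof -
  have "(\<integral>\<^sup>+\<zeta>. \<integral>\<^sup>+\<eta>. F \<eta> * G (\<zeta> - \<eta>) \<partial>lborel \<partial>lborel) = (\<integral>\<^sup>+\<eta>. \<integral>\<^sup>+\<zeta>. F \<eta> * G (\<zeta> - \<eta>) \<partial>lborel \<partial>lborel)"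
    by (rule nn_integral_Fubini_plane) measurable
  also have "\<dots> = (\<integral>\<^sup>+\<eta>. F \<eta> * (\<integral>\<^sup>+\<zeta>. G \<zeta> \<partial>lborel) \<partial>lborel)"
  proof (rule nn_integral_cong)
    fix \<eta>
    have "(\<integral>\<^sup>+\<zeta>. F \<eta> * G (\<zeta> - \<eta>) \<partial>lborel) = F \<eta> * (\<integral>\<^sup>+\<zeta>. G (\<zeta> - \<eta>) \<partial>lborel)"
      by (rule nn_integral_cmult) simp
    also have "(\<integral>\<^sup>+\<zeta>. G (\<zeta> - \<eta>) \<partial>lborel) = (\<integral>\<^sup>+\<zeta>. G \<zeta> \<partial>lborel)"
      using nn_integral_translate[of G "- \<eta>"] by simp
    finally show "(\<integral>\<^sup>+\<zeta>. F \<eta> * G (\<zeta> - \<eta>) \<partial>lborel) = F \<eta> * (\<integral>\<^sup>+\<zeta>. G \<zeta> \<partial>lborel)" .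
  qed
  also have "\<dots> = (\<integral>\<^sup>+\<eta>. F \<eta> \<partial>lborel) * (\<integral>\<^sup>+\<eta>. G \<eta> \<partial>lborel)"
    by (rule nn_integral_multc) simp
  finally show ?thesis .
qed

text \<open>Cauchy--Schwarz with respect to the measure \<open>density lborel F\<close>.\<close>

lemma young_L1_L2:
  fixes F G :: "plane \<Rightarrow> ennreal"
  assumes [measurable]: "F \<in> borel_measurable borel" "G \<in> borel_measurable borel"
  shows "(\<integral>\<^sup>+\<zeta>. (\<integral>\<^sup>+\<eta>. F \<eta> * G (\<zeta> - \<eta>) \<partial>lborel)\<^sup>2 \<partial>lborel)
    \<le> (\<integral>\<^sup>+\<eta>. F \<eta> \<partial>lborel)\<^sup>2 * (\<integral>\<^sup>+\<eta>. (G \<eta>)\<^sup>2 \<partial>lborel)"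
proof -
  have "(\<integral>\<^sup>+\<zeta>. (\<integral>\<^sup>+\<eta>. F \<eta> * G (\<zeta> - \<eta>) \<partial>lborel)\<^sup>2 \<partial>lborel)
     \<le> (\<integral>\<^sup>+\<zeta>. (\<integral>\<^sup>+\<eta>. F \<eta> \<partial>lborel) * (\<integral>\<^sup>+\<eta>. F \<eta> * (G (\<zeta> - \<eta>))\<^sup>2 \<partial>lborel) \<partial>lborel)"
  proof (rule nn_integral_mono)
    fix \<zeta>
    have "(\<integral>\<^sup>+\<eta>. F \<eta> * G (\<zeta> - \<eta>) \<partial>lborel) = (\<integral>\<^sup>+\<eta>. 1 * G (\<zeta> - \<eta>) \<partial>density lborel F)"
      by (subst nn_integral_density) simp_all
    then have "(\<integral>\<^sup>+\<eta>. F \<eta> * G (\<zeta> - \<eta>) \<partial>lborel)\<^sup>2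
        \<le> (\<integral>\<^sup>+\<eta>. 1\<^sup>2 \<partial>density lborel F) * (\<integral>\<^sup>+\<eta>. (G (\<zeta> - \<eta>))\<^sup>2 \<partial>density lborel F)"
      by (simp only:) (rule Cauchy_Schwarz_nn_integral, simp_all)
    also have "\<dots> = (\<integral>\<^sup>+\<eta>. F \<eta> \<partial>lborel) * (\<integral>\<^sup>+\<eta>. F \<eta> * (G (\<zeta> - \<eta>))\<^sup>2 \<partial>lborel)"
      by (subst (1 2) nn_integral_density) simp_all
    finally show "(\<integral>\<^sup>+\<eta>. F \<eta> * G (\<zeta> - \<eta>) \<partial>lborel)\<^sup>2
      \<le> (\<integral>\<^sup>+\<eta>. F \<eta> \<partial>lborel) * (\<integral>\<^sup>+\<eta>. F \<eta> * (G (\<zeta> - \<eta>))\<^sup>2 \<partial>lborel)" .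
  qed
  also have "\<dots> = (\<integral>\<^sup>+\<eta>. F \<eta> \<partial>lborel) * (\<integral>\<^sup>+\<zeta>. \<integral>\<^sup>+\<eta>. F \<eta> * (G (\<zeta> - \<eta>))\<^sup>2 \<partial>lborel \<partial>lborel)"
    by (rule nn_integral_cmult) simp
  also have "\<dots> = (\<integral>\<^sup>+\<eta>. F \<eta> \<partial>lborel) * ((\<integral>\<^sup>+\<eta>. F \<eta> \<partial>lborel) * (\<integral>\<^sup>+\<eta>. (G \<eta>)\<^sup>2 \<partial>lborel))"
    by (subst young_L1_L1[of F "\<lambda>\<eta>. (G \<eta>)\<^sup>2"]) simp_all
  finally show ?thesis by (simp add: power2_eq_square mult.assoc)
qed

text \<open>Replacing the smaller term by the larger one costs 4 instead of the sharp 2, but works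
  for infinite values too.\<close>

lemma ennreal_power2_sum_le: "(a + b)\<^sup>2 \<le> 4 * a\<^sup>2 + 4 * (b::ennreal)\<^sup>2"
proof -
  have *: "(x + y)\<^sup>2 \<le> 4 * (y::ennreal)\<^sup>2" if "x \<le> y" for x y
  proof -
    have "(x + y)\<^sup>2 \<le> (2 * y)\<^sup>2" using that by (intro power_mono) (auto simp: mult_2)
    then show ?thesis by (simp add: power_mult_distrib)
  qed
  show ?thesis
  proof (cases "a \<le> b")
    case True
    from *[OF this] show ?thesis by (rule order_trans) simp
  next
    case False
    then have "(b + a)\<^sup>2 \<le> 4 * a\<^sup>2" by (intro *) simp
    then show ?thesis by (simp add: add.commute add_increasing2)
  qed
qed

text \<open>The factor makes \<open>conv\<close> correspond exactly to the pointwise product, see \<open>synthesis_convolution\<close>.\<close>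

definition conv :: "(plane \<Rightarrow> complex) \<Rightarrow> (plane \<Rightarrow> complex) \<Rightarrow> plane \<Rightarrow> complex" where
  "conv f g \<zeta> = 1 / (2 * of_real pi) * (LINT \<eta>|lborel. f \<eta> * g (\<zeta> - \<eta>))"

lemma convolution_measurable [measurable]:
  assumes [measurable]: "f \<in> borel_measurable borel" "g \<in> borel_measurable borel"
  shows "conv f g \<in> borel_measurable borel"
  unfolding conv_def[abs_def] by measurable

text \<open>Without integrability the left side is \<open>0\<close>. Hence convolutions can be
  bounded at every point, also where the defining integral fails to converge.\<close>

lemma norm_integral_le_nn: "ennreal (norm (LINT x|M. f x)) \<le> (\<integral>\<^sup>+x. ennreal (norm (f x)) \<partial>M)"
  for f :: "'a \<Rightarrow> complex"
  by (cases "integrable M f") (auto simp: not_integrable_integral_eq intro: integral_norm_bound_ennreal)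

text \<open>The normalizing factor is below 1 and is simply dropped, so the ball estimates carry no
  powers of pi.\<close>

lemma norm_convolution_le:
  "ennreal (norm (conv f g \<zeta>)) \<le> (\<integral>\<^sup>+\<eta>. ennreal (norm (f \<eta>)) * ennreal (norm (g (\<zeta> - \<eta>))) \<partial>lborel)"
proof -
  have "norm (conv f g \<zeta>) = 1 / (2 * pi) * norm (LINT \<eta>|lborel. f \<eta> * g (\<zeta> - \<eta>))"
    by (simp add: conv_def norm_mult norm_divide)
  also have "\<dots> \<le> 1 * norm (LINT \<eta>|lborel. f \<eta> * g (\<zeta> - \<eta>))"
    using pi_gt3 by (intro mult_right_mono) auto
  finally have "ennreal (norm (conv f g \<zeta>)) \<le> ennreal (norm (LINT \<eta>|lborel. f \<eta> * g (\<zeta> - \<eta>)))"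
    by (simp add: ennreal_leI)
  also have "\<dots> \<le> L1_nn (\<lambda>\<eta>. f \<eta> * g (\<zeta> - \<eta>))" by (rule norm_integral_le_nn)
  also have "\<dots> = (\<integral>\<^sup>+\<eta>. ennreal (norm (f \<eta>)) * ennreal (norm (g (\<zeta> - \<eta>))) \<partial>lborel)"
    by (simp add: norm_mult ennreal_mult)
  finally show ?thesis .
qed

text \<open>The unweighted norm is Young's inequality in L1. In the weighted one, subadditivity
  moves the weight to one factor: \<open>A\<close> carries it on \<open>f\<close>, \<open>B\<close>
  on \<open>g\<close>, and the other factor is estimated in L1.\<close>

lemma in_ball_convolution:
  assumes f: "in_ball R f" and g: "in_ball S g" and R: "0 \<le> R" and S: "0 \<le> S"
  shows "in_ball (3 * R * S) (conv f g)"
proof -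
  have [measurable]: "f \<in> borel_measurable borel" "g \<in> borel_measurable borel"
    using f g by (auto simp: in_ball_def)
  define F where "F \<eta> = ennreal (norm (f \<eta>))" for \<eta>
  define G where "G \<eta> = ennreal (norm (g \<eta>))" for \<eta>
  define F' where "F' \<eta> = ennreal (weight \<eta> * norm (f \<eta>))" for \<eta>
  define G' where "G' \<eta> = ennreal (weight \<eta> * norm (g \<eta>))" for \<eta>
  have [measurable]: "F \<in> borel_measurable borel" "G \<in> borel_measurable borel"
     "F' \<in> borel_measurable borel" "G' \<in> borel_measurable borel"
    unfolding F_def G_def F'_def G'_def by measurable
  have bF: "(\<integral>\<^sup>+\<eta>. F \<eta> \<partial>lborel) \<le> ennreal R" "(\<integral>\<^sup>+\<eta>. (F' \<eta>)\<^sup>2 \<partial>lborel) \<le> ennreal (R\<^sup>2)"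
    using f by (simp_all add: in_ball_def F_def F'_def ennreal_power)
  have bG: "(\<integral>\<^sup>+\<eta>. G \<eta> \<partial>lborel) \<le> ennreal S" "(\<integral>\<^sup>+\<eta>. (G' \<eta>)\<^sup>2 \<partial>lborel) \<le> ennreal (S\<^sup>2)"
    using g by (simp_all add: in_ball_def G_def G'_def ennreal_power)
  have "L1_nn (conv f g) \<le> (\<integral>\<^sup>+\<zeta>. \<integral>\<^sup>+\<eta>. F \<eta> * G (\<zeta> - \<eta>) \<partial>lborel \<partial>lborel)"
    unfolding F_def G_def by (intro nn_integral_mono norm_convolution_le)
  also have "\<dots> = (\<integral>\<^sup>+\<eta>. F \<eta> \<partial>lborel) * (\<integral>\<^sup>+\<eta>. G \<eta> \<partial>lborel)" by (rule young_L1_L1) simp_all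
  also have "\<dots> \<le> ennreal R * ennreal S" using bF bG by (intro mult_mono) auto
  also have "\<dots> \<le> ennreal (3 * R * S)" using R S by (simp add: ennreal_mult[symmetric] ennreal_leI)
  finally have 1: "L1_nn (conv f g) \<le> ennreal (3 * R * S)" .
  define A where "A \<zeta> = (\<integral>\<^sup>+\<eta>. G \<eta> * F' (\<zeta> - \<eta>) \<partial>lborel)" for \<zeta>
  define B where "B \<zeta> = (\<integral>\<^sup>+\<eta>. F \<eta> * G' (\<zeta> - \<eta>) \<partial>lborel)" for \<zeta>
  have [measurable]: "A \<in> borel_measurable borel" "B \<in> borel_measurable borel"
    unfolding A_def B_def by measurable
  have pointwise: "ennreal (weight \<zeta> * norm (conv f g \<zeta>)) \<le> A \<zeta> + B \<zeta>" for \<zeta>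
  proof -
    have "ennreal (weight \<zeta> * norm (conv f g \<zeta>)) \<le> ennreal (weight \<zeta>) * (\<integral>\<^sup>+\<eta>. F \<eta> * G (\<zeta> - \<eta>) \<partial>lborel)"
      using norm_convolution_le[of f g \<zeta>] by (simp add: ennreal_mult F_def G_def mult_left_mono)
    also have "\<dots> = (\<integral>\<^sup>+\<eta>. ennreal (weight \<zeta>) * (F \<eta> * G (\<zeta> - \<eta>)) \<partial>lborel)"
      by (rule nn_integral_cmult[symmetric]) simp
    also have "\<dots> \<le> (\<integral>\<^sup>+\<eta>. F' \<eta> * G (\<zeta> - \<eta>) + F \<eta> * G' (\<zeta> - \<eta>) \<partial>lborel)"
    proof (rule nn_integral_mono)
      fix \<eta>
      have "weight \<zeta> \<le> weight \<eta> + weight (\<zeta> - \<eta>)" using weight_add[of \<eta> "\<zeta> - \<eta>"] by simp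
      then have "weight \<zeta> * (norm (f \<eta>) * norm (g (\<zeta> - \<eta>))) \<le> (weight \<eta> + weight (\<zeta> - \<eta>)) * (norm (f \<eta>) * norm (g (\<zeta> - \<eta>)))"
        by (rule mult_right_mono) simp
      also have "\<dots> = (weight \<eta> * norm (f \<eta>)) * norm (g (\<zeta> - \<eta>)) + norm (f \<eta>) * (weight (\<zeta> - \<eta>) * norm (g (\<zeta> - \<eta>)))"
        by (simp add: algebra_simps)
      finally have "ennreal (weight \<zeta> * (norm (f \<eta>) * norm (g (\<zeta> - \<eta>))))
         \<le> ennreal ((weight \<eta> * norm (f \<eta>)) * norm (g (\<zeta> - \<eta>)) + norm (f \<eta>) * (weight (\<zeta> - \<eta>) * norm (g (\<zeta> - \<eta>))))"
        by (rule ennreal_leI)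
      then show "ennreal (weight \<zeta>) * (F \<eta> * G (\<zeta> - \<eta>)) \<le> F' \<eta> * G (\<zeta> - \<eta>) + F \<eta> * G' (\<zeta> - \<eta>)"
        unfolding F_def G_def F'_def G'_def by (simp add: ennreal_mult[symmetric] ennreal_plus[symmetric] del: ennreal_plus)
    qed
    also have "\<dots> = (\<integral>\<^sup>+\<eta>. F' \<eta> * G (\<zeta> - \<eta>) \<partial>lborel) + (\<integral>\<^sup>+\<eta>. F \<eta> * G' (\<zeta> - \<eta>) \<partial>lborel)"
      by (rule nn_integral_add) simp_all
    \<comment> \<open>Reflection puts the unweighted factor first, where \<open>young_L1_L2\<close>
      takes its L1 norm.\<close>
    also have "(\<integral>\<^sup>+\<eta>. F' \<eta> * G (\<zeta> - \<eta>) \<partial>lborel) = (\<integral>\<^sup>+\<eta>. G \<eta> * F' (\<zeta> - \<eta>) \<partial>lborel)"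
      using nn_integral_reflect_translate[of "\<lambda>\<eta>. G \<eta> * F' (\<zeta> - \<eta>)" \<zeta>] by (simp add: mult.commute)
    finally show ?thesis by (simp add: A_def B_def)
  qed
  have "(\<integral>\<^sup>+\<zeta>. ennreal ((weight \<zeta> * norm (conv f g \<zeta>))\<^sup>2) \<partial>lborel) \<le> (\<integral>\<^sup>+\<zeta>. 4 * (A \<zeta>)\<^sup>2 + 4 * (B \<zeta>)\<^sup>2 \<partial>lborel)"
  proof (rule nn_integral_mono)
    fix \<zeta>
    have "ennreal ((weight \<zeta> * norm (conv f g \<zeta>))\<^sup>2) = (ennreal (weight \<zeta> * norm (conv f g \<zeta>)))\<^sup>2"
      by (simp add: ennreal_power)
    also have "\<dots> \<le> (A \<zeta> + B \<zeta>)\<^sup>2" by (rule power_mono[OF pointwise]) simp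
    finally show "ennreal ((weight \<zeta> * norm (conv f g \<zeta>))\<^sup>2) \<le> 4 * (A \<zeta>)\<^sup>2 + 4 * (B \<zeta>)\<^sup>2"
      using ennreal_power2_sum_le order_trans by blast
  qed
  also have "\<dots> = 4 * (\<integral>\<^sup>+\<zeta>. (A \<zeta>)\<^sup>2 \<partial>lborel) + 4 * (\<integral>\<^sup>+\<zeta>. (B \<zeta>)\<^sup>2 \<partial>lborel)"
    by (simp add: nn_integral_add nn_integral_cmult)
  also have "\<dots> \<le> 4 * ((ennreal S)\<^sup>2 * ennreal (R\<^sup>2)) + 4 * ((ennreal R)\<^sup>2 * ennreal (S\<^sup>2))"
  proof (intro add_mono mult_left_mono)
    have "(\<integral>\<^sup>+\<zeta>. (A \<zeta>)\<^sup>2 \<partial>lborel) \<le> (\<integral>\<^sup>+\<eta>. G \<eta> \<partial>lborel)\<^sup>2 * (\<integral>\<^sup>+\<eta>. (F' \<eta>)\<^sup>2 \<partial>lborel)"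
      unfolding A_def by (rule young_L1_L2) simp_all
    also have "\<dots> \<le> (ennreal S)\<^sup>2 * ennreal (R\<^sup>2)"
      using bF bG by (intro mult_mono power_mono) auto
    finally show "(\<integral>\<^sup>+\<zeta>. (A \<zeta>)\<^sup>2 \<partial>lborel) \<le> (ennreal S)\<^sup>2 * ennreal (R\<^sup>2)" .
    have "(\<integral>\<^sup>+\<zeta>. (B \<zeta>)\<^sup>2 \<partial>lborel) \<le> (\<integral>\<^sup>+\<eta>. F \<eta> \<partial>lborel)\<^sup>2 * (\<integral>\<^sup>+\<eta>. (G' \<eta>)\<^sup>2 \<partial>lborel)"
      unfolding B_def by (rule young_L1_L2) simp_all
    also have "\<dots> \<le> (ennreal R)\<^sup>2 * ennreal (S\<^sup>2)"
      using bF bG by (intro mult_mono power_mono) auto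
    finally show "(\<integral>\<^sup>+\<zeta>. (B \<zeta>)\<^sup>2 \<partial>lborel) \<le> (ennreal R)\<^sup>2 * ennreal (S\<^sup>2)" .
  qed simp_all
  also have "\<dots> = ennreal (8 * (R\<^sup>2 * S\<^sup>2))"
  proof -
    have "4 * ((ennreal S)\<^sup>2 * ennreal (R\<^sup>2)) + 4 * ((ennreal R)\<^sup>2 * ennreal (S\<^sup>2))
        = ennreal 4 * ennreal (S\<^sup>2 * R\<^sup>2) + ennreal 4 * ennreal (R\<^sup>2 * S\<^sup>2)"
      using R S by (simp add: ennreal_power ennreal_mult)
    also have "\<dots> = ennreal (4 * (S\<^sup>2 * R\<^sup>2) + 4 * (R\<^sup>2 * S\<^sup>2))"
      by (subst (1 2) ennreal_mult[symmetric]) (simp_all flip: ennreal_plus)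
    finally show ?thesis by (simp add: mult.commute)
  qed
  \<comment> \<open>The constant 3 arises here: 8 is at most 3^2.\<close>
  also have "\<dots> \<le> ennreal ((3 * R * S)\<^sup>2)"
    by (intro ennreal_leI) (simp add: power_mult_distrib)
  finally show ?thesis using 1 by (simp add: in_ball_def)
qed

text \<open>The inverse Fourier integral. It is kept as a function, not as a class in
  \<open>L2\<close>, so that products can be computed at every point.\<close>

definition synthesis :: "(plane \<Rightarrow> complex) \<Rightarrow> plane \<Rightarrow> complex" where
  "synthesis f z = fourier_integral f (- z)"

lemma synthesis_cis: "synthesis f z = 1 / (2 * of_real pi) * (LINT x|lborel. cis (x \<bullet> z) * f x)"
  by (simp add: synthesis_def fourier_integral_cis)

lemma synthesis_measurable [measurable]:
  assumes [measurable]: "f \<in> borel_measurable borel"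
  shows "synthesis f \<in> borel_measurable borel"
  unfolding synthesis_def[abs_def] by measurable

text \<open>Fubini's theorem, then the shift of the frequency by \<open>\<eta>\<close>, which splits
  the exponential into a product. Young's inequality provides the absolute convergence.\<close>

lemma synthesis_convolution:
  assumes f: "integrable lborel f" and g: "integrable lborel g"
  shows "synthesis (conv f g) z = synthesis f z * synthesis g z"
proof -
  have [measurable]: "f \<in> borel_measurable borel" "g \<in> borel_measurable borel"
    using f g borel_measurable_integrable by force+
  let ?H = "\<lambda>\<eta> \<zeta>. cis (\<zeta> \<bullet> z) * (f \<eta> * g (\<zeta> - \<eta>))"
  have H: "integrable (lborel \<Otimes>\<^sub>M lborel) (case_prod ?H)"
    unfolding lborel_prod
  proof (rule integrable_lborel_pairI)
    show "case_prod ?H \<in> borel_measurable borel" unfolding case_prod_unfold by measurable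
    have "(\<integral>\<^sup>+\<eta>. \<integral>\<^sup>+\<zeta>. ennreal (norm (f \<eta>)) * ennreal (norm (g (\<zeta> - \<eta>))) \<partial>lborel \<partial>lborel)
        = (\<integral>\<^sup>+\<zeta>. \<integral>\<^sup>+\<eta>. ennreal (norm (f \<eta>)) * ennreal (norm (g (\<zeta> - \<eta>))) \<partial>lborel \<partial>lborel)"
      by (rule nn_integral_Fubini_plane[symmetric]) measurable
    also have "\<dots> = (L1_nn f) * L1_nn g"
      by (rule young_L1_L1) simp_all
    also have "\<dots> < \<infinity>" using f g by (simp add: integrable_iff_bounded ennreal_mult_less_top)
    finally show "(\<integral>\<^sup>+\<eta>. L1_nn (\<lambda>\<zeta>. case_prod ?H (\<eta>, \<zeta>)) \<partial>lborel) < \<infinity>"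
      by (simp add: norm_mult ennreal_mult)
  qed
  define c where "c = 1 / (2 * complex_of_real pi)"
  have "synthesis (conv f g) z = c * (LINT \<zeta>|lborel. c * (LINT \<eta>|lborel. ?H \<eta> \<zeta>))"
    unfolding synthesis_cis conv_def c_def[symmetric]
  proof (rule arg_cong2[where f = "(*)", OF refl], rule Bochner_Integration.integral_cong[OF refl])
    fix \<zeta>
    have "cis (\<zeta> \<bullet> z) * (c * (LINT \<eta>|lborel. f \<eta> * g (\<zeta> - \<eta>))) = c * (cis (\<zeta> \<bullet> z) * (LINT \<eta>|lborel. f \<eta> * g (\<zeta> - \<eta>)))"
      by (simp only: mult_ac)
    also have "cis (\<zeta> \<bullet> z) * (LINT \<eta>|lborel. f \<eta> * g (\<zeta> - \<eta>)) = (LINT \<eta>|lborel. ?H \<eta> \<zeta>)"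
      by (rule integral_mult_right_zero[symmetric])
    finally show "cis (\<zeta> \<bullet> z) * (c * (LINT \<eta>|lborel. f \<eta> * g (\<zeta> - \<eta>))) = c * (LINT \<eta>|lborel. ?H \<eta> \<zeta>)" .
  qed
  also have "\<dots> = c * (c * (LINT \<zeta>|lborel. LINT \<eta>|lborel. ?H \<eta> \<zeta>))"
    by (simp only: integral_mult_right_zero)
  also have "(LINT \<zeta>|lborel. LINT \<eta>|lborel. ?H \<eta> \<zeta>) = (LINT \<eta>|lborel. LINT \<zeta>|lborel. ?H \<eta> \<zeta>)"
    by (rule lborel_pair.Fubini_integral[OF H])
  also have "\<dots> = (LINT \<eta>|lborel. (cis (\<eta> \<bullet> z) * f \<eta>) * (LINT \<theta>|lborel. cis (\<theta> \<bullet> z) * g \<theta>))"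
  proof (rule Bochner_Integration.integral_cong[OF refl])
    fix \<eta>
    have "(LINT \<zeta>|lborel. ?H \<eta> \<zeta>) = (LINT \<zeta>|lborel. ?H \<eta> (\<eta> + 1 *\<^sub>R \<zeta>))"
      by (subst integral_plane_affine) auto
    also have "\<dots> = (LINT \<zeta>|lborel. (cis (\<eta> \<bullet> z) * f \<eta>) * (cis (\<zeta> \<bullet> z) * g \<zeta>))"
      by (intro Bochner_Integration.integral_cong refl) (simp add: inner_add_left cis_mult[symmetric])
    finally show "(LINT \<zeta>|lborel. ?H \<eta> \<zeta>) = (cis (\<eta> \<bullet> z) * f \<eta>) * (LINT \<theta>|lborel. cis (\<theta> \<bullet> z) * g \<theta>)"
      by (simp only: integral_mult_right_zero)
  qed
  also have "\<dots> = (LINT \<eta>|lborel. cis (\<eta> \<bullet> z) * f \<eta>) * (LINT \<theta>|lborel. cis (\<theta> \<bullet> z) * g \<theta>)"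
    by (rule integral_mult_left_zero)
  finally show ?thesis unfolding synthesis_cis c_def by (simp only: mult_ac)
qed

lemma synthesis_cnj:
  assumes [measurable]: "f \<in> borel_measurable borel"
  shows "synthesis (\<lambda>\<zeta>. cnj (f (- \<zeta>))) z = cnj (synthesis f z)"
proof -
  have "(LINT x|lborel. cis (x \<bullet> z) * cnj (f (- x))) = (LINT x|lborel. (\<lambda>x. cnj (cis (x \<bullet> z) * f x)) (- x))"
    by (intro Bochner_Integration.integral_cong refl) (simp add: cis_cnj)
  also have "\<dots> = (LINT x|lborel. cnj (cis (x \<bullet> z) * f x))"
    by (rule integral_uminus_plane) simp
  also have "\<dots> = cnj (LINT x|lborel. cis (x \<bullet> z) * f x)" by (rule Bochner_Integration.integral_cnj)
  finally show ?thesis unfolding synthesis_cis by simp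
qed

lemma in_ball_cnj:
  assumes "in_ball R f"
  shows "in_ball R (\<lambda>\<zeta>. cnj (f (- \<zeta>)))"
proof -
  have [measurable]: "f \<in> borel_measurable borel" using assms by (simp add: in_ball_def)
  show ?thesis using assms nn_integral_uminus[of "\<lambda>\<zeta>. ennreal (norm (f \<zeta>))"]
      nn_integral_uminus[of "\<lambda>\<zeta>. ennreal ((weight \<zeta> * norm (f \<zeta>))\<^sup>2)"]
    by (simp add: in_ball_def)
qed

text \<open>Because the exponent \<open>2 * k\<close> is even, the nonlinearity is a polynomial in u
  and its conjugate, hence an iterated convolution of \<open>f\<close> and its reflected conjugate.
  The factor |u|^2 has radius 3 R^2, and convolving with it costs another 3, so each step multiplies
  the radius by 9 R^2.\<close>

lemma synthesis_power:
  assumes f: "in_ball R f" and R: "0 \<le> R"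
  shows "\<exists>g. in_ball ((9 * R\<^sup>2) ^ k * R) g \<and> (\<forall>z. synthesis g z = of_real (norm (synthesis f z) ^ (2 * k)) * synthesis f z)"
proof (induction k)
  case 0
  then show ?case using f by auto
next
  case (Suc k)
  then obtain g where g: "in_ball ((9 * R\<^sup>2) ^ k * R) g"
    "\<And>z. synthesis g z = of_real (norm (synthesis f z) ^ (2 * k)) * synthesis f z" by auto
  let ?fc = "\<lambda>\<zeta>. cnj (f (- \<zeta>))"
  have fc: "in_ball R ?fc" by (rule in_ball_cnj[OF f])
  have ff: "in_ball (3 * R * R) (conv f ?fc)" by (rule in_ball_convolution[OF f fc R R])
  have 1: "in_ball (3 * (3 * R * R) * ((9 * R\<^sup>2) ^ k * R)) (conv (conv f ?fc) g)"
    using R by (intro in_ball_convolution[OF ff g(1)]) auto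
  have int: "integrable lborel f" "integrable lborel ?fc" "integrable lborel (conv f ?fc)" "integrable lborel g"
    using in_ball_L1_L2[OF f] in_ball_L1_L2[OF fc] in_ball_L1_L2[OF ff] in_ball_L1_L2[OF g(1)] by (auto simp: L1_L2_def)
  have [measurable]: "f \<in> borel_measurable borel" using f by (simp add: in_ball_def)
  have 2: "synthesis (conv (conv f ?fc) g) z = of_real (norm (synthesis f z) ^ (2 * Suc k)) * synthesis f z" for z
    unfolding synthesis_convolution[OF int(3,4)] synthesis_convolution[OF int(1,2)] g(2)
    by (simp add: synthesis_cnj complex_norm_square[symmetric] power2_eq_square)
  have 3: "3 * (3 * R * R) * ((9 * R\<^sup>2) ^ k * R) = (9 * R\<^sup>2) ^ Suc k * R"
    by (simp add: power2_eq_square)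
  show ?case
  proof (intro exI conjI allI)
    show "in_ball ((9 * R\<^sup>2) ^ Suc k * R) (conv (conv f ?fc) g)" using 1 unfolding 3 .
  qed (rule 2)
qed

text \<open>Fourier inversion, available because transforms in a ball are integrable as well as
  square integrable. The sup bound and the product formula both enter through this
  representative.\<close>

lemma rep_eq_synthesis:
  assumes "fourier_ball R u"
  shows "AE z in lborel. rep_L2 u z = synthesis (rep_L2 (fourier u)) z"
proof -
  have L: "square_integrable (rep_L2 (fourier u))" "integrable lborel (rep_L2 (fourier u))"
    using in_ball_L1_L2[OF assms[unfolded fourier_ball_def]] by (auto simp: L1_L2_def)
  have "u = abs_L2 (synthesis (rep_L2 (fourier u)))"
    using inv_fourier_abs(2)[OF L] by (simp add: abs_rep_L2 inv_fourier_fourier synthesis_def[abs_def])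
  then show ?thesis
    using rep_abs_L2[OF inv_fourier_abs(1)[OF L]] by (simp add: synthesis_def[abs_def])
qed

lemma norm_synthesis_le:
  assumes f: "in_ball R f" and R: "0 \<le> R"
  shows "norm (synthesis f z) \<le> R"
proof -
  have int: "integrable lborel f" using in_ball_L1_L2[OF f] by (simp add: L1_L2_def)
  have "ennreal (LINT x|lborel. norm (f x)) \<le> ennreal R"
    using f int by (simp add: in_ball_def nn_integral_eq_integral)
  then have "(LINT x|lborel. norm (f x)) \<le> R" using R by simp
  moreover have "0 \<le> (LINT x|lborel. norm (f x))" by simp
  ultimately have "1 / (2 * pi) * (LINT x|lborel. norm (f x)) \<le> 1 * R"
    using pi_gt3 by (intro mult_mono) auto
  then show ?thesis using norm_fourier_integral_le[OF int, of "- z"] by (simp add: synthesis_def)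
qed

lemma fourier_ball_bounded:
  assumes "fourier_ball R u" "0 \<le> R"
  shows "AE z in lborel. norm (rep_L2 u z) \<le> R"
  using rep_eq_synthesis[OF assms(1)] norm_synthesis_le[OF assms(1)[unfolded fourier_ball_def] assms(2)]
  by (auto elim: eventually_mono)

section \<open>The nonlinearity on balls and its Lipschitz bound\<close>

lemma square_integrable_nonlinearity:
  assumes M: "AE z in lborel. norm (rep_L2 u z) \<le> M" "0 \<le> M"
  shows "square_integrable (\<lambda>z. of_real (norm (rep_L2 u z) ^ (2 * k)) * rep_L2 u z)"
proof -
  have "AE z in lborel. norm (of_real (norm (rep_L2 u z) ^ (2 * k)) * rep_L2 u z) \<le> M ^ (2 * k) * norm (rep_L2 u z)"
    using M(1) by eventually_elim (auto simp: norm_mult norm_power intro!: mult_right_mono power_mono)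
  then show ?thesis
    using norm_abs_L2_mono[OF square_integrable_rep[of u], of "\<lambda>z. of_real (norm (rep_L2 u z) ^ (2 * k)) * rep_L2 u z" "M ^ (2 * k)"] M(2)
    by simp
qed

text \<open>The function \<open>g\<close> of \<open>synthesis_power\<close> has the nonlinearity as
  its inverse transform, so by inversion it is the transform of the nonlinearity almost
  everywhere.\<close>

lemma fourier_ball_nonlinearity:
  assumes u: "fourier_ball R u" and R: "0 \<le> R"
  shows "fourier_ball ((9 * R\<^sup>2) ^ k * R) (power_nonlinearity (2 * k + 1) u)"
proof -
  let ?N = "\<lambda>z. of_real (norm (rep_L2 u z) ^ (2 * k)) * rep_L2 u z"
  obtain g where g: "in_ball ((9 * R\<^sup>2) ^ k * R) g"
    "\<And>z. synthesis g z = of_real (norm (synthesis (rep_L2 (fourier u)) z) ^ (2 * k)) * synthesis (rep_L2 (fourier u)) z"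
    using synthesis_power[OF u[unfolded fourier_ball_def] R, of k] by auto
  have L: "square_integrable g" "integrable lborel g" using in_ball_L1_L2[OF g(1)] by (auto simp: L1_L2_def)
  have sq: "square_integrable ?N" by (rule square_integrable_nonlinearity[OF fourier_ball_bounded[OF u R] R])
  have "AE z in lborel. ?N z = synthesis g z"
    using rep_eq_synthesis[OF u] by eventually_elim (simp add: g(2))
  then have "power_nonlinearity (2 * k + 1) u = inv_fourier (abs_L2 g)"
    using inv_fourier_abs[OF L] abs_L2_eq_iff[OF sq, of "synthesis g"]
    by (simp add: power_nonlinearity_def synthesis_def[abs_def])
  then have "AE \<zeta> in lborel. rep_L2 (fourier (power_nonlinearity (2 * k + 1) u)) \<zeta> = g \<zeta>"
    using rep_abs_L2[OF L(1)] by (simp add: fourier_inv_fourier)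
  then have "AE \<zeta> in lborel. norm (rep_L2 (fourier (power_nonlinearity (2 * k + 1) u)) \<zeta>) = norm (g \<zeta>)"
    by eventually_elim simp
  from in_ball_cong_AE[OF g(1) _ this] show ?thesis by (simp add: fourier_ball_def)
qed

text \<open>Induction splits off one factor |a|^2. Exchanging it for |b|^2 costs at most 2 M |a -
  b|, which raises the constant by 2 in each step; the result \<open>2 * k + 1\<close> is the
  derivative constant of the power.\<close>

lemma power_nonlinearity_pointwise:
  fixes a b :: complex
  assumes "norm a \<le> M" "norm b \<le> M"
  shows "norm (of_real (norm a ^ (2 * k)) * a - of_real (norm b ^ (2 * k)) * b) \<le> real (2 * k + 1) * M ^ (2 * k) * norm (a - b)"
proof (induction k)
  case 0
  then show ?case by simp
next
  case (Suc k)
  have M: "0 \<le> M" using assms(1) norm_ge_zero order_trans by blast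
  let ?x = "of_real (norm a ^ (2 * k)) * a" and ?y = "of_real (norm b ^ (2 * k)) * b"
  have "of_real (norm a ^ (2 * Suc k)) * a - of_real (norm b ^ (2 * Suc k)) * b
      = of_real ((norm a)\<^sup>2) * (?x - ?y) + of_real ((norm a)\<^sup>2 - (norm b)\<^sup>2) * ?y"
    by (simp add: algebra_simps power2_eq_square)
  then have "norm (of_real (norm a ^ (2 * Suc k)) * a - of_real (norm b ^ (2 * Suc k)) * b)
      \<le> (norm a)\<^sup>2 * norm (?x - ?y) + \<bar>(norm a)\<^sup>2 - (norm b)\<^sup>2\<bar> * norm ?y"
    using norm_triangle_ineq[of "of_real ((norm a)\<^sup>2) * (?x - ?y)" "of_real ((norm a)\<^sup>2 - (norm b)\<^sup>2) * ?y"]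
    by (simp add: norm_mult norm_power del: of_real_power of_real_diff)
  also have "\<dots> \<le> M\<^sup>2 * (real (2 * k + 1) * M ^ (2 * k) * norm (a - b)) + (2 * M * norm (a - b)) * (M ^ (2 * k) * M)"
  proof (intro add_mono mult_mono)
    show "(norm a)\<^sup>2 \<le> M\<^sup>2" using assms by (intro power_mono) auto
    show "norm (?x - ?y) \<le> real (2 * k + 1) * M ^ (2 * k) * norm (a - b)" by (rule Suc)
    have "\<bar>(norm a)\<^sup>2 - (norm b)\<^sup>2\<bar> = (norm a + norm b) * \<bar>norm a - norm b\<bar>"
      by (simp add: power2_eq_square square_diff_square_factored abs_mult)
    also have "\<dots> \<le> (2 * M) * norm (a - b)"
      using assms M norm_triangle_ineq3[of a b] by (intro mult_mono) auto
    finally show "\<bar>(norm a)\<^sup>2 - (norm b)\<^sup>2\<bar> \<le> 2 * M * norm (a - b)" .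
    show "norm ?y \<le> M ^ (2 * k) * M"
      using assms M unfolding norm_mult by (intro mult_mono) (auto simp: norm_power intro: power_mono)
  qed (use M in auto)
  also have "\<dots> = real (2 * Suc k + 1) * M ^ (2 * Suc k) * norm (a - b)"
    by (simp add: algebra_simps power2_eq_square)
  finally show ?case .
qed

text \<open>Assumes sup bounds instead of membership in balls, so that uniqueness can use it for
  arbitrary solutions of the class.\<close>

lemma nonlinearity_lipschitz:
  assumes "AE z in lborel. norm (rep_L2 u z) \<le> M" "AE z in lborel. norm (rep_L2 v z) \<le> M" and M: "0 \<le> M"
  shows "norm (power_nonlinearity (2 * k + 1) u - power_nonlinearity (2 * k + 1) v)
    \<le> real (2 * k + 1) * M ^ (2 * k) * norm (u - v)"
proof -
  let ?N = "\<lambda>u z. of_real (norm (rep_L2 u z) ^ (2 * k)) * rep_L2 u z"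
  let ?c = "real (2 * k + 1) * M ^ (2 * k)"
  have sq: "square_integrable (?N u)" "square_integrable (?N v)"
    by (rule square_integrable_nonlinearity[OF assms(1) M], rule square_integrable_nonlinearity[OF assms(2) M])
  have "AE z in lborel. norm (?N u z - ?N v z) \<le> ?c * norm (rep_L2 (u - v) z)"
    using assms(1,2) rep_L2_diff[of u v]
  proof eventually_elim
    case (elim z)
    then show ?case using power_nonlinearity_pointwise[of "rep_L2 u z" M "rep_L2 v z" k] by simp
  qed
  then have "norm (abs_L2 (\<lambda>z. ?N u z - ?N v z)) \<le> ?c * norm (abs_L2 (rep_L2 (u - v)))"
    using norm_abs_L2_mono[OF square_integrable_rep[of "u - v"], of "\<lambda>z. ?N u z - ?N v z" ?c] M by simp
  moreover have "power_nonlinearity (2 * k + 1) w = abs_L2 (?N w)" for w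
    by (simp add: power_nonlinearity_def)
  ultimately show ?thesis
    by (simp only: abs_L2_diff[OF sq] abs_rep_L2)
qed

section \<open>Existence by contraction\<close>

definition oriented_integral :: "(real \<Rightarrow> 'a::banach) \<Rightarrow> real \<Rightarrow> 'a" where
  "oriented_integral f t = (if 0 \<le> t then integral {0..t} f else - integral {t..0} f)"

lemma oriented_integral_has_integral:
  fixes f :: "real \<Rightarrow> L2"
  assumes f: "continuous_on {-T..T} f" and t: "t \<in> {-T..T}"
  shows "has_integral_from_zero f (oriented_integral f t) t"
  unfolding has_integral_from_zero_def oriented_integral_def
  using t integrable_continuous_real[OF continuous_on_subset[OF f]]
  by (auto simp: integrable_integral)

lemma oriented_integral_diff:
  fixes f :: "real \<Rightarrow> 'a::banach"
  assumes f: "continuous_on {-T..T} f" and st: "s \<in> {-T..T}" "t \<in> {-T..T}" "s \<le> t"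
  shows "oriented_integral f t - oriented_integral f s = integral {s..t} f"
proof -
  have int: "f integrable_on {a..b}" if "-T \<le> a" "b \<le> T" for a b
    by (rule integrable_continuous_real[OF continuous_on_subset[OF f]]) (use that in auto)
  \<comment> \<open>Rebasing at \<open>-T\<close> expresses both signs of \<open>r\<close> by one
    formula, so the difference of two values needs no further cases.\<close>
  have eq: "oriented_integral f r = integral {-T..r} f - integral {-T..0} f" if "r \<in> {-T..T}" for r
  proof (cases "0 \<le> r")
    case True
    then have "integral {-T..0} f + integral {0..r} f = integral {-T..r} f"
      using that by (intro Henstock_Kurzweil_Integration.integral_combine int) auto
    then show ?thesis using True by (simp add: oriented_integral_def algebra_simps)
  next
    case False
    then have "integral {-T..r} f + integral {r..0} f = integral {-T..0} f"
      using that by (intro Henstock_Kurzweil_Integration.integral_combine int) auto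
    then show ?thesis using False by (simp add: oriented_integral_def algebra_simps)
  qed
  have comb: "integral {-T..s} f + integral {s..t} f = integral {-T..t} f"
    using st by (intro Henstock_Kurzweil_Integration.integral_combine int) auto
  show ?thesis unfolding eq[OF st(1)] eq[OF st(2)] comb[symmetric] by simp
qed

lemma continuous_on_oriented_integral:
  fixes f :: "real \<Rightarrow> 'a::banach"
  assumes f: "continuous_on {-T..T} f"
  shows "continuous_on {-T..T} (oriented_integral f)"
proof (cases "0 \<le> T")
  case True
  have "f integrable_on {-T..T}" by (rule integrable_continuous_real[OF f])
  from indefinite_integral_continuous_1[OF this]
  have "continuous_on {-T..T} (\<lambda>t. integral {-T..t} f + oriented_integral f (-T))"
    by (intro continuous_intros)
  then show ?thesis
  proof (rule continuous_on_eq)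
    fix t assume "t \<in> {-T..T}"
    then show "integral {-T..t} f + oriented_integral f (-T) = oriented_integral f t"
      using oriented_integral_diff[OF f, of "-T" t] True by (auto simp: algebra_simps)
  qed
qed simp

lemma norm_oriented_integral_diff_le:
  fixes f g :: "real \<Rightarrow> 'a::banach"
  assumes f: "continuous_on {-T..T} f" and g: "continuous_on {-T..T} g" and t: "t \<in> {-T..T}"
    and bnd: "\<And>\<tau>. \<tau> \<in> {-T..T} \<Longrightarrow> norm (f \<tau> - g \<tau>) \<le> B" "0 \<le> B"
  shows "norm (oriented_integral f t - oriented_integral g t) \<le> T * B"
proof -
  have *: "norm (integral {a..b} f - integral {a..b} g) \<le> T * B" if "a \<le> b" "-T \<le> a" "b \<le> T" "b - a \<le> T" for a b
  proof -
    have c: "continuous_on {a..b} f" "continuous_on {a..b} g"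
      using f g that by (auto elim!: continuous_on_subset)
    have "norm (integral {a..b} (\<lambda>\<tau>. f \<tau> - g \<tau>)) \<le> B * (b - a)"
      by (rule integral_bound[OF \<open>a \<le> b\<close> continuous_on_diff[OF c]]) (use that bnd in auto)
    also have "\<dots> \<le> T * B" using that bnd(2) by (simp add: mult.commute mult_left_mono)
    finally show ?thesis
      by (simp add: Henstock_Kurzweil_Integration.integral_diff integrable_continuous_real c)
  qed
  show ?thesis
  proof (cases "0 \<le> t")
    case True
    then show ?thesis using *[of 0 t] t by (simp add: oriented_integral_def)
  next
    case False
    then show ?thesis using *[of t 0] t by (simp add: oriented_integral_def norm_minus_commute)
  qed
qed

lemma fourier_ball_integral_continuous:
  assumes f: "continuous_on {a..b} f" and "a \<le> b" "0 \<le> B" "\<And>x. x \<in> {a..b} \<Longrightarrow> fourier_ball B (f x)"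
  shows "fourier_ball ((b - a) * B) (integral {a..b} f)"
  using fourier_ball_integral[OF integrable_integral[OF integrable_continuous_real[OF f]]] assms(2-) by blast

lemma fourier_ball_uminus: "fourier_ball R u \<Longrightarrow> 0 \<le> R \<Longrightarrow> fourier_ball R (- u)"
  using fourier_ball_scaleR[of R u "-1"] by simp

lemma fourier_ball_oriented_integral:
  assumes f: "continuous_on {-T..T} f" and t: "t \<in> {-T..T}" and "0 \<le> B"
    and B: "\<And>x. x \<in> {-T..T} \<Longrightarrow> fourier_ball B (f x)"
  shows "fourier_ball (T * B) (oriented_integral f t)"
proof -
  have "fourier_ball (\<bar>t\<bar> * B) (oriented_integral f t)"
  proof (cases "0 \<le> t")
    case True
    have "fourier_ball ((t - 0) * B) (integral {0..t} f)"
      by (rule fourier_ball_integral_continuous[OF continuous_on_subset[OF f]]) (use True t B \<open>0 \<le> B\<close> in auto)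
    then show ?thesis using True by (simp add: oriented_integral_def)
  next
    case False
    have nn: "0 \<le> (0 - t) * B" using False \<open>0 \<le> B\<close> by (intro mult_nonneg_nonneg) auto
    have "fourier_ball ((0 - t) * B) (integral {t..0} f)"
      by (rule fourier_ball_integral_continuous[OF continuous_on_subset[OF f]]) (use False t B \<open>0 \<le> B\<close> in auto)
    from fourier_ball_uminus[OF this nn] show ?thesis
      using False by (simp add: oriented_integral_def)
  qed
  then show ?thesis
    by (rule fourier_ball_mono) (use t \<open>0 \<le> B\<close> in \<open>auto intro!: mult_right_mono\<close>)
qed

text \<open>In the interaction picture \<open>v t = propagator (- t) (u t)\<close> the equation has no linear part and
  \<open>v\<close> becomes Lipschitz in time, even for the energy norm.\<close>

definition force :: "nat \<Rightarrow> (real \<Rightarrow> L2) \<Rightarrow> real \<Rightarrow> L2" where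
  "force k v \<tau> = propagator (- \<tau>) (power_nonlinearity (2 * k + 1) (propagator \<tau> (v \<tau>)))"

lemma nonlinearity_lipschitz_ball:
  assumes "fourier_ball R u" "fourier_ball R v" "0 \<le> R"
  shows "norm (power_nonlinearity (2 * k + 1) u - power_nonlinearity (2 * k + 1) v)
    \<le> real (2 * k + 1) * R ^ (2 * k) * norm (u - v)"
  using assms by (intro nonlinearity_lipschitz fourier_ball_bounded)

lemma continuous_on_nonlinearity:
  assumes w: "continuous_on S w" and R: "\<And>t. t \<in> S \<Longrightarrow> fourier_ball R (w t)" "0 \<le> R"
  shows "continuous_on S (\<lambda>t. power_nonlinearity (2 * k + 1) (w t))"
  unfolding continuous_on_def
proof (intro ballI)
  fix a assume a: "a \<in> S"
  let ?L = "real (2 * k + 1) * R ^ (2 * k)"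
  have "((\<lambda>t. w t - w a) \<longlongrightarrow> 0) (at a within S)"
    using w a by (simp add: continuous_on_def LIM_zero)
  then have "((\<lambda>t. ?L * norm (w t - w a)) \<longlongrightarrow> 0) (at a within S)"
    by (intro tendsto_mult_right_zero tendsto_norm_zero)
  moreover have "eventually (\<lambda>t. norm (power_nonlinearity (2 * k + 1) (w t) - power_nonlinearity (2 * k + 1) (w a))
      \<le> ?L * norm (w t - w a)) (at a within S)"
    unfolding eventually_at_filter
    by (intro always_eventually allI impI nonlinearity_lipschitz_ball R a)
  ultimately have "((\<lambda>t. power_nonlinearity (2 * k + 1) (w t) - power_nonlinearity (2 * k + 1) (w a)) \<longlongrightarrow> 0) (at a within S)"
    by (rule Lim_null_comparison[rotated])
  then show "((\<lambda>t. power_nonlinearity (2 * k + 1) (w t)) \<longlongrightarrow> power_nonlinearity (2 * k + 1) (w a)) (at a within S)"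
    by (simp add: LIM_zero_iff)
qed

lemma force:
  assumes v: "continuous_on S v" and R: "\<And>t. t \<in> S \<Longrightarrow> fourier_ball R (v t)" "0 \<le> R"
  shows "continuous_on S (force k v)"
    "\<tau> \<in> S \<Longrightarrow> fourier_ball ((9 * R\<^sup>2) ^ k * R) (force k v \<tau>)"
proof -
  show "continuous_on S (force k v)"
    unfolding force_def
    by (intro continuous_on_propagator continuous_on_nonlinearity[where R = R] fourier_ball_propagator continuous_intros v R)
  show "fourier_ball ((9 * R\<^sup>2) ^ k * R) (force k v \<tau>)" if "\<tau> \<in> S"
    unfolding force_def
    by (intro fourier_ball_propagator fourier_ball_nonlinearity R that)
qed

lemma force_lipschitz:
  assumes "fourier_ball R (v \<tau>)" "fourier_ball R (w \<tau>)" "0 \<le> R"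
  shows "norm (force k v \<tau> - force k w \<tau>) \<le> real (2 * k + 1) * R ^ (2 * k) * norm (v \<tau> - w \<tau>)"
proof -
  have "norm (force k v \<tau> - force k w \<tau>)
      = norm (power_nonlinearity (2 * k + 1) (propagator \<tau> (v \<tau>)) - power_nonlinearity (2 * k + 1) (propagator \<tau> (w \<tau>)))"
    by (simp add: force_def propagator_diff[symmetric] norm_propagator)
  also have "\<dots> \<le> real (2 * k + 1) * R ^ (2 * k) * norm (propagator \<tau> (v \<tau>) - propagator \<tau> (w \<tau>))"
    by (intro nonlinearity_lipschitz_ball fourier_ball_propagator assms)
  finally show ?thesis by (simp add: propagator_diff[symmetric] norm_propagator)
qed

text \<open>Banach's fixed point theorem on paths with values in the ball of radius
  \<open>2 * R\<close>. By \<open>T1\<close> the integral term has radius at most \<open>R\<close>,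
  so together with the datum the ball is preserved; by \<open>T2\<close> the map halves distances in
  the sup of the \<open>L2\<close> norm.\<close>

lemma interaction_solution_exists:
  assumes u0: "fourier_ball R u0" and R: "0 \<le> R" and T: "0 < T" and c: "norm c = 1"
    and T1: "T * ((9 * (2 * R)\<^sup>2) ^ k * (2 * R)) \<le> R"
    and T2: "T * (real (2 * k + 1) * (2 * R) ^ (2 * k)) \<le> 1 / 2"
  obtains v where "continuous_on {-T..T} v" "\<And>t. t \<in> {-T..T} \<Longrightarrow> fourier_ball (2 * R) (v t)"
    "\<And>t. t \<in> {-T..T} \<Longrightarrow> v t = u0 - cscale c (oriented_integral (force k v) t)"
proof -
  \<comment> \<open>Projects time onto \<open>{-T..T}\<close>. The fixed point is sought among
    bounded continuous functions on the whole line, a complete space; freezing time outside the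
    interval makes the Picard iterates bounded.\<close>
  define cl where "cl t = max (- T) (min T t)" for t :: real
  have cl: "cl t \<in> {-T..T}" for t using T by (auto simp: cl_def)
  have cl_id: "cl t = t" if "t \<in> {-T..T}" for t using that by (auto simp: cl_def)
  have cl_cont: "continuous_on UNIV cl" unfolding cl_def by (intro continuous_intros)
  define S where "S = PiC UNIV (\<lambda>t :: real. {u. fourier_ball (2 * R) u})"
  have S: "v \<in> S \<longleftrightarrow> (\<forall>t. fourier_ball (2 * R) (apply_bcontfun v t))" for v by (auto simp: S_def mem_PiC_iff)
  have "closed {u. fourier_ball (2 * R) u}"
    unfolding closed_sequential_limits using fourier_ball_closed by auto
  then have clS: "closed S" unfolding S_def by (intro closed_PiC) auto
  have "const_bcontfun u0 \<in> S"
    using fourier_ball_mono[OF u0 R, of "2 * R"] R by (simp add: S const_bcontfun.rep_eq)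
  then have neS: "S \<noteq> {}" by blast
  define \<Phi>0 where "\<Phi>0 v t = u0 - cscale c (oriented_integral (force k v) (cl t))" for v :: "real \<Rightarrow> L2" and t
  have F: "continuous_on {-T..T} (force k v)"
    "\<tau> \<in> {-T..T} \<Longrightarrow> fourier_ball ((9 * (2 * R)\<^sup>2) ^ k * (2 * R)) (force k v \<tau>)"
    if "v \<in> S" for v \<tau>
    by (rule force[where R = "2 * R" and S = "{-T..T}"]; use that R in \<open>simp add: S\<close>)+
  have \<Phi>0_cont: "continuous_on UNIV (\<Phi>0 v)" if "v \<in> S" for v
    unfolding \<Phi>0_def
    by (intro continuous_intros bounded_linear.continuous_on[OF bounded_linear_cscale]
        continuous_on_compose2[OF continuous_on_oriented_integral[OF F(1)[OF that]] cl_cont]) (use cl in auto)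
  have \<Phi>0_bcont: "\<Phi>0 v \<in> bcontfun" if v: "v \<in> S" for v
  proof -
    have "compact (\<Phi>0 v ` {-T..T})"
      by (intro compact_continuous_image continuous_on_subset[OF \<Phi>0_cont[OF v]]) auto
    moreover have "range (\<Phi>0 v) \<subseteq> \<Phi>0 v ` {-T..T}"
    proof
      fix x assume "x \<in> range (\<Phi>0 v)"
      then obtain t where "x = \<Phi>0 v t" by blast
      moreover have "\<Phi>0 v t = \<Phi>0 v (cl t)" by (simp add: \<Phi>0_def cl_id[OF cl])
      ultimately show "x \<in> \<Phi>0 v ` {-T..T}" using cl by blast
    qed
    ultimately show ?thesis using \<Phi>0_cont[OF v] by (auto simp: bcontfun_def intro: bounded_subset compact_imp_bounded)
  qed
  \<comment> \<open>Controlled only for \<open>v\<close> in \<open>S\<close>, where the image of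
    \<open>\<Phi>0\<close> is known to be bounded and continuous; elsewhere \<open>Bcontfun\<close>
    may return an arbitrary value.\<close>
  define \<Phi> where "\<Phi> v = Bcontfun (\<Phi>0 (apply_bcontfun v))" for v
  have \<Phi>: "apply_bcontfun (\<Phi> v) t = \<Phi>0 v t" if "v \<in> S" for v t
    by (simp add: \<Phi>_def Bcontfun_inverse[OF \<Phi>0_bcont[OF that]])
  have img: "\<Phi> ` S \<subseteq> S"
  proof (intro image_subsetI)
    fix v assume v: "v \<in> S"
    have "fourier_ball (2 * R) (\<Phi>0 v t)" for t
    proof -
      let ?B = "(9 * (2 * R)\<^sup>2) ^ k * (2 * R)"
      have B: "0 \<le> ?B" using R by simp
      have "fourier_ball (T * ?B) (oriented_integral (force k v) (cl t))"
        by (rule fourier_ball_oriented_integral[OF F(1)[OF v] cl B F(2)[OF v]])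
      then have "fourier_ball R (oriented_integral (force k v) (cl t))"
        by (rule fourier_ball_mono[OF _ mult_nonneg_nonneg[OF less_imp_le[OF T] B] T1])
      from fourier_ball_cscale[OF this R, of "- c"]
      have "fourier_ball R (cscale (- c) (oriented_integral (force k v) (cl t)))"
        using c by simp
      from fourier_ball_add[OF u0 this R R] 
      have "fourier_ball (R + R) (u0 + cscale (- c) (oriented_integral (force k v) (cl t)))" .
      moreover have "cscale (- c) w = - cscale c w" for w
        using scaleR_eq_cscale[of "-1" "cscale c w"] by (simp add: cscale_cscale)
      ultimately show ?thesis by (simp add: \<Phi>0_def)
    qed
    then show "\<Phi> v \<in> S" by (simp add: S \<Phi>[OF v])
  qed
  have contr: "dist (\<Phi> v) (\<Phi> w) \<le> 1 / 2 * dist v w" if v: "v \<in> S" and w: "w \<in> S" for v w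
  proof (rule dist_bound)
    fix t
    let ?L = "real (2 * k + 1) * (2 * R) ^ (2 * k)"
    have "norm (oriented_integral (force k v) (cl t) - oriented_integral (force k w) (cl t))
        \<le> T * (?L * dist v w)"
    proof (rule norm_oriented_integral_diff_le[OF F(1)[OF v] F(1)[OF w] cl])
      fix \<tau>
      have "norm (force k v \<tau> - force k w \<tau>)
          \<le> ?L * norm (apply_bcontfun v \<tau> - apply_bcontfun w \<tau>)"
        using v w R by (intro force_lipschitz) (auto simp: S)
      also have "\<dots> \<le> ?L * dist v w"
        using dist_bounded[of v \<tau> w] R by (intro mult_left_mono) (auto simp: dist_norm)
      finally show "norm (force k v \<tau> - force k w \<tau>) \<le> ?L * dist v w" .
    qed (use R in simp)
    also have "\<dots> \<le> 1 / 2 * dist v w"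
      unfolding mult.assoc[symmetric] using T2 by (intro mult_right_mono) (auto simp: mult.assoc)
    finally have *: "norm (oriented_integral (force k v) (cl t) - oriented_integral (force k w) (cl t))
        \<le> 1 / 2 * dist v w" .
    have lin: "cscale c x - cscale c y = cscale c (x - y)" for x y
      by (rule linear_diff[symmetric, OF bounded_linear.axioms(1)[OF bounded_linear_cscale]])
    have "dist (\<Phi>0 v t) (\<Phi>0 w t) = norm (cscale c (oriented_integral (force k v) (cl t)) - cscale c (oriented_integral (force k w) (cl t)))"
      by (simp add: \<Phi>0_def dist_norm norm_minus_commute)
    also have "\<dots> \<le> 1 / 2 * dist v w" using * c by (simp add: lin norm_cscale)
    finally show "dist (apply_bcontfun (\<Phi> v) t) (apply_bcontfun (\<Phi> w) t) \<le> 1 / 2 * dist v w"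
      by (simp add: \<Phi>[OF v] \<Phi>[OF w])
  qed
  have "\<exists>!v. v \<in> S \<and> \<Phi> v = v"
    by (rule Banach_fix[OF complete_eq_closed[THEN iffD2, OF clS] neS _ _ img, of "1 / 2"]) (use contr in auto)
  then obtain v where v: "v \<in> S" "\<Phi> v = v" by blast
  show ?thesis
  proof (rule that[of "apply_bcontfun v"])
    show "fourier_ball (2 * R) (apply_bcontfun v t)" for t using v(1) by (simp add: S)
    show "apply_bcontfun v t = u0 - cscale c (oriented_integral (force k v) t)" if "t \<in> {-T..T}" for t
      using \<Phi>[OF v(1), of t] v(2) cl_id[OF that] by (simp add: \<Phi>0_def)
  qed simp
qed

section \<open>The energy space and regularity of the solution\<close>

lemma japanese_bracket_bounds: "1 \<le> japanese_bracket x" "\<bar>x\<bar> \<le> japanese_bracket x" "japanese_bracket x \<le> 1 + \<bar>x\<bar>"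
proof -
  show "1 \<le> japanese_bracket x" by (simp add: japanese_bracket_def)
  show "\<bar>x\<bar> \<le> japanese_bracket x"
    unfolding japanese_bracket_def by (rule real_le_rsqrt) simp
  show "japanese_bracket x \<le> 1 + \<bar>x\<bar>"
    unfolding japanese_bracket_def by (rule real_le_lsqrt) (auto simp: power2_sum)
qed

lemma japanese_bracket_measurable [measurable]: "japanese_bracket \<in> borel_measurable borel"
  unfolding japanese_bracket_def by (intro borel_measurable_continuous_onI continuous_intros)

lemma aniso_sobolev_1_0:
  "u \<in> aniso_sobolev 1 0 \<longleftrightarrow> integrable lborel (\<lambda>\<zeta>. (1 + (fst \<zeta>)\<^sup>2) * (norm (rep_L2 (fourier u) \<zeta>))\<^sup>2)"
proof -
  have "0 < japanese_bracket x" for x using japanese_bracket_bounds(1)[of x] by linarith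
  then have "(\<lambda>(\<xi>, \<eta>). japanese_bracket \<xi> powr (2 * 1) * japanese_bracket \<eta> powr (2 * 0) *
       (norm (rep_L2 (fourier u) (\<xi>, \<eta>)))\<^sup>2) = (\<lambda>\<zeta>. (1 + (fst \<zeta>)\<^sup>2) * (norm (rep_L2 (fourier u) \<zeta>))\<^sup>2)"
    by (intro ext) (auto simp: case_prod_unfold powr_numeral less_imp_neq[symmetric] japanese_bracket_def)
  then show ?thesis by (simp only: aniso_sobolev_def mem_Collect_eq)
qed

lemma aniso_sobolev_0_half:
  "u \<in> aniso_sobolev 0 (1/2) \<longleftrightarrow> integrable lborel (\<lambda>\<zeta>. japanese_bracket (snd \<zeta>) * (norm (rep_L2 (fourier u) \<zeta>))\<^sup>2)"
proof -
  have "0 < japanese_bracket x" for x using japanese_bracket_bounds(1)[of x] by linarith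
  then have "(\<lambda>(\<xi>, \<eta>). japanese_bracket \<xi> powr (2 * 0) * japanese_bracket \<eta> powr (2 * (1/2)) *
       (norm (rep_L2 (fourier u) (\<xi>, \<eta>)))\<^sup>2) = (\<lambda>\<zeta>. japanese_bracket (snd \<zeta>) * (norm (rep_L2 (fourier u) \<zeta>))\<^sup>2)"
    by (intro ext) (auto simp: case_prod_unfold less_imp_neq[symmetric] less_imp_le)
  then show ?thesis by (simp only: aniso_sobolev_def mem_Collect_eq)
qed

definition weighted_fourier :: "L2 \<Rightarrow> plane \<Rightarrow> complex" where
  "weighted_fourier u \<zeta> = of_real (weight \<zeta>) * rep_L2 (fourier u) \<zeta>"

lemma weighted_fourier_measurable [measurable]: "weighted_fourier u \<in> borel_measurable borel"
  unfolding weighted_fourier_def by measurable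

lemma norm_weighted_fourier_sq:
  "(norm (weighted_fourier u \<zeta>))\<^sup>2 = (1 + (fst \<zeta>)\<^sup>2 + \<bar>snd \<zeta>\<bar>) * (norm (rep_L2 (fourier u) \<zeta>))\<^sup>2"
  by (simp add: weighted_fourier_def norm_mult power_mult_distrib weight_sq)

lemma square_integrable_weighted_iff:
  "square_integrable (weighted_fourier u)
     \<longleftrightarrow> integrable lborel (\<lambda>\<zeta>. (1 + (fst \<zeta>)\<^sup>2 + \<bar>snd \<zeta>\<bar>) * (norm (rep_L2 (fourier u) \<zeta>))\<^sup>2)"
  by (simp add: square_integrable_def norm_weighted_fourier_sq)

text \<open>The two Sobolev weights add up to a quantity comparable with 1 + xi^2 + |eta|, because
  the Japanese bracket lies between |eta| and 1 + |eta|.\<close>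

lemma energy_space_iff: "u \<in> energy_space \<longleftrightarrow> square_integrable (weighted_fourier u)"
proof
  let ?n = "\<lambda>\<zeta>. (norm (rep_L2 (fourier u) \<zeta>))\<^sup>2"
  assume "u \<in> energy_space"
  then have int: "integrable lborel (\<lambda>\<zeta>. (1 + (fst \<zeta>)\<^sup>2) * ?n \<zeta> + japanese_bracket (snd \<zeta>) * ?n \<zeta>)"
    by (auto simp: energy_space_def aniso_sobolev_1_0 aniso_sobolev_0_half)
  show "square_integrable (weighted_fourier u)"
    unfolding square_integrable_weighted_iff
  proof (rule Bochner_Integration.integrable_bound[OF int])
    show "AE \<zeta> in lborel. norm ((1 + (fst \<zeta>)\<^sup>2 + \<bar>snd \<zeta>\<bar>) * ?n \<zeta>) \<le> norm ((1 + (fst \<zeta>)\<^sup>2) * ?n \<zeta> + japanese_bracket (snd \<zeta>) * ?n \<zeta>)"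
    proof (rule AE_I2)
      fix \<zeta>
      have "(1 + (fst \<zeta>)\<^sup>2 + \<bar>snd \<zeta>\<bar>) * ?n \<zeta> \<le> (1 + (fst \<zeta>)\<^sup>2 + japanese_bracket (snd \<zeta>)) * ?n \<zeta>"
        using japanese_bracket_bounds(2) by (intro mult_right_mono) auto
      moreover have "0 \<le> (1 + (fst \<zeta>)\<^sup>2 + \<bar>snd \<zeta>\<bar>) * ?n \<zeta>" by simp
      ultimately show "norm ((1 + (fst \<zeta>)\<^sup>2 + \<bar>snd \<zeta>\<bar>) * ?n \<zeta>) \<le> norm ((1 + (fst \<zeta>)\<^sup>2) * ?n \<zeta> + japanese_bracket (snd \<zeta>) * ?n \<zeta>)"
        unfolding real_norm_def distrib_right[symmetric] by linarith
    qed
  qed measurable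
next
  let ?n = "\<lambda>\<zeta>. (norm (rep_L2 (fourier u) \<zeta>))\<^sup>2"
  assume "square_integrable (weighted_fourier u)"
  then have int: "integrable lborel (\<lambda>\<zeta>. (1 + (fst \<zeta>)\<^sup>2 + \<bar>snd \<zeta>\<bar>) * ?n \<zeta>)"
    by (simp only: square_integrable_weighted_iff)
  have "integrable lborel (\<lambda>\<zeta>. (1 + (fst \<zeta>)\<^sup>2) * ?n \<zeta>)"
    by (rule Bochner_Integration.integrable_bound[OF int]) (auto intro!: mult_right_mono simp: abs_mult)
  moreover have "integrable lborel (\<lambda>\<zeta>. japanese_bracket (snd \<zeta>) * ?n \<zeta>)"
  proof (rule Bochner_Integration.integrable_bound[OF int])
    show "AE \<zeta> in lborel. norm (japanese_bracket (snd \<zeta>) * ?n \<zeta>) \<le> norm ((1 + (fst \<zeta>)\<^sup>2 + \<bar>snd \<zeta>\<bar>) * ?n \<zeta>)"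
    proof (rule AE_I2)
      fix \<zeta>
      have "japanese_bracket (snd \<zeta>) * ?n \<zeta> \<le> (1 + (fst \<zeta>)\<^sup>2 + \<bar>snd \<zeta>\<bar>) * ?n \<zeta>"
      proof (rule mult_right_mono)
        show "japanese_bracket (snd \<zeta>) \<le> 1 + (fst \<zeta>)\<^sup>2 + \<bar>snd \<zeta>\<bar>"
          using japanese_bracket_bounds(3)[of "snd \<zeta>"] zero_le_power2[of "fst \<zeta>"] by linarith
      qed simp
      moreover have "0 \<le> japanese_bracket (snd \<zeta>) * ?n \<zeta>"
        using japanese_bracket_bounds(1)[of "snd \<zeta>"] by simp
      ultimately show "norm (japanese_bracket (snd \<zeta>) * ?n \<zeta>) \<le> norm ((1 + (fst \<zeta>)\<^sup>2 + \<bar>snd \<zeta>\<bar>) * ?n \<zeta>)"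
        unfolding real_norm_def by linarith
    qed
  qed measurable
  ultimately show "u \<in> energy_space"
    by (simp add: energy_space_def aniso_sobolev_1_0 aniso_sobolev_0_half)
qed

lemma norm_fourier_multiplier_sq:
  assumes m: "m \<in> borel_measurable borel" and bnd: "\<And>\<zeta>. norm (m \<zeta>) \<le> weight \<zeta>" and u: "u \<in> energy_space"
  shows "integrable lborel (\<lambda>\<zeta>. (norm (m \<zeta>))\<^sup>2 * (norm (rep_L2 (fourier u) \<zeta>))\<^sup>2)"
    "(norm (fourier_multiplier m u))\<^sup>2 = (LINT \<zeta>|lborel. (norm (m \<zeta>))\<^sup>2 * (norm (rep_L2 (fourier u) \<zeta>))\<^sup>2)"
proof -
  have sq: "square_integrable (\<lambda>\<zeta>. m \<zeta> * rep_L2 (fourier u) \<zeta>)"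
    by (rule square_integrable_bound[OF u[unfolded energy_space_iff]])
       (use m bnd in \<open>auto simp: weighted_fourier_def norm_mult intro!: mult_right_mono\<close>)
  then show "integrable lborel (\<lambda>\<zeta>. (norm (m \<zeta>))\<^sup>2 * (norm (rep_L2 (fourier u) \<zeta>))\<^sup>2)"
    by (simp add: square_integrable_def norm_mult power_mult_distrib)
  have "norm (fourier_multiplier m u) = norm (abs_L2 (\<lambda>\<zeta>. m \<zeta> * rep_L2 (fourier u) \<zeta>))"
    using fourier_fourier_multiplier[OF sq] norm_fourier[of "fourier_multiplier m u"] by simp
  then show "(norm (fourier_multiplier m u))\<^sup>2 = (LINT \<zeta>|lborel. (norm (m \<zeta>))\<^sup>2 * (norm (rep_L2 (fourier u) \<zeta>))\<^sup>2)"
    by (simp add: norm_abs_L2_sq[OF sq] norm_mult power_mult_distrib)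
qed

text \<open>The symbols of the two derivatives and of the identity have squared moduli adding up
  exactly to the squared weight. Membership in the energy space makes the products square
  integrable, so that the multipliers have their intended values.\<close>

lemma energy_norm_eq:
  assumes u: "u \<in> energy_space"
  shows "energy_norm u = norm (abs_L2 (weighted_fourier u))"
proof -
  let ?n = "\<lambda>\<zeta>. (norm (rep_L2 (fourier u) \<zeta>))\<^sup>2"
  define mx where "mx \<zeta> = \<i> * complex_of_real (fst \<zeta>)" for \<zeta> :: "plane"
  define my where "my \<zeta> = complex_of_real (\<bar>snd \<zeta>\<bar> powr (1/2))" for \<zeta> :: "plane"
  have nx: "(norm (mx \<zeta>))\<^sup>2 = (fst \<zeta>)\<^sup>2" for \<zeta> by (simp add: mx_def norm_mult)
  have ny: "(norm (my \<zeta>))\<^sup>2 = \<bar>snd \<zeta>\<bar>" for \<zeta> by (simp add: my_def powr_half_sqrt)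
  have le: "norm (mx \<zeta>) \<le> weight \<zeta>" "norm (my \<zeta>) \<le> weight \<zeta>" for \<zeta>
    by (rule power2_le_imp_le; simp add: nx ny weight_sq)+
  have meas: "mx \<in> borel_measurable borel" "my \<in> borel_measurable borel" unfolding mx_def my_def by measurable
  have one: "(\<lambda>\<zeta>. 1 :: complex) \<in> borel_measurable borel" "norm (1 :: complex) \<le> weight \<zeta>" for \<zeta>
    using weight_ge_1 by auto
  have "deriv_x = fourier_multiplier mx" unfolding deriv_x_def mx_def by (simp add: case_prod_unfold)
  moreover have "half_deriv_y = fourier_multiplier my" unfolding half_deriv_y_def my_def by (simp add: case_prod_unfold)
  moreover have "u = fourier_multiplier (\<lambda>\<zeta>. 1) u" by (rule fourier_multiplier_eqI[symmetric]) simp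
  ultimately have "(norm (deriv_x u))\<^sup>2 + (norm (half_deriv_y u))\<^sup>2 + (norm u)\<^sup>2
      = (LINT \<zeta>|lborel. (fst \<zeta>)\<^sup>2 * ?n \<zeta>) + (LINT \<zeta>|lborel. \<bar>snd \<zeta>\<bar> * ?n \<zeta>) + (LINT \<zeta>|lborel. ?n \<zeta>)"
    using norm_fourier_multiplier_sq(2)[OF meas(1) le(1) u] norm_fourier_multiplier_sq(2)[OF meas(2) le(2) u]
      norm_fourier_multiplier_sq(2)[OF one u] by (simp add: nx ny)
  also have "\<dots> = (LINT \<zeta>|lborel. (fst \<zeta>)\<^sup>2 * ?n \<zeta> + \<bar>snd \<zeta>\<bar> * ?n \<zeta> + ?n \<zeta>)"
    using norm_fourier_multiplier_sq(1)[OF meas(1) le(1) u] norm_fourier_multiplier_sq(1)[OF meas(2) le(2) u]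
      norm_fourier_multiplier_sq(1)[OF one u] by (simp add: nx ny)
  also have "\<dots> = (LINT \<zeta>|lborel. (norm (weighted_fourier u \<zeta>))\<^sup>2)"
    by (simp add: norm_weighted_fourier_sq algebra_simps)
  also have "\<dots> = (norm (abs_L2 (weighted_fourier u)))\<^sup>2"
    using u by (simp add: norm_abs_L2_sq energy_space_iff)
  finally show ?thesis unfolding energy_norm_def by simp
qed

section \<open>Energy norm, Fourier balls and continuity in time\<close>

lemma norm_le_energy_norm: "norm u \<le> energy_norm u"
  unfolding energy_norm_def by (rule real_le_rsqrt) simp

lemma fourier_ball_energy:
  assumes "fourier_ball R u" "0 \<le> R"
  shows "u \<in> energy_space" "energy_norm u \<le> R"
proof -
  note w = weighted_square_integrable[of "rep_L2 (fourier u)" R, folded weighted_fourier_def]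
  have "W2_nn (rep_L2 (fourier u)) \<le> ennreal (R\<^sup>2)"
    using assms by (simp add: fourier_ball_def in_ball_def)
  with w show u: "u \<in> energy_space" and "energy_norm u \<le> R"
    using assms(2) by (auto simp: energy_space_iff energy_norm_eq weighted_fourier_def[abs_def])
qed

lemma fourier_ball_L1:
  assumes "fourier_ball R u" "0 \<le> R"
  shows "fourier_in_L1 u" "fourier_L1_norm u \<le> R"
proof -
  show L: "fourier_in_L1 u"
    using in_ball_L1_L2[OF assms(1)[unfolded fourier_ball_def]] by (simp add: L1_L2_def fourier_in_L1_def)
  have "ennreal (fourier_L1_norm u) \<le> ennreal R"
    using L assms(1) by (simp add: fourier_L1_norm_def fourier_in_L1_def fourier_ball_def in_ball_def nn_integral_eq_integral)
  then show "fourier_L1_norm u \<le> R" using assms(2) by simp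
qed

text \<open>The entrance for the datum: it turns the two norms of the theorem into a single
  radius.\<close>

lemma fourier_ballI:
  assumes "u \<in> energy_space" "fourier_in_L1 u" "energy_norm u \<le> R" "fourier_L1_norm u \<le> R"
  shows "fourier_ball R u"
proof -
  have sq: "square_integrable (\<lambda>\<zeta>. of_real (weight \<zeta>) * rep_L2 (fourier u) \<zeta>)"
    using assms(1) by (simp add: energy_space_iff weighted_fourier_def[abs_def])
  have "W2_nn (rep_L2 (fourier u)) = ennreal ((energy_norm u)\<^sup>2)"
    unfolding weighted_nn[OF sq] energy_norm_eq[OF assms(1)] weighted_fourier_def[abs_def] ..
  also have "\<dots> \<le> ennreal (R\<^sup>2)"
    using assms(3) order_trans[OF norm_ge_zero norm_le_energy_norm[of u]] by (intro ennreal_leI power_mono) auto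
  finally have "W2_nn (rep_L2 (fourier u)) \<le> ennreal (R\<^sup>2)" .
  moreover have "L1_nn (rep_L2 (fourier u)) = ennreal (fourier_L1_norm u)"
    using assms(2) by (simp add: fourier_L1_norm_def fourier_in_L1_def nn_integral_eq_integral)
  ultimately show ?thesis using assms(4) by (simp add: fourier_ball_def in_ball_def ennreal_leI)
qed

lemma energy_norm_add:
  assumes u: "u \<in> energy_space" and v: "v \<in> energy_space"
  shows "u + v \<in> energy_space" "energy_norm (u + v) \<le> energy_norm u + energy_norm v"
proof -
  note sq = u[unfolded energy_space_iff] v[unfolded energy_space_iff]
  have ae: "AE \<zeta> in lborel. weighted_fourier (u + v) \<zeta> = weighted_fourier u \<zeta> + weighted_fourier v \<zeta>"
    using rep_L2_add[of "fourier u" "fourier v"] unfolding weighted_fourier_def fourier_add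
    by eventually_elim (simp add: distrib_left)
  have sum: "square_integrable (\<lambda>\<zeta>. weighted_fourier u \<zeta> + weighted_fourier v \<zeta>)"
    by (rule square_integrable_add[OF sq])
  have uv: "square_integrable (weighted_fourier (u + v))"
  proof -
    have "AE \<zeta> in lborel. norm (weighted_fourier (u + v) \<zeta>) \<le> 1 * norm (weighted_fourier u \<zeta> + weighted_fourier v \<zeta>)"
      using ae by eventually_elim simp
    from norm_abs_L2_mono[OF sum _ this] show ?thesis by simp
  qed
  then show uv': "u + v \<in> energy_space" by (simp add: energy_space_iff)
  have "abs_L2 (weighted_fourier (u + v)) = abs_L2 (weighted_fourier u) + abs_L2 (weighted_fourier v)"
    using ae uv sum by (simp add: abs_L2_add sq abs_L2_eq_iff)
  then show "energy_norm (u + v) \<le> energy_norm u + energy_norm v"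
    by (simp add: energy_norm_eq u v uv' norm_triangle_ineq)
qed

text \<open>Weight and phase are both multiplications on the Fourier side, so energy distances
  between evolved states become \<open>L2\<close> distances of phase-rotated weighted
  transforms.\<close>

lemma energy_propagator_diff:
  assumes u: "u \<in> energy_space"
  shows "propagator s u - propagator t u \<in> energy_space"
    "energy_norm (propagator s u - propagator t u)
      = norm (abs_L2 (\<lambda>\<zeta>. phase s \<zeta> * weighted_fourier u \<zeta>) - abs_L2 (\<lambda>\<zeta>. phase t \<zeta> * weighted_fourier u \<zeta>))"
proof -
  let ?d = "\<lambda>\<zeta>. phase s \<zeta> * weighted_fourier u \<zeta> - phase t \<zeta> * weighted_fourier u \<zeta>"
  note sq = square_integrable_phase_mult[OF u[unfolded energy_space_iff]]
  have ae: "AE \<zeta> in lborel. weighted_fourier (propagator s u - propagator t u) \<zeta> = ?d \<zeta>"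
    using rep_L2_diff[of "fourier (propagator s u)" "fourier (propagator t u)"]
      rep_fourier_propagator[of s u] rep_fourier_propagator[of t u]
    unfolding weighted_fourier_def fourier_diff by eventually_elim (simp add: right_diff_distrib mult.left_commute)
  have d: "square_integrable ?d" by (rule square_integrable_diff[OF sq sq])
  have w: "square_integrable (weighted_fourier (propagator s u - propagator t u))"
  proof -
    have "AE \<zeta> in lborel. norm (weighted_fourier (propagator s u - propagator t u) \<zeta>) \<le> 1 * norm (?d \<zeta>)"
      using ae by eventually_elim simp
    from norm_abs_L2_mono[OF d _ this] show ?thesis by simp
  qed
  then show 1: "propagator s u - propagator t u \<in> energy_space" by (simp add: energy_space_iff)
  have "abs_L2 (weighted_fourier (propagator s u - propagator t u)) = abs_L2 ?d"
    using ae w d by (simp add: abs_L2_eq_iff)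
  then show "energy_norm (propagator s u - propagator t u)
      = norm (abs_L2 (\<lambda>\<zeta>. phase s \<zeta> * weighted_fourier u \<zeta>) - abs_L2 (\<lambda>\<zeta>. phase t \<zeta> * weighted_fourier u \<zeta>))"
    by (simp add: energy_norm_eq[OF 1] abs_L2_diff[OF sq sq])
qed

text \<open>The contraction yields continuity in \<open>L2\<close> only. Continuity in energy
  separates the change of \<open>v\<close>, controlled by the Lipschitz balls, from the change of
  the propagator on the fixed state \<open>v t\<close>, where strong continuity suffices.\<close>

lemma continuous_into_energy_propagator:
  assumes R: "\<And>t. t \<in> {-T..T} \<Longrightarrow> fourier_ball R (v t)" "0 \<le> R"
    and lip: "\<And>s t. s \<in> {-T..T} \<Longrightarrow> t \<in> {-T..T} \<Longrightarrow> fourier_ball (B * \<bar>s - t\<bar>) (v s - v t)" and B: "0 \<le> B"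
  shows "continuous_into_energy T (\<lambda>t. propagator t (v t))"
  unfolding continuous_into_energy_def
proof (intro conjI ballI)
  fix t assume t: "t \<in> {-T..T}"
  show "propagator t (v t) \<in> energy_space"
    by (rule fourier_ball_energy(1)[OF fourier_ball_propagator[OF R(1)[OF t]] R(2)])
  have vt: "v t \<in> energy_space" by (rule fourier_ball_energy(1)[OF R(1)[OF t] R(2)])
  let ?\<Lambda> = "\<lambda>s. abs_L2 (\<lambda>\<zeta>. phase s \<zeta> * weighted_fourier (v t) \<zeta>)"
  show "((\<lambda>s. energy_norm (propagator s (v s) - propagator t (v t))) \<longlongrightarrow> 0) (at t within {-T..T})"
    unfolding tendsto_at_iff_sequentially comp_def
  proof (intro allI impI)
    fix X assume X: "\<forall>i. X i \<in> {-T..T} - {t}" "X \<longlonglongrightarrow> t"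
    have "(\<lambda>n. B * \<bar>X n - t\<bar> + norm (?\<Lambda> (X n) - ?\<Lambda> t)) \<longlonglongrightarrow> B * \<bar>t - t\<bar> + norm (?\<Lambda> t - ?\<Lambda> t)"
      by (intro tendsto_intros X phase_tendsto_L2 vt[unfolded energy_space_iff])
    then have lim: "(\<lambda>n. B * \<bar>X n - t\<bar> + norm (?\<Lambda> (X n) - ?\<Lambda> t)) \<longlonglongrightarrow> 0" by simp
    have "norm (energy_norm (propagator (X n) (v (X n)) - propagator t (v t))) \<le> B * \<bar>X n - t\<bar> + norm (?\<Lambda> (X n) - ?\<Lambda> t)" for n
    proof -
      have Xn: "X n \<in> {-T..T}" using X(1) by blast
      \<comment> \<open>The two parts of this splitting: \<open>?a\<close> varies the state,
        \<open>?b\<close> the propagation time.\<close>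
      let ?a = "propagator (X n) (v (X n) - v t)" and ?b = "propagator (X n) (v t) - propagator t (v t)"
      have a: "fourier_ball (B * \<bar>X n - t\<bar>) ?a" by (intro fourier_ball_propagator lip Xn t)
      have nn: "0 \<le> B * \<bar>X n - t\<bar>" using B by simp
      have "energy_norm (?a + ?b) \<le> energy_norm ?a + energy_norm ?b"
        by (rule energy_norm_add(2)[OF fourier_ball_energy(1)[OF a nn] energy_propagator_diff(1)[OF vt]])
      also have "\<dots> \<le> B * \<bar>X n - t\<bar> + norm (?\<Lambda> (X n) - ?\<Lambda> t)"
        using fourier_ball_energy(2)[OF a nn] by (simp add: energy_propagator_diff(2)[OF vt])
      also have "?a + ?b = propagator (X n) (v (X n)) - propagator t (v t)" by (simp add: propagator_diff)
      finally show ?thesis using order_trans[OF norm_ge_zero norm_le_energy_norm] by simp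
    qed
    then show "(\<lambda>n. energy_norm (propagator (X n) (v (X n)) - propagator t (v t))) \<longlonglongrightarrow> 0"
      by (intro Lim_null_comparison[OF always_eventually lim]) auto
  qed
qed

text \<open>Approximation by step functions in time with error at most \<open>(1/2) ^ n\<close>: for every fixed time the
  approximations converge almost everywhere in space.\<close>

lemma spacetime_version_exists:
  assumes w: "continuous_on {-T..T} w" and T: "0 < T"
  shows "\<exists>U. spacetime_version T w U"
proof -
  have "uniformly_continuous_on {-T..T} w" by (rule compact_uniformly_continuous[OF w]) simp
  then have "\<forall>n. \<exists>d>0. \<forall>s\<in>{-T..T}. \<forall>t\<in>{-T..T}. dist s t < d \<longrightarrow> dist (w s) (w t) < (1/2) ^ n"
    unfolding uniformly_continuous_on_def by (metis zero_less_power half_gt_zero_iff zero_less_one)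
  then obtain d where d: "\<And>n. d n > 0"
    "\<And>n s t. s \<in> {-T..T} \<Longrightarrow> t \<in> {-T..T} \<Longrightarrow> dist s t < d n \<Longrightarrow> dist (w s) (w t) < (1/2) ^ n"
    by metis
  \<comment> \<open>Grid points of mesh \<open>d n / 2\<close>, pulled back into the interval on
    which \<open>w\<close> is controlled.\<close>
  define g where "g n j = max (-T) (min T (of_int j * (d n / 2)))" for n :: nat and j :: int
  \<comment> \<open>Each \<open>U n\<close> selects one of countably many fixed representatives
    through a measurable index. This gives joint measurability although \<open>rep_L2\<close>
    chooses its representatives with no regard to time.\<close>
  define U where "U n q = rep_L2 (w (g n \<lfloor>fst q / (d n / 2)\<rfloor>)) (snd q)" for n and q :: "real \<times> plane"
  have [measurable]: "U n \<in> borel_measurable borel" for n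
    unfolding U_def
  proof (rule measurable_compose_countable[where f = "\<lambda>j q. rep_L2 (w (g n j)) (snd q)"])
    show "(\<lambda>q. rep_L2 (w (g n j)) (snd q)) \<in> borel_measurable borel" for j :: int by measurable
    show "(\<lambda>q :: real \<times> plane. \<lfloor>fst q / (d n / 2)\<rfloor>) \<in> measurable borel (count_space UNIV)" by measurable
  qed
  define V where "V q = lim (\<lambda>n. U n q)" for q
  have "V \<in> borel_measurable borel" unfolding V_def by measurable
  moreover have "AE z in lborel. V (t, z) = rep_L2 (w t) z" if t: "t \<in> {-T..T}" for t
  proof -
    have "norm (w (g n \<lfloor>t / (d n / 2)\<rfloor>) - w t) \<le> (1/2) ^ n" for n
    proof -
      let ?j = "\<lfloor>t / (d n / 2)\<rfloor>"
      have e: "0 < d n / 2" using d(1)[of n] by simp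
      have "of_int ?j \<le> t / (d n / 2)" "t / (d n / 2) < of_int ?j + 1" by linarith+
      then have "of_int ?j * (d n / 2) \<le> t" "t < (of_int ?j + 1) * (d n / 2)"
        by (simp_all only: pos_le_divide_eq[OF e] pos_divide_less_eq[OF e])
      then have "of_int ?j * (d n / 2) \<le> t" "t < of_int ?j * (d n / 2) + d n / 2"
        by (simp_all only: distrib_right mult_1)
      then have "dist (g n ?j) t < d n" using t d(1)[of n] by (auto simp: g_def dist_real_def)
      moreover have "g n ?j \<in> {-T..T}" using T by (auto simp: g_def)
      ultimately show ?thesis using d(2)[of "g n ?j" t n] t by (simp add: dist_norm)
    qed
    from fast_conv_AE[OF this] show ?thesis
      by eventually_elim (auto simp: V_def U_def limI)
  qed
  ultimately have "spacetime_version T w V" unfolding spacetime_version_def by simp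
  then show ?thesis by blast
qed

text \<open>A version agrees with the path only on almost every slice. Setting it to
  \<open>0\<close> wherever it exceeds \<open>M\<close> changes nothing almost everywhere on such
  slices and makes the bound hold at every point.\<close>

lemma spacetime_boundedI:
  assumes w: "continuous_on {-T..T} w" and T: "0 < T"
    and bnd: "\<And>t. t \<in> {-T..T} \<Longrightarrow> AE z in lborel. norm (rep_L2 (w t) z) \<le> M" and M: "0 \<le> M"
  shows "spacetime_bounded T w"
proof -
  obtain U where U: "U \<in> borel_measurable lborel"
    "AE t in lborel. t \<in> {-T..T} \<longrightarrow> (AE z in lborel. U (t, z) = rep_L2 (w t) z)"
    using spacetime_version_exists[OF w T] by (auto simp: spacetime_version_def)
  define V where "V q = (if norm (U q) \<le> M then U q else 0)" for q
  have [measurable]: "U \<in> borel_measurable borel" using U(1) by simp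
  have "V \<in> borel_measurable borel" unfolding V_def by measurable
  moreover have "AE t in lborel. t \<in> {-T..T} \<longrightarrow> (AE z in lborel. V (t, z) = rep_L2 (w t) z)"
    using U(2)
  proof eventually_elim
    case (elim t)
    show ?case
    proof
      assume t: "t \<in> {-T..T}"
      from elim[THEN mp, OF t] bnd[OF t] show "AE z in lborel. V (t, z) = rep_L2 (w t) z"
        by eventually_elim (simp add: V_def)
    qed
  qed
  moreover have "norm (V q) \<le> M" for q using M by (simp add: V_def)
  ultimately show ?thesis unfolding spacetime_bounded_def spacetime_version_def
    by (intro exI[of _ V] conjI exI[of _ M]) auto
qed

lemma solution_exists:
  assumes u0: "fourier_ball R u0" and R: "0 \<le> R" and T: "0 < T" and \<mu>: "\<bar>\<mu>\<bar> = 1"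
    and T1: "T * ((9 * (2 * R)\<^sup>2) ^ k * (2 * R)) \<le> R"
    and T2: "T * (real (2 * k + 1) * (2 * R) ^ (2 * k)) \<le> 1 / 2"
  shows "\<exists>u. solution_in_class (2 * k + 1) \<mu> u0 T u"
proof -
  let ?c = "\<i> * complex_of_real \<mu>"
  obtain v where v: "continuous_on {-T..T} v" "\<And>t. t \<in> {-T..T} \<Longrightarrow> fourier_ball (2 * R) (v t)"
    "\<And>t. t \<in> {-T..T} \<Longrightarrow> v t = u0 - cscale ?c (oriented_integral (force k v) t)"
    using interaction_solution_exists[OF u0 R T _ T1 T2, of ?c] \<mu> by (auto simp: norm_mult)
  define u where "u t = propagator t (v t)" for t
  have R2: "0 \<le> 2 * R" using R by simp
  let ?B = "(9 * (2 * R)\<^sup>2) ^ k * (2 * R)"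
  have B: "0 \<le> ?B" using R by simp
  have u_ball: "fourier_ball (2 * R) (u t)" if "t \<in> {-T..T}" for t
    unfolding u_def by (intro fourier_ball_propagator v(2) that)
  have u_cont: "continuous_on {-T..T} u"
    unfolding u_def by (intro continuous_on_propagator continuous_intros v(1))
  have F1: "continuous_on {-T..T} (force k v)"
    by (rule force(1)[OF v(1,2) R2])
  have F2: "fourier_ball ?B (force k v \<tau>)" if "\<tau> \<in> {-T..T}" for \<tau>
    by (rule force(2)[OF v(1,2) R2 that])
  \<comment> \<open>An increment of \<open>v\<close> is an integral of \<open>force k v\<close>, all
    of whose values lie in one ball, so its radius is proportional to the elapsed time.\<close>
  have lip1: "fourier_ball (?B * (t - s)) (v t - v s)" if st: "s \<in> {-T..T}" "t \<in> {-T..T}" "s \<le> t" for s t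
  proof -
    have "fourier_ball ((t - s) * ?B) (integral {s..t} (force k v))"
      by (rule fourier_ball_integral_continuous[OF continuous_on_subset[OF F1] \<open>s \<le> t\<close> B F2]) (use st in auto)
    from fourier_ball_cscale[OF this, of "- ?c"]
    have *: "fourier_ball ((t - s) * ?B) (cscale (- ?c) (integral {s..t} (force k v)))"
      using \<mu> mult_nonneg_nonneg[OF _ B, of "t - s"] st(3) by (simp add: norm_mult)
    have lin: "cscale ?c x - cscale ?c y = cscale ?c (x - y)" for x y
      by (rule linear_diff[symmetric, OF bounded_linear.axioms(1)[OF bounded_linear_cscale]])
    have neg: "cscale (- ?c) w = - cscale ?c w" for w
      using scaleR_eq_cscale[of "-1" "cscale ?c w"] by (simp add: cscale_cscale)
    have "v t - v s = - (cscale ?c (oriented_integral (force k v) t) - cscale ?c (oriented_integral (force k v) s))"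
      using v(3)[OF st(1)] v(3)[OF st(2)] by simp
    also have "\<dots> = cscale (- ?c) (integral {s..t} (force k v))"
      unfolding lin neg oriented_integral_diff[OF F1 st] ..
    finally show ?thesis using * by (simp only: mult.commute)
  qed
  have lip: "fourier_ball (?B * \<bar>s - t\<bar>) (v s - v t)" if st: "s \<in> {-T..T}" "t \<in> {-T..T}" for s t
  proof (cases "t \<le> s")
    case True
    then show ?thesis using lip1[OF st(2,1)] by simp
  next
    case False
    then have "fourier_ball (?B * (t - s)) (v t - v s)" by (intro lip1 st) simp
    from fourier_ball_uminus[OF this mult_nonneg_nonneg[OF B]] False show ?thesis by (simp add: abs_if)
  qed
  have duhamel: "duhamel_solution (2 * k + 1) \<mu> u0 T u"
    unfolding duhamel_solution_def
  proof (intro ballI exI conjI)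
    fix t assume t: "t \<in> {-T..T}"
    let ?I = "propagator t (oriented_integral (force k v) t)"
    \<comment> \<open>By the group law, moving \<open>propagator t\<close> under the integral turns
      the interaction picture back into Duhamel's formula.\<close>
    have eq: "propagator t \<circ> force k v = (\<lambda>\<tau>. propagator (t - \<tau>) (power_nonlinearity (2 * k + 1) (u \<tau>)))"
      by (simp add: fun_eq_iff force_def propagator_propagator u_def)
    have "has_integral_from_zero (force k v) (oriented_integral (force k v) t) t"
      by (rule oriented_integral_has_integral[OF F1 t])
    then show "has_integral_from_zero (\<lambda>\<tau>. propagator (t - \<tau>) (power_nonlinearity (2 * k + 1) (u \<tau>))) ?I t"
      unfolding has_integral_from_zero_def eq[symmetric]
        linear_neg[OF bounded_linear.axioms(1)[OF bounded_linear_propagator], symmetric]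
      by (auto split: if_splits intro: has_integral_linear[OF _ bounded_linear_propagator])
    show "u t = propagator t u0 - cscale ?c ?I"
      unfolding u_def v(3)[OF t] propagator_diff propagator_cscale ..
  qed
  have energy: "continuous_into_energy T u"
    unfolding u_def by (rule continuous_into_energy_propagator[OF v(2) R2 lip B])
  have bounded: "spacetime_bounded T u"
    by (rule spacetime_boundedI[OF u_cont T fourier_ball_bounded[OF u_ball R2] R2])
  have "continuous_on {-T..T} (\<lambda>t. fourier (u t))"
    by (rule bounded_linear.continuous_on[OF bounded_linear_fourier u_cont])
  then have "fourier_bounded_in_L1 T u"
    unfolding fourier_bounded_in_L1_def
    using spacetime_version_exists[OF _ T] fourier_ball_L1[OF u_ball R2]
    by (intro conjI exI[of _ "2 * R"] AE_I2 impI) blast+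
  with duhamel energy bounded show ?thesis unfolding solution_in_class_def by blast
qed

section \<open>Uniqueness and the main theorem\<close>

lemma AE_lborel_negligible:
  assumes "AE x in lborel. P (x :: real)"
  shows "negligible {x. \<not> P x}"
proof -
  obtain N where N: "{x \<in> space lborel. \<not> P x} \<subseteq> N" "emeasure lborel N = 0" "N \<in> sets lborel"
    using assms by (rule AE_E)
  then have "N \<in> null_sets lebesgue" by (intro null_sets_completionI) (auto simp: null_sets_def)
  then have "negligible N" by (simp add: negligible_iff_null_sets)
  then show ?thesis by (rule negligible_subset) (use N(1) in auto)
qed

text \<open>A gauge integral ignores values on a negligible set, so \<open>f\<close> can be replaced
  by \<open>0\<close> where the bound fails; \<open>g0\<close> keeps the comparison valid at those
  points.\<close>

lemma norm_has_integral_le_AE: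
  fixes f :: "real \<Rightarrow> L2"
  assumes f: "(f has_integral I) {a..b}" and g: "(g has_integral J) {a..b}"
    and le: "AE x in lborel. x \<in> {a..b} \<longrightarrow> norm (f x) \<le> g x"
    and g0: "\<And>x. x \<in> {a..b} \<Longrightarrow> 0 \<le> g x"
  shows "norm I \<le> J"
proof -
  let ?N = "{x. \<not> (x \<in> {a..b} \<longrightarrow> norm (f x) \<le> g x)}"
  define f' where "f' x = (if x \<in> ?N then 0 else f x)" for x
  have N: "negligible ?N" by (rule AE_lborel_negligible[OF le])
  have f': "(f' has_integral I) {a..b}"
    by (rule has_integral_spike[OF N _ f]) (simp add: f'_def)
  have "norm (integral {a..b} f') \<le> integral {a..b} g"
    by (rule integral_norm_bound_integral)
       (use f' g g0 in \<open>auto simp: f'_def has_integral_integrable\<close>)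
  then show ?thesis using f' g by (simp add: integral_unique)
qed

text \<open>Fubini's theorem for null sets passes the bound on the product to almost every time
  slice. The maximum with \<open>0\<close> is taken because nothing makes the given essential bound
  nonnegative.\<close>

lemma solution_bounded:
  assumes "spacetime_bounded T u"
  obtains M where "0 \<le> M" "AE t in lborel. t \<in> {-T..T} \<longrightarrow> (AE z in lborel. norm (rep_L2 (u t) z) \<le> M)"
proof -
  obtain U M where U: "AE t in lborel. t \<in> {-T..T} \<longrightarrow> (AE z in lborel. U (t, z) = rep_L2 (u t) z)"
    and M: "AE q in lborel. fst q \<in> {-T..T} \<longrightarrow> norm (U q) \<le> M"
    using assms by (auto simp: spacetime_bounded_def spacetime_version_def)
  have "AE t in lborel. AE z in lborel. fst (t, z) \<in> {-T..T} \<longrightarrow> norm (U (t, z)) \<le> M"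
    by (rule lborel_pair.AE_pair) (simp only: lborel_prod M)
  with U have "AE t in lborel. t \<in> {-T..T} \<longrightarrow> (AE z in lborel. norm (rep_L2 (u t) z) \<le> max 0 M)"
  proof eventually_elim
    case (elim t)
    show ?case
    proof
      assume t: "t \<in> {-T..T}"
      from elim(1)[THEN mp, OF t] elim(2) show "AE z in lborel. norm (rep_L2 (u t) z) \<le> max 0 M"
        by eventually_elim (use t in auto)
    qed
  qed
  then show ?thesis by (rule that[rotated]) simp
qed

lemma continuous_into_energy_imp_continuous:
  assumes "continuous_into_energy T u"
  shows "continuous_on {-T..T} u"
  unfolding continuous_on_def
proof (intro ballI)
  fix t assume "t \<in> {-T..T}"
  then have "((\<lambda>s. energy_norm (u s - u t)) \<longlongrightarrow> 0) (at t within {-T..T})"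
    using assms by (simp add: continuous_into_energy_def)
  then have "((\<lambda>s. u s - u t) \<longlongrightarrow> 0) (at t within {-T..T})"
    by (rule Lim_null_comparison[rotated]) (simp add: norm_le_energy_norm)
  then show "(u \<longlongrightarrow> u t) (at t within {-T..T})" by (simp add: LIM_zero_iff)
qed

text \<open>Gronwall's lemma, proved by maximizing \<open>exp (- 2 L \<bar>t\<bar>) * D t\<close>: in this weighted norm the integral
  operator has norm at most \<open>1/2\<close>.\<close>

lemma gronwall_zero:
  fixes D :: "real \<Rightarrow> real"
  assumes D: "continuous_on {-T..T} D" "\<And>t. t \<in> {-T..T} \<Longrightarrow> 0 \<le> D t" and L: "0 < L"
    and bnd: "\<And>t A. t \<in> {-T..T} \<Longrightarrow> 0 \<le> A \<Longrightarrow> (\<And>\<tau>. \<tau> \<in> {-T..T} \<Longrightarrow> D \<tau> \<le> A * exp (2 * L * \<bar>\<tau>\<bar>)) \<Longrightarrow>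
      D t \<le> A / 2 * exp (2 * L * \<bar>t\<bar>)"
    and t: "t \<in> {-T..T}"
  shows "D t = 0"
proof -
  let ?E = "\<lambda>t. exp (- (2 * L * \<bar>t\<bar>)) * D t"
  have "continuous_on {-T..T} ?E" by (intro continuous_intros D(1))
  then obtain s where s: "s \<in> {-T..T}" "\<And>t. t \<in> {-T..T} \<Longrightarrow> ?E t \<le> ?E s"
    using continuous_attains_sup[of "{-T..T}" ?E] t by auto
  have le: "D \<tau> \<le> ?E s * exp (2 * L * \<bar>\<tau>\<bar>)" if "\<tau> \<in> {-T..T}" for \<tau>
  proof -
    have "?E \<tau> * exp (2 * L * \<bar>\<tau>\<bar>) \<le> ?E s * exp (2 * L * \<bar>\<tau>\<bar>)"
      by (rule mult_right_mono[OF s(2)[OF that]]) simp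
    then show ?thesis by (simp add: exp_minus field_simps)
  qed
  have E0: "0 \<le> ?E s" using D(2)[OF s(1)] by simp
  \<comment> \<open>At the maximizer the improved estimate reads
    \<open>D s \<le> D s / 2\<close>.\<close>
  have "D s \<le> ?E s / 2 * exp (2 * L * \<bar>s\<bar>)" by (rule bnd[OF s(1) E0 le])
  then have "D s \<le> D s / 2" by (simp add: exp_minus field_simps)
  then have "?E s = 0" using D(2)[OF s(1)] by simp
  then show ?thesis using le[OF t] D(2)[OF t] by simp
qed

text \<open>The source of the factor 1/2 in \<open>gronwall_zero\<close>: the exponential rate is
  twice the Lipschitz constant \<open>L\<close>, so integration gains \<open>1 / (2 * L)\<close>
  against the prefactor \<open>L\<close>.\<close>

lemma exp_integral_bound:
  fixes L A t :: real
  assumes "0 < L" "0 \<le> t"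
  shows "((\<lambda>\<tau>. L * (A * exp (2 * L * \<bar>\<tau>\<bar>))) has_integral A / 2 * (exp (2 * L * t) - 1)) {0..t}"
    "((\<lambda>\<tau>. L * (A * exp (2 * L * \<bar>\<tau>\<bar>))) has_integral A / 2 * (exp (2 * L * t) - 1)) {-t..0}"
proof -
  have "((\<lambda>\<tau>. L * (A * exp (2 * L * \<tau>))) has_integral A / 2 * exp (2 * L * t) - A / 2 * exp (2 * L * 0)) {0..t}"
    by (rule fundamental_theorem_of_calculus[OF \<open>0 \<le> t\<close>])
       (auto intro!: derivative_eq_intros simp: has_real_derivative_iff_has_vector_derivative[symmetric])
  then have 1: "((\<lambda>\<tau>. L * (A * exp (2 * L * \<tau>))) has_integral A / 2 * (exp (2 * L * t) - 1)) {0..t}"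
    by (simp add: right_diff_distrib)
  show 2: "((\<lambda>\<tau>. L * (A * exp (2 * L * \<bar>\<tau>\<bar>))) has_integral A / 2 * (exp (2 * L * t) - 1)) {0..t}"
    by (rule has_integral_eq[OF _ 1]) simp
  have "((\<lambda>\<tau>. L * (A * exp (2 * L * \<bar>- \<tau>\<bar>))) has_integral A / 2 * (exp (2 * L * t) - 1)) {- t..- 0}"
    by (rule iffD2[OF has_integral_reflect_real[of _ _ t 0]]) (use 2 in simp)
  then show "((\<lambda>\<tau>. L * (A * exp (2 * L * \<bar>\<tau>\<bar>))) has_integral A / 2 * (exp (2 * L * t) - 1)) {-t..0}"
    by simp
qed

lemma solution_unique:
  assumes u: "solution_in_class (2 * k + 1) \<mu> u0 T u" and v: "solution_in_class (2 * k + 1) \<mu> u0 T v"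
    and \<mu>: "\<bar>\<mu>\<bar> = 1" and t: "t \<in> {-T..T}"
  shows "u t = v t"
proof -
  let ?N = "power_nonlinearity (2 * k + 1)"
  obtain M1 where M1: "0 \<le> M1" "AE t in lborel. t \<in> {-T..T} \<longrightarrow> (AE z in lborel. norm (rep_L2 (u t) z) \<le> M1)"
    using u solution_bounded by (auto simp: solution_in_class_def)
  obtain M2 where M2: "0 \<le> M2" "AE t in lborel. t \<in> {-T..T} \<longrightarrow> (AE z in lborel. norm (rep_L2 (v t) z) \<le> M2)"
    using v solution_bounded by (auto simp: solution_in_class_def)
  define M where "M = max M1 M2"
  \<comment> \<open>The summand \<open>1\<close> makes \<open>L\<close> positive even if both
    solutions are bounded by \<open>0\<close>.\<close>
  define L where "L = real (2 * k + 1) * M ^ (2 * k) + 1"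
  have M: "0 \<le> M" using M1(1) by (simp add: M_def)
  have L: "0 < L" unfolding L_def using M by (intro add_nonneg_pos mult_nonneg_nonneg) auto
  have lip: "AE \<tau> in lborel. \<tau> \<in> {-T..T} \<longrightarrow> norm (?N (u \<tau>) - ?N (v \<tau>)) \<le> L * norm (u \<tau> - v \<tau>)"
    using M1(2) M2(2)
  proof eventually_elim
    case (elim \<tau>)
    show ?case
    proof
      assume \<tau>: "\<tau> \<in> {-T..T}"
      have "AE z in lborel. norm (rep_L2 (u \<tau>) z) \<le> M" "AE z in lborel. norm (rep_L2 (v \<tau>) z) \<le> M"
        using elim[THEN mp, OF \<tau>] unfolding M_def by (auto elim: eventually_mono)
      from nonlinearity_lipschitz[OF this M, of k]
      have "norm (?N (u \<tau>) - ?N (v \<tau>)) \<le> real (2 * k + 1) * M ^ (2 * k) * norm (u \<tau> - v \<tau>)" .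
      also have "\<dots> \<le> L * norm (u \<tau> - v \<tau>)" unfolding L_def by (intro mult_right_mono) auto
      finally show "norm (?N (u \<tau>) - ?N (v \<tau>)) \<le> L * norm (u \<tau> - v \<tau>)" .
    qed
  qed
  define D where "D t = norm (u t - v t)" for t
  have "D t = 0"
  proof (rule gronwall_zero[OF _ _ L _ t])
    \<comment> \<open>Continuity in the energy norm is used only here, to let the weighted distance
      attain its maximum.\<close>
    show "continuous_on {-T..T} D" unfolding D_def
      using u v by (intro continuous_intros continuous_into_energy_imp_continuous) (auto simp: solution_in_class_def)
    show "0 \<le> D t" for t by (simp add: D_def)
    fix t A
    assume t: "t \<in> {-T..T}" and A: "0 \<le> A" and le: "\<And>\<tau>. \<tau> \<in> {-T..T} \<Longrightarrow> D \<tau> \<le> A * exp (2 * L * \<bar>\<tau>\<bar>)"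
    let ?g = "\<lambda>\<tau>. L * (A * exp (2 * L * \<bar>\<tau>\<bar>))"
    let ?f = "\<lambda>w \<tau>. propagator (t - \<tau>) (?N (w \<tau>))"
    have bnd: "AE \<tau> in lborel. \<tau> \<in> {-T..T} \<longrightarrow> norm (?f u \<tau> - ?f v \<tau>) \<le> ?g \<tau>"
      using lip
    proof eventually_elim
      case (elim \<tau>)
      show ?case
      proof
        assume \<tau>: "\<tau> \<in> {-T..T}"
        have "norm (?f u \<tau> - ?f v \<tau>) \<le> L * D \<tau>"
          using elim \<tau> by (simp add: propagator_diff[symmetric] norm_propagator D_def)
        also have "\<dots> \<le> ?g \<tau>" using le[OF \<tau>] L by (intro mult_left_mono) auto
        finally show "norm (?f u \<tau> - ?f v \<tau>) \<le> ?g \<tau>" .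
      qed
    qed
    have g0: "0 \<le> ?g \<tau>" for \<tau> using L A by simp
    obtain I where I: "has_integral_from_zero (?f u) I t" "u t = propagator t u0 - cscale (\<i> * of_real \<mu>) I"
      using u t unfolding solution_in_class_def duhamel_solution_def by blast
    obtain I' where I': "has_integral_from_zero (?f v) I' t" "v t = propagator t u0 - cscale (\<i> * of_real \<mu>) I'"
      using v t unfolding solution_in_class_def duhamel_solution_def by blast
    have lin: "cscale c x - cscale c y = cscale c (x - y)" for c x y
      by (rule linear_diff[symmetric, OF bounded_linear.axioms(1)[OF bounded_linear_cscale]])
    have "D t = norm (cscale (\<i> * of_real \<mu>) (I' - I))"
      unfolding D_def I(2) I'(2) lin[symmetric] by simp
    then have Dt: "D t = norm (I - I')" using \<mu> by (simp add: norm_cscale norm_mult norm_minus_commute)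
    also have "norm (I - I') \<le> A / 2 * (exp (2 * L * \<bar>t\<bar>) - 1)"
    proof (cases "0 \<le> t")
      case True
      have "((\<lambda>\<tau>. ?f u \<tau> - ?f v \<tau>) has_integral I - I') {0..t}"
        using I(1) I'(1) True by (intro has_integral_diff) (auto simp: has_integral_from_zero_def)
      moreover have "(?g has_integral A / 2 * (exp (2 * L * t) - 1)) {0..t}" by (rule exp_integral_bound(1)[OF L True])
      moreover have "AE \<tau> in lborel. \<tau> \<in> {0..t} \<longrightarrow> norm (?f u \<tau> - ?f v \<tau>) \<le> ?g \<tau>"
        using bnd by eventually_elim (use t in auto)
      ultimately have "norm (I - I') \<le> A / 2 * (exp (2 * L * t) - 1)"
        using g0 by (rule norm_has_integral_le_AE)
      then show ?thesis using True by simp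
    next
      case False
      then have nt: "0 \<le> - t" by simp
      have "((\<lambda>\<tau>. ?f u \<tau> - ?f v \<tau>) has_integral - I - - I') {t..0}"
        using I(1) I'(1) False by (intro has_integral_diff) (auto simp: has_integral_from_zero_def)
      moreover have "(?g has_integral A / 2 * (exp (2 * L * (- t)) - 1)) {t..0}"
        using exp_integral_bound(2)[OF L nt] by simp
      moreover have "AE \<tau> in lborel. \<tau> \<in> {t..0} \<longrightarrow> norm (?f u \<tau> - ?f v \<tau>) \<le> ?g \<tau>"
        using bnd by eventually_elim (use t in auto)
      ultimately have "norm (- I - - I') \<le> A / 2 * (exp (2 * L * (- t)) - 1)"
        using g0 by (rule norm_has_integral_le_AE)
      then show ?thesis using False by (simp add: norm_minus_commute)
    qed
    also have "\<dots> \<le> A / 2 * exp (2 * L * \<bar>t\<bar>)" using A by (intro mult_left_mono) auto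
    finally show "D t \<le> A / 2 * exp (2 * L * \<bar>t\<bar>)" .
  qed
  then show ?thesis by (simp add: D_def)
qed

theorem theorem1p1:
  fixes k p :: nat and \<mu> :: real
  assumes "k \<ge> 1" and "p = 2 * k + 1" and "\<mu> \<in> {1, -1}"
  shows "\<exists>T :: real \<Rightarrow> real \<Rightarrow> real. \<forall>u0 \<in> energy_space. fourier_in_L1 u0 \<longrightarrow>
           (let T0 = T (energy_norm u0) (fourier_L1_norm u0) in
              T0 > 0 \<and>
              (\<exists>u. solution_in_class p \<mu> u0 T0 u) \<and>
              (\<forall>u v. solution_in_class p \<mu> u0 T0 u \<longrightarrow> solution_in_class p \<mu> u0 T0 v \<longrightarrow>
                 (\<forall>t\<in>{-T0..T0}. u t = v t)))"
proof -
  \<comment> \<open>At the actual norms \<open>R\<close> dominates both of them; the absolute values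
    and the summand \<open>1\<close> keep it positive for all real arguments, hence \<open>T\<close>
    as well.\<close>
  define R where "R a b = \<bar>a\<bar> + \<bar>b\<bar> + 1" for a b :: real
  define B where "B r = (9 * (2 * r)\<^sup>2) ^ k * (2 * r)" for r :: real
  define L where "L r = real (2 * k + 1) * (2 * r) ^ (2 * k)" for r :: real
  \<comment> \<open>\<open>B\<close> bounds the nonlinearity and \<open>L\<close> its Lipschitz
    constant on the ball of radius twice the argument. The first entry keeps the Duhamel term within
    radius \<open>R\<close>, the second makes the contraction constant 1/2.\<close>
  define T where "T a b = min (R a b / B (R a b)) (1 / (2 * L (R a b)))" for a b
  have \<mu>: "\<bar>\<mu>\<bar> = 1" using assms(3) by auto
  have R: "0 < R a b" for a b by (simp add: R_def)
  have B: "0 < B r" and L: "0 < L r" if "0 < r" for r using that by (simp_all add: B_def L_def)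
  have T: "0 < T a b" for a b using B[OF R] L[OF R] R by (simp add: T_def)
  show ?thesis
  proof (intro exI[of _ T] ballI impI)
    fix u0 assume u0: "u0 \<in> energy_space" "fourier_in_L1 u0"
    define a where "a = energy_norm u0"
    define b where "b = fourier_L1_norm u0"
    have ball: "fourier_ball (R a b) u0"
      by (rule fourier_ballI[OF u0]) (auto simp: R_def a_def b_def)
    have "T a b * B (R a b) \<le> R a b / B (R a b) * B (R a b)"
      using B[OF R] by (intro mult_right_mono) (auto simp: T_def less_imp_le)
    then have T1: "T a b * B (R a b) \<le> R a b" using B[OF R, of a b] by simp
    have "T a b * L (R a b) \<le> 1 / (2 * L (R a b)) * L (R a b)"
      using L[OF R] by (intro mult_right_mono) (auto simp: T_def less_imp_le)
    then have T2: "T a b * L (R a b) \<le> 1 / 2" using L[OF R, of a b] by simp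
    have "\<exists>u. solution_in_class p \<mu> u0 (T a b) u"
      unfolding assms(2)
      by (rule solution_exists[OF ball less_imp_le[OF R] T \<mu> T1[unfolded B_def] T2[unfolded L_def]])
    then show "let T0 = T (energy_norm u0) (fourier_L1_norm u0) in T0 > 0 \<and>
        (\<exists>u. solution_in_class p \<mu> u0 T0 u) \<and>
        (\<forall>u v. solution_in_class p \<mu> u0 T0 u \<longrightarrow> solution_in_class p \<mu> u0 T0 v \<longrightarrow> (\<forall>t\<in>{-T0..T0}. u t = v t))"
      using T solution_unique[OF _ _ \<mu>] unfolding Let_def a_def b_def assms(2) by blast
  qed
qed

end
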